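(* Let $A=\mathbb{k}Q/I$ be a toupie algebra, let $\{\Delta_n\}$ be the $A_\infty$-coalgebra structure on $\mathbb{T}_*=\mathrm{Tor}^A_*(E,E)$ transferred from the DG associative coalgebra $(\mathbb{B}'_*,d,\Delta')$ as described in the context, let $n\ge3$, and let $\gamma$ be an $r$-chain in $\mathbb{T}_*$ ($r\ge 0$). When $\gamma$ does not contain non monomial relations, $$\Delta_n(\gamma)=\sum(-1)^N\gamma_1\otimes\cdots\otimes\gamma_n,\qquad N=r_1+\sum_{i=1}^{n-1}(n-i)r_i,$$ where the sum is over all decompositions $(\gamma_1,\dots,\gamma_n)$ of $\gamma$, with $\gamma_i$ an $r_i$-chain for all $1\le i\le n$. When $\gamma=[w_0|w_1]$ with $w_0w_1\in\mathrm{Tip}\,\mathcal{G}_{nomon}$, $$\Delta_n(\gamma)=\sum_{a_1\cdots a_n\in\mathrm{Supp}(\mathrm{Tip}^{-1}(w_0w_1))}c(a_1\cdots a_n)\,a_1\otimes\cdots\otimes a_n$$ with $a_1,\dots,a_n\in Q_1$.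
   Context: $\mathbb{k}$ is a field of characteristic zero, $\otimes=\otimes_{\mathbb{k}}$, Koszul sign rule. Paths are written from left to right, $Q$ also denotes the set of paths, $Q_n$ the paths of length $n$, $l(p)$ the length, $E=\mathbb{k}Q_0$. $\mathrm{Supp}(a)$ is the set of paths occurring in $a\in\mathbb{k}Q$ with nonzero coefficient. **Toupie algebras.** A finite quiver $Q$ is toupie if it has a unique source $0$ and a unique sink $\omega$ and every other vertex is the source of exactly one arrow and the target of exactly one arrow. A toupie algebra is $A=\mathbb{k}Q/I$ with $Q$ toupie and $I$ admissible. Branches are the paths from $0$ to $\omega$; they are ordered as $B_1$ (arrows, $\alpha^{(1)},\dots,\alpha^{(a)}$), $B_2$ (length $>1$, involved in no relation, next $l$ ones), $B_3$ (containing monomial relations, next $m$ ones), $B_4=\{\alpha^{(a+l+m+1)},\dots,\alpha^{(a+l+m+n)}\}$ (involved in non monomial relations, listed with non-increasing lengths). The non monomial relations are taken in reduced row echelon form: $\rho_i=\alpha^{(a+l+m+k_i)}+\sum_{j>k_i}a_{ij}\alpha^{(a+l+m+j)}$, $1\le i\le r$ (coefficient matrix reduced of rank $r$). $\mathrm{Tip}(\rho_i)=\alpha^{(a+l+m+k_i)}$, $\mathrm{Tip}^{-1}(\alpha^{(a+l+m+k_i)})=\rho_i$, and $c(\cdot)$ denotes the coefficient of a branch in $\rho_i$. $\mathcal{G}=\mathcal{G}_{mon}\sqcup\mathcal{G}_{nomon}$ is a minimal generating set of $I$ with $\mathcal{G}_{nomon}=\{\rho_i\}$ and $\mathcal{G}_{mon}$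 consisting of paths; $\mathrm{Tip}\,\mathcal{G}_{nomon}=\{\mathrm{Tip}(\rho_i)\}$. $W=\mathrm{Tip}\,\mathcal{G}=\mathcal{G}_{mon}\cup\mathrm{Tip}\,\mathcal{G}_{nomon}$, and $\mathrm{NonTip}(I)$ is the set of paths having no subpath in $W$; it gives a basis of $A$. **Chains.** The Uf-graph $Q_W$ has vertex set $Q_0\cup Q_1\cup\{\text{proper right factors of elements of }W\}$ and arrows $e\to x$ for $e\in Q_0$, $x=ex\in Q_1$, and $u\to v$ whenever the path $uv$ lies in $\langle W\rangle$ but every proper left factor of $uv$ does not. $W^{(i)}$, the set of $i$-chains ($i\ge0$), consists of the sequences $[w_1|\cdots|w_{i+1}]$ with $w_k\in\mathrm{NonTip}(I)\setminus Q_0$ such that $e\to w_1\to\cdots\to w_{i+1}$ is a path in $Q_W$; $W^{(-1)}=Q_0$. A chain $[w_1|\cdots|w_{i+1}]$ is identified with the path $w_1\cdots w_{i+1}$. $V_{q,i}^{(n)}$ is the set of $[w_1|\cdots|w_n]$ with $w_1\cdots w_n=q$, $[w_1|\cdots|w_{i+1}]\in W^{(i)}$ and $[w_1|\cdots|w_{i+2}]\notin W^{(i+1)}$. A chain contains a non monomial relation if its path has a subpath in $\mathrm{Tip}\,\mathcal{G}_{nomon}$. A decomposition $(\gamma_1,\dots,\gamma_n)$ of an $r$-chain $\gamma$ consists of $r_i$-chains $\gamma_i$ ($r_i\ge0$) with $\gamma=\gamma_1\cdots\gamma_n$ as paths and $r=r_1+\cdots+r_n+1$. **Complexes and maps.**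 $\mathbb{B}'_*=E\otimes_A\mathbb{B}_*\otimes_AE$, where $\mathbb{B}_*$ is the reduced bar resolution of $A$; $\mathbb{B}'_n$ ($n\ge1$) has as basis the bar terms $[a_1|\cdots|a_n]$ with $a_j\in\mathrm{NonTip}(I)\setminus Q_0$ and $a_1\cdots a_n$ a path, with $d([a_1|\cdots|a_n])=\sum_{j=1}^{n-1}(-1)^j[a_1|\cdots|a_ja_{j+1}|\cdots|a_n]$ (products in $A$) and $\Delta'([a_1|\cdots|a_n])=\sum_{j=1}^{n-1}[a_1|\cdots|a_j]\otimes[a_{j+1}|\cdots|a_n]$. Let $G$ be the quiver with vertices the bar terms and an arrow $x\to y$ weighted by the nonzero coefficient of $y$ in $d(x)$. $\mathcal{M}$ is the set of arrows $[w_1|\cdots|w_{i+1}|w'_{i+2}|w''_{i+2}|w_{i+3}|\cdots|w_n]\to[w_1|\cdots|w_{i+2}|\cdots|w_n]$ with $w_{i+2}=w'_{i+2}w''_{i+2}$, source in $V_{q,i+1}^{(n+1)}$ and target in $V_{q,i}^{(n)}$, $q=w_1\cdots w_n$; it is a Morse matching whose critical vertices (those on no arrow of $\mathcal{M}$) in degree $n$ are $W^{(n-1)}$. Reverse each arrow of $\mathcal{M}$ (making it dotted) and replace its weight by the negative inverse; a zigzag path is one in which dotted and undotted arrows alternate (trivial paths allowed, weight $1$), and its weight is the product of the weights of its arrows. $\mathbb{T}_n=\mathbb{k}W^{(n-1)}$, with zero differential; an $r$-chain has degree $r+1$. For a bar term $x$ of degree $n$: $p(x)\in\mathbb{T}_n$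 is the sum over critical $y$ of degree $n$, and $h(x)\in\mathbb{B}'_{n+1}$ the sum over all $y$ of degree $n+1$, of $y$ times the total weight of zigzag paths from $x$ to $y$; for critical $x$, $i(x)\in\mathbb{B}'_n$ is the same sum over all $y$ of degree $n$. **Transferred structure.** An $A_\infty$-coalgebra is a graded space $V$ with maps $\Delta_n:V\to V^{\otimes n}$ of degree $n-2$ with $\sum_{r+s+t=n,\,r,t\ge0,\,s\ge1}(-1)^{r+st}(\mathrm{Id}^{\otimes r}\otimes\Delta_s\otimes\mathrm{Id}^{\otimes t})\Delta_{r+1+t}=0$ for all $n\ge1$. On $\mathbb{B}'_*$ set $\Delta^{\mathbb{B}'}_2=\Delta'$ and, for $n\ge3$, $\Delta^{\mathbb{B}'}_n=\sum_{s+t=n,\,s,t>0}(-1)^{s(t+1)}(\Delta^{\mathbb{B}'}_sh\otimes\Delta^{\mathbb{B}'}_th)\Delta'$ with the convention $\Delta^{\mathbb{B}'}_1h=\mathrm{Id}$. The structure on $\mathbb{T}_*$ is $\Delta_1=0$ and $\Delta_n=p^{\otimes n}\Delta^{\mathbb{B}'}_n\,i$ for $n\ge2$. *)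

theory Defs
  imports
    "Graph_Theory.Graph_Theory"
    "HOL-Algebra.QuotRing"
    "HOL-Library.Poly_Mapping"
begin

text \<open>
  Conventions.  A vector space with basis \<open>'x\<close> over \<open>'k\<close> is the type \<open>'x \<Rightarrow>\<^sub>0 'k\<close> of finitely
  supported functions, and \<open>Supp\<close> is \<^const>\<open>Poly_Mapping.keys\<close>.  The \<open>n\<close>-th tensor power (over the
  ground field) of the space with basis \<open>'x\<close> has as basis the lists of length \<open>n\<close> over \<open>'x\<close>.
\<close>

definition smul :: "'k::semiring_0 \<Rightarrow> ('x \<Rightarrow>\<^sub>0 'k) \<Rightarrow> ('x \<Rightarrow>\<^sub>0 'k)" where
  "smul c x = Poly_Mapping.map ((*) c) x"

definition lin :: "('x \<Rightarrow> ('y \<Rightarrow>\<^sub>0 'k)) \<Rightarrow> ('x \<Rightarrow>\<^sub>0 'k) \<Rightarrow> ('y \<Rightarrow>\<^sub>0 'k::semiring_0)" where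
  "lin f x = (\<Sum>b\<in>Poly_Mapping.keys x. smul (Poly_Mapping.lookup x b) (f b))"

definition tens :: "('x list \<Rightarrow>\<^sub>0 'k) \<Rightarrow> ('x list \<Rightarrow>\<^sub>0 'k) \<Rightarrow> ('x list \<Rightarrow>\<^sub>0 'k::semiring_0)" where
  "tens x y = (\<Sum>a\<in>Poly_Mapping.keys x. \<Sum>b\<in>Poly_Mapping.keys y.
     Poly_Mapping.single (a @ b) (Poly_Mapping.lookup x a * Poly_Mapping.lookup y b))"

definition tensor_power :: "('x \<Rightarrow> ('y \<Rightarrow>\<^sub>0 'k)) \<Rightarrow> 'x list \<Rightarrow> ('y list \<Rightarrow>\<^sub>0 'k::semiring_1)" where
  "tensor_power f as =
     foldr (\<lambda>a t. tens (lin (\<lambda>b. Poly_Mapping.single [b] 1) (f a)) t) as (Poly_Mapping.single [] 1)"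


section \<open>Paths and the path algebra\<close>

text \<open>
  A path is a pair of its starting vertex and its list of arrows, written from left to right; the
  starting vertex is recorded because of the trivial paths \<open>(v, [])\<close>.  A bar term
  \<open>[w\<^sub>1|\<dots>|w\<^sub>n]\<close> is likewise \<open>(v, [w\<^sub>1, \<dots>, w\<^sub>n])\<close> with \<open>v\<close> the source of \<open>w\<^sub>1\<close>, so that in degree
  \<open>0\<close> the terms \<open>(v, [])\<close> are the vertices.
\<close>

type_synonym ('a, 'b) qpath = "'a \<times> 'b list"
type_synonym ('a, 'b) bar = "'a \<times> ('a, 'b) qpath list"

definition pcat :: "('a, 'b) qpath \<Rightarrow> ('a, 'b) qpath \<Rightarrow> ('a, 'b) qpath" where
  "pcat p q = (fst p, snd p @ snd q)"

definition pconcat :: "'a \<Rightarrow> ('a, 'b) qpath list \<Rightarrow> ('a, 'b) qpath" where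
  "pconcat x ps = (x, concat (map snd ps))"

definition bar_path :: "('a, 'b) bar \<Rightarrow> ('a, 'b) qpath" where
  "bar_path t = pconcat (fst t) (snd t)"

definition bar_degree :: "('a, 'b) bar \<Rightarrow> nat" where
  "bar_degree t = length (snd t)"

text \<open>The \<open>r\<close> for which a term of positive degree can be an \<open>r\<close>-chain.\<close>
definition chain_index :: "('a, 'b) bar \<Rightarrow> nat" where
  "chain_index \<delta> = bar_degree \<delta> - 1"

text \<open>
  With the list positions counted from \<open>0\<close>: \<open>r\<^sub>i\<close> belongs to the entry at position \<open>i - 1\<close>.
\<close>
definition sign_exponent :: "nat \<Rightarrow> ('a, 'b) bar list \<Rightarrow> nat" where
  "sign_exponent n \<delta>s =
     chain_index (\<delta>s ! 0) + (\<Sum>i = 1..n - 1. (n - i) * chain_index (\<delta>s ! (i - 1)))"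

definition of_path :: "('a, 'b) qpath \<Rightarrow> (('a, 'b) qpath \<Rightarrow>\<^sub>0 'k::zero_neq_one)" where
  "of_path p = Poly_Mapping.single p 1"

definition proper_left_factor :: "('a, 'b) qpath \<Rightarrow> ('a, 'b) qpath \<Rightarrow> bool" where
  "proper_left_factor q p \<longleftrightarrow> (\<exists>ys. ys \<noteq> [] \<and> p = (fst q, snd q @ ys))"

context pre_digraph
begin

definition qpaths :: "('a, 'b) qpath set" where
  "qpaths = {(x, as). \<exists>y. awalk x as y}"

definition tgt :: "('a, 'b) qpath \<Rightarrow> 'a" where
  "tgt p = awlast (fst p) (snd p)"

definition proper_right_factor :: "('a, 'b) qpath \<Rightarrow> ('a, 'b) qpath \<Rightarrow> bool" where
  "proper_right_factor s p \<longleftrightarrow>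
     (\<exists>xs. xs \<noteq> [] \<and> snd p = xs @ snd s \<and> fst s = tgt (fst p, xs))"

definition subpath :: "('a, 'b) qpath \<Rightarrow> ('a, 'b) qpath \<Rightarrow> bool" where
  "subpath s p \<longleftrightarrow> (\<exists>xs ys. snd p = xs @ snd s @ ys \<and> fst s = tgt (fst p, xs))"

fun composable :: "'a \<Rightarrow> ('a, 'b) qpath list \<Rightarrow> bool" where
  "composable x [] \<longleftrightarrow> True"
| "composable x (p # ps) \<longleftrightarrow> fst p = x \<and> composable (tgt p) ps"

definition arrow_chain :: "'b \<Rightarrow> ('a, 'b) bar" where
  "arrow_chain a = (tail G a, [(tail G a, [a])])"

definition path_mult ::
  "(('a, 'b) qpath \<Rightarrow>\<^sub>0 'k) \<Rightarrow> (('a, 'b) qpath \<Rightarrow>\<^sub>0 'k) \<Rightarrow> (('a, 'b) qpath \<Rightarrow>\<^sub>0 'k::semiring_0)" where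
  "path_mult x y = (\<Sum>p\<in>Poly_Mapping.keys x. \<Sum>q\<in>Poly_Mapping.keys y.
     if tgt p = fst q
     then Poly_Mapping.single (pcat p q) (Poly_Mapping.lookup x p * Poly_Mapping.lookup y q)
     else 0)"

definition path_algebra :: "(('a, 'b) qpath \<Rightarrow>\<^sub>0 'k::field) ring" where
  "path_algebra =
     \<lparr>carrier = {x. Poly_Mapping.keys x \<subseteq> qpaths},
      monoid.mult = path_mult,
      one = (\<Sum>v\<in>verts G. of_path (v, [])),
      zero = 0,
      add = (+)\<rparr>"

text \<open>The \<open>n\<close>-th power of the ideal generated by the arrows.\<close>
definition arrow_power :: "nat \<Rightarrow> (('a, 'b) qpath \<Rightarrow>\<^sub>0 'k::field) set" where
  "arrow_power n = {x \<in> carrier path_algebra. \<forall>p\<in>Poly_Mapping.keys x. n \<le> length (snd p)}"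

definition admissible :: "(('a, 'b) qpath \<Rightarrow>\<^sub>0 'k::field) set \<Rightarrow> bool" where
  "admissible I \<longleftrightarrow>
     ideal I path_algebra \<and> I \<subseteq> arrow_power 2 \<and> (\<exists>n\<ge>2. arrow_power n \<subseteq> I)"

end


subsection \<open>The path algebra of a finite quiver is a ring\<close>

lemma path_mult_superset:
  fixes x y :: "('a, 'b) qpath \<Rightarrow>\<^sub>0 'k::semiring_0"
  assumes "finite A" "Poly_Mapping.keys x \<subseteq> A" "finite B" "Poly_Mapping.keys y \<subseteq> B"
  shows "pre_digraph.path_mult G x y = (\<Sum>p\<in>A. \<Sum>q\<in>B.
     if pre_digraph.tgt G p = fst q
     then Poly_Mapping.single (pcat p q) (Poly_Mapping.lookup x p * Poly_Mapping.lookup y q)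
     else 0)"
proof -
  let ?f = "\<lambda>p q. if pre_digraph.tgt G p = fst q
     then Poly_Mapping.single (pcat p q) (Poly_Mapping.lookup x p * Poly_Mapping.lookup y q) else 0"
  have "(\<Sum>p\<in>A. \<Sum>q\<in>B. ?f p q) = (\<Sum>p\<in>A. \<Sum>q\<in>Poly_Mapping.keys y. ?f p q)"
    using assms by (intro sum.cong refl sum.mono_neutral_right) (auto simp: in_keys_iff)
  also have "\<dots> = (\<Sum>p\<in>Poly_Mapping.keys x. \<Sum>q\<in>Poly_Mapping.keys y. ?f p q)"
    using assms by (intro sum.mono_neutral_right) (auto simp: in_keys_iff intro!: sum.neutral)
  finally show ?thesis by (simp add: pre_digraph.path_mult_def)
qed

lemma path_mult_add_left:
  "pre_digraph.path_mult G (x + y) z = pre_digraph.path_mult G x z + pre_digraph.path_mult G y z"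
proof -
  let ?A = "Poly_Mapping.keys x \<union> Poly_Mapping.keys y" and ?B = "Poly_Mapping.keys z"
  show ?thesis
    by (subst (1 2 3) path_mult_superset[where A = ?A and B = ?B])
      (use Poly_Mapping.keys_add[of x y] in \<open>auto simp: lookup_add distrib_right single_add
        sum.distrib[symmetric] intro!: sum.cong\<close>)
qed

lemma path_mult_add_right:
  "pre_digraph.path_mult G z (x + y) = pre_digraph.path_mult G z x + pre_digraph.path_mult G z y"
proof -
  let ?A = "Poly_Mapping.keys x \<union> Poly_Mapping.keys y" and ?B = "Poly_Mapping.keys z"
  show ?thesis
    by (subst (1 2 3) path_mult_superset[where A = ?B and B = ?A])
      (use Poly_Mapping.keys_add[of x y] in \<open>auto simp: lookup_add distrib_left single_add
        sum.distrib[symmetric] intro!: sum.cong\<close>)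
qed

lemma path_mult_0 [simp]: "pre_digraph.path_mult G 0 z = 0" "pre_digraph.path_mult G z 0 = 0"
  by (simp_all add: pre_digraph.path_mult_def)

lemma path_mult_sum_left:
  "pre_digraph.path_mult G (sum f A) z = (\<Sum>a\<in>A. pre_digraph.path_mult G (f a) z)"
  by (induction A rule: infinite_finite_induct) (auto simp: path_mult_add_left)

lemma path_mult_sum_right:
  "pre_digraph.path_mult G z (sum f A) = (\<Sum>a\<in>A. pre_digraph.path_mult G z (f a))"
  by (induction A rule: infinite_finite_induct) (auto simp: path_mult_add_right)

lemma path_mult_single:
  "pre_digraph.path_mult G (Poly_Mapping.single p c) (Poly_Mapping.single q d) =
     (if pre_digraph.tgt G p = fst q then Poly_Mapping.single (pcat p q) (c * d) else 0)"
  by (subst path_mult_superset[where A = "{p}" and B = "{q}"]) auto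

lemma tgt_pcat: "pre_digraph.tgt G p = fst q \<Longrightarrow> pre_digraph.tgt G (pcat p q) = pre_digraph.tgt G q"
proof -
  have *: "last (pre_digraph.awalk_verts G u (as @ bs)) =
     last (pre_digraph.awalk_verts G (last (pre_digraph.awalk_verts G u as)) bs)" for u as bs
  proof (induction as arbitrary: u)
    case Nil
    then show ?case by (simp add: pre_digraph.awalk_verts.simps)
  next
    case (Cons a as)
    have ne: "pre_digraph.awalk_verts G v cs \<noteq> []" for v cs
      by (cases cs) (auto simp: pre_digraph.awalk_verts.simps)
    show ?case by (simp add: pre_digraph.awalk_verts.simps ne Cons.IH)
  qed
  show "pre_digraph.tgt G p = fst q \<Longrightarrow> pre_digraph.tgt G (pcat p q) = pre_digraph.tgt G q"
    by (simp add: pre_digraph.tgt_def pcat_def *)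
qed

lemma path_mult_assoc:
  "pre_digraph.path_mult G (pre_digraph.path_mult G x y) z =
   pre_digraph.path_mult G x (pre_digraph.path_mult G y z)"
proof -
  have rep: "u = (\<Sum>p\<in>Poly_Mapping.keys u. Poly_Mapping.single p (Poly_Mapping.lookup u p))"
    for u :: "('a, 'b) qpath \<Rightarrow>\<^sub>0 'k::semiring_0"
    by (rule poly_mapping_eqI)
      (auto simp: lookup_sum lookup_single in_keys_iff when_def if_distrib cong: if_cong)
  have basis: "pre_digraph.path_mult G (pre_digraph.path_mult G (Poly_Mapping.single p c)
        (Poly_Mapping.single q d)) (Poly_Mapping.single s e) =
      pre_digraph.path_mult G (Poly_Mapping.single p c)
        (pre_digraph.path_mult G (Poly_Mapping.single q d) (Poly_Mapping.single s e))"
    for p q s :: "('a, 'b) qpath" and c d e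
    using tgt_pcat[of G p q]
    by (auto simp: path_mult_single) (auto simp: pcat_def mult.assoc)
  show ?thesis
    by (subst (1 2) rep[of x], subst (1 2) rep[of y], subst (1 2) rep[of z])
      (simp add: path_mult_sum_left path_mult_sum_right basis del: path_mult_0)
qed

context fin_digraph
begin

lemma qpaths_pcat: "p \<in> qpaths \<Longrightarrow> q \<in> qpaths \<Longrightarrow> tgt p = fst q \<Longrightarrow> pcat p q \<in> qpaths"
  by (auto simp: qpaths_def tgt_def pcat_def awalk_ends intro: awalk_appendI)

lemma keys_path_mult:
  assumes "Poly_Mapping.keys x \<subseteq> qpaths" "Poly_Mapping.keys y \<subseteq> qpaths"
  shows "Poly_Mapping.keys (path_mult x y) \<subseteq> qpaths"
proof -
  have "Poly_Mapping.keys (if tgt p = fst q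
      then Poly_Mapping.single (pcat p q) (Poly_Mapping.lookup x p * Poly_Mapping.lookup y q)
      else 0) \<subseteq> qpaths" if "p \<in> Poly_Mapping.keys x" "q \<in> Poly_Mapping.keys y" for p q
    using that assms qpaths_pcat[of p q] by (auto split: if_splits)
  then show ?thesis
    unfolding path_mult_def using keys_sum by (fastforce dest!: subsetD[OF keys_sum])
qed

lemma path_mult_one:
  fixes x :: "('a, 'b) qpath \<Rightarrow>\<^sub>0 'k::field"
  assumes "Poly_Mapping.keys x \<subseteq> qpaths"
  shows "path_mult (\<Sum>v\<in>verts G. of_path (v, [])) x = x"
    and "path_mult x (\<Sum>v\<in>verts G. of_path (v, [])) = x"
proof -
  have rep: "x = (\<Sum>p\<in>Poly_Mapping.keys x. Poly_Mapping.single p (Poly_Mapping.lookup x p))"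
    by (rule poly_mapping_eqI)
      (auto simp: lookup_sum lookup_single in_keys_iff when_def if_distrib cong: if_cong)
  have v: "fst p \<in> verts G" "tgt p \<in> verts G" if "p \<in> Poly_Mapping.keys x" for p
    using subsetD[OF assms that] by (cases p; auto simp: qpaths_def tgt_def)+
  have triv: "tgt (v, []) = v" for v by (simp add: tgt_def)
  have "path_mult (\<Sum>v\<in>verts G. of_path (v, [])) x =
      (\<Sum>v\<in>verts G. \<Sum>p\<in>Poly_Mapping.keys x.
        if v = fst p then Poly_Mapping.single p (Poly_Mapping.lookup x p) else 0)"
    by (subst rep, simp only: path_mult_sum_left path_mult_sum_right)
      (subst sum.swap, auto simp: of_path_def path_mult_single triv pcat_def intro!: sum.cong)
  also have "\<dots> = (\<Sum>p\<in>Poly_Mapping.keys x. \<Sum>v\<in>verts G.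
        if v = fst p then Poly_Mapping.single p (Poly_Mapping.lookup x p) else 0)"
    by (rule sum.swap)
  also have "\<dots> = (\<Sum>p\<in>Poly_Mapping.keys x. Poly_Mapping.single p (Poly_Mapping.lookup x p))"
    by (intro sum.cong refl) (auto simp: v)
  also have "\<dots> = x" by (rule rep[symmetric])
  finally show "path_mult (\<Sum>v\<in>verts G. of_path (v, [])) x = x" .
  have "path_mult x (\<Sum>v\<in>verts G. of_path (v, [])) =
      (\<Sum>v\<in>verts G. \<Sum>p\<in>Poly_Mapping.keys x.
        if v = tgt p then Poly_Mapping.single p (Poly_Mapping.lookup x p) else 0)"
    by (subst rep, simp only: path_mult_sum_left path_mult_sum_right)
      (auto simp: of_path_def path_mult_single pcat_def intro!: sum.cong)
  also have "\<dots> = (\<Sum>p\<in>Poly_Mapping.keys x. \<Sum>v\<in>verts G.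
        if v = tgt p then Poly_Mapping.single p (Poly_Mapping.lookup x p) else 0)"
    by (rule sum.swap)
  also have "\<dots> = (\<Sum>p\<in>Poly_Mapping.keys x. Poly_Mapping.single p (Poly_Mapping.lookup x p))"
    by (intro sum.cong refl) (auto simp: v)
  also have "\<dots> = x" by (rule rep[symmetric])
  finally show "path_mult x (\<Sum>v\<in>verts G. of_path (v, [])) = x" .
qed

lemma ring_path_algebra: "ring (path_algebra :: (('a, 'b) qpath \<Rightarrow>\<^sub>0 'k::field) ring)"
proof (rule ringI)
  show "abelian_group (path_algebra :: (('a, 'b) qpath \<Rightarrow>\<^sub>0 'k::field) ring)"
  proof (rule abelian_groupI)
    fix x :: "('a, 'b) qpath \<Rightarrow>\<^sub>0 'k"
    assume "x \<in> carrier path_algebra"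
    then show "\<exists>y\<in>carrier path_algebra. y \<oplus>\<^bsub>path_algebra\<^esub> x = \<zero>\<^bsub>path_algebra\<^esub>"
      by (intro bexI[of _ "- x"]) (auto simp: path_algebra_def)
  qed (use Poly_Mapping.keys_add in \<open>fastforce simp: path_algebra_def algebra_simps\<close>)+
  show "Group.monoid (path_algebra :: (('a, 'b) qpath \<Rightarrow>\<^sub>0 'k::field) ring)"
  proof (rule monoidI)
    show "\<one>\<^bsub>path_algebra\<^esub> \<in> carrier (path_algebra :: (('a, 'b) qpath \<Rightarrow>\<^sub>0 'k::field) ring)"
      by (auto simp: path_algebra_def of_path_def qpaths_def awalk_Nil_iff
          dest!: subsetD[OF keys_sum])
  qed (auto simp: path_algebra_def path_mult_one path_mult_assoc dest: subsetD[OF keys_path_mult])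
qed (auto simp: path_algebra_def path_mult_add_left path_mult_add_right)

end


section \<open>Chains, the bar construction and the transferred structure\<close>

text \<open>
  \<open>I\<close> is the ideal of relations and \<open>W\<close> the set of tips of the chosen generators.  The definitions
  make sense for arbitrary \<open>I\<close> and \<open>W\<close>; they have the intended meaning if the paths in \<open>NonTip\<close>
  give a basis of \<open>\<k>Q/I\<close>.
\<close>

locale tip_presentation = pre_digraph Q
  for Q :: "('a, 'b) pre_digraph" +
  fixes I :: "(('a, 'b) qpath \<Rightarrow>\<^sub>0 'k::field) set"
    and W :: "('a, 'b) qpath set"
begin

abbreviation kQ :: "(('a, 'b) qpath \<Rightarrow>\<^sub>0 'k) ring" where
  "kQ \<equiv> path_algebra"

definition NonTip :: "('a, 'b) qpath set" where
  "NonTip = {p \<in> qpaths. \<not> (\<exists>s\<in>W. subpath s p)}"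

text \<open>The expansion in the basis \<open>NonTip\<close> of the class of \<open>x\<close> in \<open>\<k>Q/I\<close>.\<close>
definition nf :: "(('a, 'b) qpath \<Rightarrow>\<^sub>0 'k) \<Rightarrow> (('a, 'b) qpath \<Rightarrow>\<^sub>0 'k)" where
  "nf x = (THE y. Poly_Mapping.keys y \<subseteq> NonTip \<and> I +>\<^bsub>kQ\<^esub> y = I +>\<^bsub>kQ\<^esub> x)"

definition tip_ideal :: "(('a, 'b) qpath \<Rightarrow>\<^sub>0 'k) set" where
  "tip_ideal = Idl\<^bsub>kQ\<^esub> (of_path ` W)"

definition uf_verts :: "('a, 'b) qpath set" where
  "uf_verts = {(v, []) | v. v \<in> verts Q} \<union> {(tail Q a, [a]) | a. a \<in> arcs Q}
     \<union> {s. \<exists>w\<in>W. proper_right_factor s w}"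

definition uf_arc :: "('a, 'b) qpath \<Rightarrow> ('a, 'b) qpath \<Rightarrow> bool" where
  "uf_arc u v \<longleftrightarrow> u \<in> uf_verts \<and> v \<in> uf_verts \<and>
     ((\<exists>a\<in>arcs Q. u = (tail Q a, []) \<and> v = (tail Q a, [a])) \<or>
      (tgt u = fst v \<and> of_path (pcat u v) \<in> tip_ideal \<and>
       (\<forall>q. proper_left_factor q (pcat u v) \<longrightarrow> of_path q \<notin> tip_ideal)))"

definition bar_terms :: "('a, 'b) bar set" where
  "bar_terms = {(x, ws). x \<in> verts Q \<and> composable x ws \<and>
     (\<forall>w\<in>set ws. w \<in> NonTip \<and> snd w \<noteq> [])}"

text \<open>\<open>chains n\<close> is \<open>W\<^bsup>(n-1)\<^esup>\<close>, the basis of \<open>\<T>\<^sub>n\<close>; in particular \<open>chains 0\<close> is the set of vertices.\<close>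
definition chains :: "nat \<Rightarrow> ('a, 'b) bar set" where
  "chains n = {(x, ws) \<in> bar_terms. length ws = n \<and> successively uf_arc ((x, []) # ws)}"

definition bar_d :: "('a, 'b) bar \<Rightarrow> (('a, 'b) bar \<Rightarrow>\<^sub>0 'k)" where
  "bar_d t = (case t of (x, ws) \<Rightarrow>
     (\<Sum>j = 1..<length ws.
        smul ((-1) ^ j)
          (lin (\<lambda>p. Poly_Mapping.single (x, take (j - 1) ws @ [p] @ drop (j + 1) ws) 1)
             (nf (of_path (pcat (ws ! (j - 1)) (ws ! j)))))))"

text \<open>The reduced comultiplication \<open>\<Delta>'\<close>, with values in the tensor square.\<close>
definition bar_coprod :: "('a, 'b) bar \<Rightarrow> (('a, 'b) bar list \<Rightarrow>\<^sub>0 'k)" where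
  "bar_coprod t = (case t of (x, ws) \<Rightarrow>
     (\<Sum>j = 1..<length ws.
        Poly_Mapping.single [(x, take j ws), (fst (ws ! j), drop j ws)] 1))"

text \<open>\<open>Vset q k n\<close> is \<open>V\<^bsub>q,k-1\<^esub>\<^bsup>(n)\<^esup>\<close>; the index is shifted so that it starts at \<open>0\<close>.\<close>
definition Vset :: "('a, 'b) qpath \<Rightarrow> nat \<Rightarrow> nat \<Rightarrow> ('a, 'b) bar set" where
  "Vset q k n = {(x, ws) \<in> bar_terms. length ws = n \<and> bar_path (x, ws) = q \<and>
     (x, take k ws) \<in> chains k \<and> (x, take (Suc k) ws) \<notin> chains (Suc k)}"

definition G_arrow :: "('a, 'b) bar \<Rightarrow> ('a, 'b) bar \<Rightarrow> bool" where
  "G_arrow s t \<longleftrightarrow> s \<in> bar_terms \<and> t \<in> bar_terms \<and> Poly_Mapping.lookup (bar_d s) t \<noteq> 0"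

definition matching :: "(('a, 'b) bar \<times> ('a, 'b) bar) set" where
  "matching = {(s, t). G_arrow s t \<and>
     (\<exists>x us w' w'' vs q.
        s = (x, us @ [w', w''] @ vs) \<and> t = (x, us @ [pcat w' w''] @ vs) \<and>
        s \<in> Vset q (Suc (length us)) (Suc (length (snd t))) \<and>
        t \<in> Vset q (length us) (length (snd t)))}"

definition critical :: "('a, 'b) bar \<Rightarrow> bool" where
  "critical t \<longleftrightarrow> t \<in> bar_terms \<and> (\<forall>s. (s, t) \<notin> matching \<and> (t, s) \<notin> matching)"

definition dotted :: "('a, 'b) bar \<Rightarrow> ('a, 'b) bar \<Rightarrow> bool" where
  "dotted s t \<longleftrightarrow> (t, s) \<in> matching"

definition undotted :: "('a, 'b) bar \<Rightarrow> ('a, 'b) bar \<Rightarrow> bool" where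
  "undotted s t \<longleftrightarrow> G_arrow s t \<and> (s, t) \<notin> matching"

text \<open>
  Dotted arrows raise the degree by one and undotted ones lower it by one, so a zigzag path is
  determined by the nonempty list of its vertices.
\<close>
definition zigzag :: "('a, 'b) bar list \<Rightarrow> bool" where
  "zigzag zs \<longleftrightarrow> zs \<noteq> [] \<and> set zs \<subseteq> bar_terms \<and>
     (\<forall>j. Suc j < length zs \<longrightarrow> dotted (zs ! j) (zs ! Suc j) \<or> undotted (zs ! j) (zs ! Suc j)) \<and>
     (\<forall>j. Suc (Suc j) < length zs \<longrightarrow>
        dotted (zs ! j) (zs ! Suc j) \<noteq> dotted (zs ! Suc j) (zs ! Suc (Suc j)))"

definition step_weight :: "('a, 'b) bar \<Rightarrow> ('a, 'b) bar \<Rightarrow> 'k" where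
  "step_weight s t = (if dotted s t then - inverse (Poly_Mapping.lookup (bar_d t) s)
     else Poly_Mapping.lookup (bar_d s) t)"

definition zigzag_weight :: "('a, 'b) bar list \<Rightarrow> 'k" where
  "zigzag_weight zs = (\<Prod>j<length zs - 1. step_weight (zs ! j) (zs ! Suc j))"

definition total_weight :: "('a, 'b) bar \<Rightarrow> ('a, 'b) bar \<Rightarrow> 'k" where
  "total_weight s t = (\<Sum>zs\<in>{zs. zigzag zs \<and> hd zs = s \<and> last zs = t}. zigzag_weight zs)"

definition map_p :: "('a, 'b) bar \<Rightarrow> (('a, 'b) bar \<Rightarrow>\<^sub>0 'k)" where
  "map_p t = (\<Sum>y\<in>{y. critical y \<and> bar_degree y = bar_degree t}.
     Poly_Mapping.single y (total_weight t y))"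

definition map_h :: "('a, 'b) bar \<Rightarrow> (('a, 'b) bar \<Rightarrow>\<^sub>0 'k)" where
  "map_h t = (\<Sum>y\<in>{y \<in> bar_terms. bar_degree y = bar_degree t + 1}.
     Poly_Mapping.single y (total_weight t y))"

text \<open>Only used for critical \<open>t\<close>.\<close>
definition map_i :: "('a, 'b) bar \<Rightarrow> (('a, 'b) bar \<Rightarrow>\<^sub>0 'k)" where
  "map_i t = (\<Sum>y\<in>{y \<in> bar_terms. bar_degree y = bar_degree t}.
     Poly_Mapping.single y (total_weight t y))"

text \<open>
  \<open>f \<otimes> g\<close> on \<open>a \<otimes> b\<close> for \<open>g\<close> of degree \<open>m\<close>; the sign is the Koszul sign.
\<close>
definition koszul_tensor ::
  "(('a, 'b) bar \<Rightarrow> (('a, 'b) bar list \<Rightarrow>\<^sub>0 'k)) \<Rightarrow> (('a, 'b) bar \<Rightarrow> (('a, 'b) bar list \<Rightarrow>\<^sub>0 'k)) \<Rightarrow> nat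
    \<Rightarrow> ('a, 'b) bar list \<Rightarrow> (('a, 'b) bar list \<Rightarrow>\<^sub>0 'k)" where
  "koszul_tensor f g m ab = smul ((-1) ^ (m * bar_degree (ab ! 0))) (tens (f (ab ! 0)) (g (ab ! 1)))"

text \<open>
  The maps \<open>\<Delta>\<^sub>n\<close> on the bar construction, for \<open>n \<ge> 2\<close>.  For \<open>t \<ge> 1\<close> the map \<open>\<Delta>\<^sub>t h\<close> (the identity
  if \<open>t = 1\<close>) has degree \<open>t - 1\<close>.
\<close>
fun Delta_bar :: "nat \<Rightarrow> ('a, 'b) bar \<Rightarrow> (('a, 'b) bar list \<Rightarrow>\<^sub>0 'k)" where
  "Delta_bar n =
     (if n < 2 then (\<lambda>x. 0)
      else if n = 2 then bar_coprod
      else (\<lambda>x. \<Sum>s\<in>{1..<n}.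
        smul ((-1) ^ (s * (n - s + 1)))
          (lin (koszul_tensor
                  (\<lambda>a. if s = 1 then Poly_Mapping.single [a] 1 else lin (Delta_bar s) (map_h a))
                  (\<lambda>a. if n - s = 1 then Poly_Mapping.single [a] 1
                       else lin (Delta_bar (n - s)) (map_h a))
                  (n - s - 1))
            (bar_coprod x))))"

declare Delta_bar.simps [simp del]

definition Delta :: "nat \<Rightarrow> ('a, 'b) bar \<Rightarrow> (('a, 'b) bar list \<Rightarrow>\<^sub>0 'k)" where
  "Delta n \<gamma> = lin (tensor_power map_p) (lin (Delta_bar n) (map_i \<gamma>))"

definition decompositions :: "nat \<Rightarrow> ('a, 'b) bar \<Rightarrow> ('a, 'b) bar list set" where
  "decompositions n \<gamma> = {\<delta>s. length \<delta>s = n \<and>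
     (\<forall>\<delta>\<in>set \<delta>s. \<exists>r. \<delta> \<in> chains (Suc r)) \<and>
     composable (fst \<gamma>) (map bar_path \<delta>s) \<and>
     pconcat (fst \<gamma>) (map bar_path \<delta>s) = bar_path \<gamma> \<and>
     chain_index \<gamma> = (\<Sum>\<delta>\<leftarrow>\<delta>s. chain_index \<delta>) + 1}"

end


section \<open>Toupie algebras\<close>

locale toupie_quiver = fin_digraph Q
  for Q :: "('a, 'b) pre_digraph" +
  fixes z \<omega> :: 'a
  assumes source_unique: "{v \<in> verts Q. in_arcs Q v = {}} = {z}"
    and sink_unique: "{v \<in> verts Q. out_arcs Q v = {}} = {\<omega>}"
    and one_in: "\<And>v. v \<in> verts Q - {z, \<omega>} \<Longrightarrow> in_degree Q v = 1"
    and one_out: "\<And>v. v \<in> verts Q - {z, \<omega>} \<Longrightarrow> out_degree Q v = 1"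
begin

definition branches :: "('a, 'b) qpath set" where
  "branches = {p \<in> qpaths. fst p = z \<and> tgt p = \<omega>}"

end

text \<open>
  A toupie algebra \<open>\<k>Q/I\<close> with its generators: \<open>Gmon\<close> the monomial ones and \<open>\<rho> 0, \<dots>, \<rho> (m - 1)\<close>
  the non monomial ones.  \<open>B4\<close> lists the branches involved in non monomial relations, \<open>C\<close> is the
  coefficient matrix and \<open>\<kappa> i\<close> the column of the pivot of row \<open>i\<close> (rows and columns are counted from
  \<open>0\<close>).
\<close>

locale toupie_algebra = toupie_quiver Q z \<omega>
  for Q :: "('a, 'b) pre_digraph" and z \<omega> +
  fixes I :: "(('a, 'b) qpath \<Rightarrow>\<^sub>0 'k::field_char_0) set"
    and Gmon :: "('a, 'b) qpath set"
    and B4 :: "('a, 'b) qpath list"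
    and m :: nat
    and \<kappa> :: "nat \<Rightarrow> nat"
    and C :: "nat \<Rightarrow> nat \<Rightarrow> 'k"
    and \<rho> :: "nat \<Rightarrow> (('a, 'b) qpath \<Rightarrow>\<^sub>0 'k)"
    and tip :: "nat \<Rightarrow> ('a, 'b) qpath"
    and W :: "('a, 'b) qpath set"
  assumes admissible: "admissible I"
    and Gmon_paths: "Gmon \<subseteq> qpaths"
    and generates: "Idl\<^bsub>path_algebra\<^esub> (of_path ` Gmon \<union> \<rho> ` {..<m}) = I"
    and minimal: "\<And>S. S \<subset> of_path ` Gmon \<union> \<rho> ` {..<m} \<Longrightarrow> Idl\<^bsub>path_algebra\<^esub> S \<noteq> I"
    and B4_distinct: "distinct B4"
    and B4_branches: "set B4 \<subseteq> branches"
    and B4_lengths: "sorted_wrt (\<lambda>p q. length (snd q) \<le> length (snd p)) B4"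
    and B4_involved: "set B4 = (\<Union>i<m. Poly_Mapping.keys (\<rho> i))"
    and B4_not_B3: "\<And>p s. p \<in> set B4 \<Longrightarrow> s \<in> Gmon \<Longrightarrow> \<not> subpath s p"
    and pivots: "strict_mono_on {..<m} \<kappa>" "\<And>i. i < m \<Longrightarrow> \<kappa> i < length B4"
    and pivot_one: "\<And>i. i < m \<Longrightarrow> C i (\<kappa> i) = 1"
    and echelon: "\<And>i j. i < m \<Longrightarrow> j < \<kappa> i \<Longrightarrow> C i j = 0"
    and reduced: "\<And>i i'. i < m \<Longrightarrow> i' < m \<Longrightarrow> i' \<noteq> i \<Longrightarrow> C i' (\<kappa> i) = 0"
    and rho_eq: "\<And>i. i < m \<Longrightarrow> \<rho> i = (\<Sum>j<length B4. Poly_Mapping.single (B4 ! j) (C i j))"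
    and rho_non_monomial: "\<And>i. i < m \<Longrightarrow> \<exists>j. \<kappa> i < j \<and> j < length B4 \<and> C i j \<noteq> 0"
    and tip_eq: "\<And>i. i < m \<Longrightarrow> tip i = B4 ! \<kappa> i"
    and W_eq: "W = Gmon \<union> tip ` {..<m}"

end

theory Submission
  imports Defs
begin

text \<open>
  On a path that contains no tip of a non monomial relation everything is monomial: a bar term is
  the list of its break points on the path, \<open>bad i j\<close> says that the segment from \<open>i\<close> to \<open>j\<close>
  contains an element of \<open>W\<close>, and \<open>E i\<close> is the end of the shortest bad segment starting at \<open>i\<close>.
  A chain is a list with \<open>b\<^sub>1 = b\<^sub>0 + 1\<close> and \<open>b\<^sub>i\<^sub>+\<^sub>2 = E b\<^sub>i\<close>, and a zigzag is deterministic: it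
  replaces break points from left to right by those of the chain with the same starting point.

  Since \<open>h\<close> vanishes on the left factors that occur, \<open>\<Delta>\<^sub>n\<close> splits off a chain on the left and
  continues with \<open>p\<^sup>\<otimes> \<Delta>\<^sub>n\<^sub>-\<^sub>1 h\<close> on the rest.  The latter is computed by induction for all lists with
  \<open>b\<^sub>i\<^sub>+\<^sub>2 \<le> E b\<^sub>i\<close>: it is \<open>0\<close> if one of these inequalities is strict for an even \<open>i\<close>, and otherwise
  the sum, without signs, of all words of chains of the largest possible degree.  In such a word all
  chains but the last have odd degree, which turns the sign of the recursion into the claimed one.

  For a chain with path \<open>tip i\<close> the only correction is that \<open>map_i\<close> replaces the chain by the
  relation \<open>\<rho> i\<close>, each of its branches being split after the first arrow.
\<close>

section \<open>Linear extensions and tensors\<close>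

text \<open>The homotopy inserts a break point, so the lists met in the recursion are no longer
  tails of chains; the inequalities between b_(i+2) and E b_i are what survives an insertion. Alone
  they do not determine the map p: if the minimal bad segments are [0,3], [1,5], [3,6] and
  \<open>L = 6\<close>, the list [0,1,3,4,6] satisfies them, with equality at even indices, and p
  sends it to 0, although [0,1,3,5,6] is a chain of the same degree with the same end points. Every
  list that does occur lies, aligned at the right end, above the chain from which the computation
  starts (\<open>dominates\<close>), and this excludes such a competitor. The signs disappear by
  parity. At every second step the break point that a chain demands is E of an entry of the original
  list, so an insertion happens only at an even index k, where its weight (-1)^k is 1. Splitting the
  enlarged list after an even number j of pieces leaves a gap at an even index, so only odd j
  contribute, and there (-1)^((m+1)(j+1)) is 1.\<close>

lemma lookup_smul [simp]:
  fixes c :: "'k::semiring_0"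
  shows "Poly_Mapping.lookup (smul c x) a = c * Poly_Mapping.lookup x a"
  by (auto simp: smul_def map.rep_eq when_def)

lemma smul_zero [simp]: "smul c (0 :: 'x \<Rightarrow>\<^sub>0 'k::semiring_0) = 0" "smul (0::'k) (x :: 'x \<Rightarrow>\<^sub>0 'k) = 0"
  by (auto intro: poly_mapping_eqI)

lemma smul_one [simp]: "smul 1 (x :: 'x \<Rightarrow>\<^sub>0 'k::semiring_1) = x"
  by (auto intro: poly_mapping_eqI)

lemma smul_smul [simp]: "smul c (smul d x) = smul (c * d) (x :: 'x \<Rightarrow>\<^sub>0 'k::semiring_0)"
  by (auto intro: poly_mapping_eqI simp: mult.assoc)

lemma smul_add: "smul c (x + y) = smul c x + smul c (y :: 'x \<Rightarrow>\<^sub>0 'k::semiring_0)"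
  by (auto intro!: poly_mapping_eqI simp: lookup_add distrib_left)

lemma smul_sum: "smul c (sum f A) = (\<Sum>a\<in>A. smul c (f a :: 'x \<Rightarrow>\<^sub>0 'k::semiring_0))"
  by (induction A rule: infinite_finite_induct) (auto simp: smul_add)

lemma smul_single [simp]: "smul c (Poly_Mapping.single a d) = Poly_Mapping.single a (c * d :: 'k::semiring_0)"
  by (auto intro!: poly_mapping_eqI simp: lookup_single when_def)

lemma lin_superset:
  assumes "finite A" "Poly_Mapping.keys x \<subseteq> A"
  shows "lin f x = (\<Sum>b\<in>A. smul (Poly_Mapping.lookup x b) (f b))"
  unfolding lin_def using assms by (intro sum.mono_neutral_left) (auto simp: in_keys_iff)

lemma lin_zero [simp]: "lin f 0 = 0"
  by (simp add: lin_def)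

lemma lin_single [simp]: "lin f (Poly_Mapping.single a c) = smul c (f a)"
  by (subst lin_superset[where A = "{a}"]) auto

lemma smul_add_left: "smul (c + d) x = smul c x + smul d (x :: 'x \<Rightarrow>\<^sub>0 'k::semiring_0)"
  by (auto intro!: poly_mapping_eqI simp: lookup_add distrib_right)

lemma lin_add: "lin f (x + y) = lin f x + lin f y"
proof -
  let ?A = "Poly_Mapping.keys x \<union> Poly_Mapping.keys y"
  show ?thesis
    by (subst (1 2 3) lin_superset[where A = ?A])
      (use Poly_Mapping.keys_add[of x y] in \<open>auto simp: lookup_add smul_add_left sum.distrib\<close>)
qed

lemma lin_sum: "lin f (sum g A) = (\<Sum>a\<in>A. lin f (g a))"
  by (induction A rule: infinite_finite_induct) (auto simp: lin_add)

lemma lin_smul: "lin f (smul c x) = smul c (lin f (x :: 'x \<Rightarrow>\<^sub>0 'k::comm_semiring_1))"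
proof -
  have "Poly_Mapping.keys (smul c x) \<subseteq> Poly_Mapping.keys x"
    by (auto simp: in_keys_iff)
  then have "lin f (smul c x) = (\<Sum>b\<in>Poly_Mapping.keys x. smul (c * Poly_Mapping.lookup x b) (f b))"
    by (subst lin_superset[where A = "Poly_Mapping.keys x"]) auto
  then show ?thesis by (simp add: lin_def smul_sum)
qed

lemma poly_mapping_expand:
  "(\<Sum>a\<in>Poly_Mapping.keys x. Poly_Mapping.single a (Poly_Mapping.lookup x a)) = x"
  by (rule poly_mapping_eqI)
    (auto simp: lookup_sum lookup_single in_keys_iff when_def if_distrib cong: if_cong)

lemma lin_lin: "lin f (lin g x) = lin (\<lambda>a. lin f (g a)) (x :: 'x \<Rightarrow>\<^sub>0 'k::comm_semiring_1)"
  unfolding lin_def[of g x] lin_def[of "\<lambda>a. lin f (g a)"] by (simp add: lin_sum lin_smul)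

lemma lin_ident: "lin (\<lambda>a. Poly_Mapping.single a 1) (x :: 'x \<Rightarrow>\<^sub>0 'k::semiring_1) = x"
  by (simp add: lin_def poly_mapping_expand)

lemma lin_fun_zero [simp]: "lin (\<lambda>a. 0) x = 0"
  by (simp add: lin_def)

lemma lin_fun_sum: "lin (\<lambda>a. \<Sum>i\<in>A. f i a) x = (\<Sum>i\<in>A. lin (f i) x)"
  unfolding lin_def smul_sum by (rule sum.swap)

text \<open>Reduces bilinearity and associativity of the tensor product to the rules for
  \<open>lin\<close>.\<close>

lemma tens_eq_lin:
  fixes x y :: "'x list \<Rightarrow>\<^sub>0 'k::comm_semiring_1"
  shows "tens x y = lin (\<lambda>a. lin (\<lambda>b. Poly_Mapping.single (a @ b) 1) y) x"
  by (simp add: tens_def lin_def smul_sum)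

lemma tens_zero [simp]:
  fixes x y :: "'x list \<Rightarrow>\<^sub>0 'k::comm_semiring_1"
  shows "tens 0 y = 0" "tens x 0 = 0"
  by (simp_all add: tens_eq_lin)

lemma tens_single [simp]:
  "tens (Poly_Mapping.single a c) (Poly_Mapping.single b d) = Poly_Mapping.single (a @ b) (c * d :: 'k::comm_semiring_1)"
  by (simp add: tens_eq_lin)

lemma tens_sum_right:
  fixes x :: "'x list \<Rightarrow>\<^sub>0 'k::comm_semiring_1"
  shows "tens x (sum f A) = (\<Sum>a\<in>A. tens x (f a))"
  by (simp add: tens_eq_lin lin_sum lin_fun_sum)

lemma lin_swap:
  "lin (\<lambda>a. lin (g a) y) x = lin (\<lambda>c. lin (\<lambda>a. g a c) x) (y :: 'y \<Rightarrow>\<^sub>0 'k::comm_semiring_1)"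
  unfolding lin_def smul_sum smul_smul by (subst sum.swap) (simp add: mult.commute)

lemma tens_lin_right:
  fixes x :: "'x list \<Rightarrow>\<^sub>0 'k::comm_semiring_1"
  shows "tens x (lin f y) = lin (\<lambda>b. tens x (f b)) y"
  unfolding tens_eq_lin lin_lin by (rule lin_swap)

lemma tens_lin_left:
  fixes x :: "'x list \<Rightarrow>\<^sub>0 'k::comm_semiring_1"
  shows "tens (lin f y) x = lin (\<lambda>b. tens (f b) x) y"
  by (simp add: tens_eq_lin lin_lin)

lemma tens_assoc: "tens (tens x y) z = tens x (tens y (z :: 'x list \<Rightarrow>\<^sub>0 'k::comm_semiring_1))"
  by (simp add: tens_eq_lin lin_lin)

lemma tens_unit [simp]: "tens (Poly_Mapping.single [] 1) (x :: 'x list \<Rightarrow>\<^sub>0 'k::comm_semiring_1) = x"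
  by (simp add: tens_eq_lin lin_ident)

lemma tensor_power_simps:
  "tensor_power f [] = Poly_Mapping.single [] 1"
  "tensor_power f (a # as) = tens (lin (\<lambda>b. Poly_Mapping.single [b] 1) (f a)) (tensor_power f as)"
  by (auto simp: tensor_power_def)

lemma tensor_power_append:
  "tensor_power f (as @ bs) = tens (tensor_power f as) (tensor_power f bs :: 'y list \<Rightarrow>\<^sub>0 'k::comm_semiring_1)"
  by (induction as) (auto simp: tensor_power_simps tens_assoc)

text \<open>No Koszul sign appears, which fits the degree 0 map p to which this is applied.\<close>

lemma lin_tensor_power_tens:
  fixes x y :: "'x list \<Rightarrow>\<^sub>0 'k::comm_semiring_1"
  shows "lin (tensor_power f) (tens x y) = tens (lin (tensor_power f) x) (lin (tensor_power f) y)"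
  by (simp add: tens_eq_lin[of x y] lin_lin tensor_power_append tens_lin_left)
    (simp add: tens_lin_right)

lemma tens_unit_right [simp]: "tens (x :: 'x list \<Rightarrow>\<^sub>0 'k::comm_semiring_1) (Poly_Mapping.single [] 1) = x"
  by (simp add: tens_eq_lin lin_ident)

lemma tensor_power_single:
  "tensor_power f [a] = lin (\<lambda>t. Poly_Mapping.single [t] (1 :: 'k::comm_semiring_1)) (f a)"
  by (simp add: tensor_power_simps)

lemma successively_Cons_nth: "successively P (x # ws) \<longleftrightarrow> (\<forall>i<length ws. P ((x # ws) ! i) (ws ! i))"
  by (induction ws arbitrary: x) (auto simp: All_less_Suc2)

lemma minus_one_power_cong: "(even a \<longleftrightarrow> even b) \<Longrightarrow> (- 1 :: 'k::ring_1) ^ a = (- 1) ^ b"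
  by (cases "even a") auto

section \<open>Chains on an interval\<close>

locale overlaps =
  fixes L :: nat and bad :: "nat \<Rightarrow> nat \<Rightarrow> bool"
  assumes bad_mono: "bad i j \<Longrightarrow> i' \<le> i \<Longrightarrow> j \<le> j' \<Longrightarrow> bad i' j'"
    and not_bad_Suc: "\<not> bad i (Suc i)"
begin

text \<open>The disjunct \<open>L < j\<close> supplies the default value \<open>Suc L\<close> when
  no bad segment starting at \<open>x\<close> ends inside the interval. The least element then
  always exists, and E is monotone without exception.\<close>

definition E :: "nat \<Rightarrow> nat" where
  "E x = (LEAST j. bad x j \<or> L < j)"

lemma E_le_iff: "j \<le> L \<Longrightarrow> E x \<le> j \<longleftrightarrow> bad x j"
proof
  have "bad x (E x) \<or> L < E x"
    unfolding E_def by (rule LeastI[of _ "Suc L"]) simp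
  moreover assume "E x \<le> j" "j \<le> L"
  ultimately show "bad x j" using bad_mono by (metis le_refl leD le_trans)
qed (auto simp: E_def intro: Least_le)

lemma E_le_Suc: "E x \<le> Suc L"
  unfolding E_def by (rule Least_le) simp

lemma E_mono: "x \<le> y \<Longrightarrow> E x \<le> E y"
proof -
  assume "x \<le> y"
  have "bad y (E y) \<or> L < E y"
    unfolding E_def by (rule LeastI[of _ "Suc L"]) simp
  then have "bad x (E y) \<or> L < E y" using bad_mono \<open>x \<le> y\<close> by blast
  then show ?thesis unfolding E_def[of x] by (rule Least_le)
qed

lemma less_E_iff: "j \<le> L \<Longrightarrow> j < E x \<longleftrightarrow> \<not> bad x j"
  using E_le_iff[of j x] by auto

section \<open>Lists of break points, their place in the matching, and words of chains\<close>

text \<open>The break point that a chain must have after index \<open>k\<close>. A chain starts with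
  an arrow; later, an arrow from u to v of the Uf-graph ends where the first bad segment from the
  start of u ends, hence the index \<open>k - 1\<close>.\<close>

definition nxt :: "nat list \<Rightarrow> nat \<Rightarrow> nat" where
  "nxt z k = (if k = 0 then Suc (z ! 0) else E (z ! (k - 1)))"

definition valid :: "nat list \<Rightarrow> bool" where
  "valid z \<longleftrightarrow> 2 \<le> length z \<and> sorted_wrt (<) z \<and> (\<forall>x\<in>set z. x \<le> L) \<and>
     (\<forall>i. Suc i < length z \<longrightarrow> \<not> bad (z ! i) (z ! Suc i))"

text \<open>The largest \<open>k\<close> with this property is the index \<open>k\<close> of
  \<open>Vset\<close>.\<close>

definition pre :: "nat list \<Rightarrow> nat \<Rightarrow> bool" where
  "pre z k \<longleftrightarrow> k < length z \<and> (\<forall>i<k. z ! Suc i = nxt z i)"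

definition chain :: "nat list \<Rightarrow> bool" where
  "chain z \<longleftrightarrow> valid z \<and> pre z (length z - 1)"

text \<open>
  A bar term is of type A or B if the matching arrow through it ends or starts there.
\<close>
definition typeA :: "nat list \<Rightarrow> nat \<Rightarrow> bool" where
  "typeA z k \<longleftrightarrow> pre z k \<and> Suc k < length z \<and> nxt z k < z ! Suc k"

definition typeB :: "nat list \<Rightarrow> nat \<Rightarrow> bool" where
  "typeB z k \<longleftrightarrow> pre z k \<and> Suc k < length z \<and> z ! Suc k < nxt z k"

text \<open>The end point of the dotted arrow that leaves a list of type A.\<close>

definition ins :: "nat list \<Rightarrow> nat \<Rightarrow> nat list" where
  "ins z k = take (Suc k) z @ nxt z k # drop (Suc k) z"

text \<open>After the insertion the zigzag can only go on by removing the old break point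
  \<open>z ! Suc k\<close>; this says that the product formed there is nonzero.\<close>

definition continues :: "nat list \<Rightarrow> nat \<Rightarrow> bool" where
  "continues z k \<longleftrightarrow> Suc (Suc k) < length z \<and> \<not> bad (nxt z k) (z ! Suc (Suc k))"

fun word :: "nat \<Rightarrow> nat list list \<Rightarrow> bool" where
  "word t [] \<longleftrightarrow> t = L"
| "word t (c # cs) \<longleftrightarrow> chain c \<and> hd c = t \<and> word (last c) cs"

definition degsum :: "nat list list \<Rightarrow> nat" where
  "degsum cs = (\<Sum>c\<leftarrow>cs. length c - 1)"

definition words :: "nat \<Rightarrow> nat \<Rightarrow> nat \<Rightarrow> nat list list set" where
  "words n d t = {cs. word t cs \<and> length cs = n \<and> degsum cs = d}"

lemma degsum_simps [simp]: "degsum [] = 0" "degsum (c # cs) = length c - 1 + degsum cs"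
  by (auto simp: degsum_def)

lemma valid_less: "valid z \<Longrightarrow> i < j \<Longrightarrow> j < length z \<Longrightarrow> z ! i < z ! j"
  by (auto simp: valid_def sorted_wrt_iff_nth_less)

lemma valid_le: "valid z \<Longrightarrow> i < length z \<Longrightarrow> z ! i \<le> L"
  by (auto simp: valid_def)

lemma valid_mono: "valid z \<Longrightarrow> i \<le> j \<Longrightarrow> j < length z \<Longrightarrow> z ! i \<le> z ! j"
  using valid_less[of z i j] by (cases "i = j") auto

lemma valid_hd_last: "valid z \<Longrightarrow> hd z < last z" "valid z \<Longrightarrow> z \<noteq> []"
proof -
  assume v: "valid z"
  then have "2 \<le> length z" by (simp add: valid_def)
  then show "z \<noteq> []" by auto
  then show "hd z < last z" using valid_less[OF v, of 0 "length z - 1"] \<open>2 \<le> length z\<close>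
    by (simp add: hd_conv_nth last_conv_nth)
qed

lemma word_le: "word t cs \<Longrightarrow> t \<le> L"
proof (induction cs arbitrary: t)
  case (Cons c cs)
  then have "hd c < last c" "last c \<le> L" "t = hd c"
    using valid_hd_last(1)[of c] Cons.IH[of "last c"] by (auto simp: chain_def)
  then show ?case by simp
qed simp

lemma word_less: "word t cs \<Longrightarrow> cs \<noteq> [] \<Longrightarrow> t < L"
proof (cases cs)
  case (Cons c cs')
  then show "word t cs \<Longrightarrow> t < L"
    using valid_hd_last(1)[of c] word_le[of "last c" cs'] by (simp add: chain_def)
qed simp

section \<open>Degree bounds for words of chains\<close>

text \<open>Only the first entries are compared by hypothesis, and E relates indices of equal
  parity. So even break points are controlled by monotonicity of E, while an odd one is merely known
  to exceed its even predecessor.\<close>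

lemma chain_above:
  assumes "chain f" "i < length f" "c 0 \<le> hd f" "i \<le> Suc p"
    and step: "\<And>i. Suc i \<le> p \<Longrightarrow> c (Suc (Suc i)) \<le> E (c i)"
  shows "(even i \<longrightarrow> c i \<le> f ! i) \<and> (odd i \<longrightarrow> c (i - 1) < f ! i)"
  using assms(2,4)
proof (induction i rule: less_induct)
  case (less i)
  have v: "valid f" and n: "\<And>i. Suc i < length f \<Longrightarrow> f ! Suc i = nxt f i"
    using \<open>chain f\<close> by (auto simp: chain_def pre_def)
  consider "i = 0" | "odd i" | l where "i = Suc (Suc l)" "even i"
    by (metis even_Suc even_zero old.nat.exhaust)
  then show ?case
  proof cases
    case 1
    then show ?thesis using assms(3) v by (auto simp: hd_conv_nth valid_hd_last)
  next
    case 2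
    then obtain l where l: "i = Suc l" "even l" by (cases i) auto
    then show ?thesis using less.IH[of l] less.prems valid_less[OF v, of l i] by auto
  next
    case 3
    have "c i \<le> E (c l)" using step[of l] 3 less.prems by simp
    also have "\<dots> \<le> E (f ! l)" using less.IH[of l] less.prems 3 by (intro E_mono) auto
    also have "\<dots> = f ! i" using n[of "Suc l"] 3 less.prems by (simp add: nxt_def)
    finally show ?thesis using 3 by auto
  qed
qed

text \<open>
  Bounds the degree of a word by the number of pieces of \<open>c\<close>: an even break point of its first chain
  lies above the corresponding entry of \<open>c\<close>, an odd one above the preceding entry.
\<close>
lemma word_degree_bound:
  assumes "word t cs" "cs \<noteq> []" "c 0 \<le> t" "c p = L" "c (Suc p) = Suc L" "0 < p"
    and "\<And>i. Suc i \<le> p \<Longrightarrow> c (Suc (Suc i)) \<le> E (c i)"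
  shows "degsum cs + 1 \<le> p + length cs"
  using assms
proof (induction cs arbitrary: t c p)
  case Nil
  then show ?case by simp
next
  case (Cons f cs)
  define j where "j = length f - 1"
  have f: "chain f" "hd f = t" "word (last f) cs" using Cons.prems by auto
  then have v: "valid f" by (simp add: chain_def)
  then have len: "length f = Suc j" "0 < j" unfolding j_def by (auto simp: valid_def)
  have last: "last f = f ! j" using len by (metis diff_Suc_1 last_conv_nth length_0_conv nat.simps(3))
  have lastL: "last f \<le> L" using f(3) word_le by blast
  note ab = chain_above[of f _ c p, OF f(1) _ _ _ Cons.prems(7)]
  \<comment> \<open>A longer chain would pass L: at index \<open>p\<close> if \<open>p\<close> is
    even, and otherwise at index \<open>Suc p\<close>, where the sentinel
    \<open>c (Suc p) = Suc L\<close> is used.\<close>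
  have jp: "j \<le> p"
  proof (rule ccontr)
    assume "\<not> j \<le> p"
    then have "f ! Suc p \<le> L" "f ! p < f ! Suc p"
      using valid_le[OF v, of "Suc p"] valid_less[OF v, of p "Suc p"] len by auto
    then show False using ab[of p] ab[of "Suc p"] \<open>\<not> j \<le> p\<close> len Cons.prems(3-5) f(2)
      by (cases "even p") auto
  qed
  show ?case
  proof (cases "cs = []")
    case True
    then show ?thesis using jp len by simp
  next
    case False
    then have lt: "last f < L" using word_less f(3) by blast
    show ?thesis
    proof (cases "even j")
      case True
      then have cj: "c j \<le> last f" using ab[of j] len jp Cons.prems(3) f(2) last by auto
      then have "j < p" using lt jp Cons.prems(4) by (cases "j = p") auto
      then have "degsum cs + 1 \<le> (p - j) + length cs"
        using Cons.IH[OF f(3) False, of "\<lambda>i. c (i + j)" "p - j"] Cons.prems cj by auto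
      then show ?thesis using len jp by simp
    next
      \<comment> \<open>For odd \<open>j\<close> only \<open>c (j - 1)\<close> is known to lie below
        \<open>last f\<close>, so the rest is bounded from index \<open>j - 1\<close> on. The index
        gained is the surplus of one that the bound grants to every chain but the last.\<close>
      case odd: False
      then obtain l where l: "j = Suc l" by (cases j) auto
      then have cj: "c l \<le> last f" using ab[of j] len jp odd Cons.prems(3) f(2) last by auto
      have "degsum cs + 1 \<le> (p - l) + length cs"
        using Cons.IH[OF f(3) False, of "\<lambda>i. c (i + l)" "p - l"] Cons.prems cj jp l by auto
      then show ?thesis using len jp l by simp
    qed
  qed
qed

lemma chain_unique:
  assumes "chain f" "pre y k" "hd f = hd y" "i < length f" "i \<le> k"
  shows "f ! i = y ! i"
  using assms(4,5)
proof (induction i rule: less_induct)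
  case (less i)
  have y: "y \<noteq> []" "f \<noteq> []" using assms by (auto simp: pre_def chain_def valid_def)
  show ?case
  proof (cases i)
    case 0
    then show ?thesis using assms(3) y by (simp add: hd_conv_nth)
  next
    case (Suc l)
    have "f ! i = nxt f l" "y ! i = nxt y l"
      using assms less.prems Suc by (auto simp: chain_def pre_def)
    moreover have "nxt f l = nxt y l"
      using less.IH[of 0] less.IH[of "l - 1"] less.prems Suc by (auto simp: nxt_def)
    ultimately show ?thesis by simp
  qed
qed

lemma chain_prefix:
  assumes "chain f" "pre y k" "hd f = hd y" "length f \<le> Suc k"
  shows "f = take (length f) y"
  using assms chain_unique[OF assms(1-3)] by (intro nth_equalityI) (auto simp: pre_def)

text \<open>Chains and their tails satisfy this with equality; insertions by the homotopy preserve
  the inequality.\<close>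

definition slow :: "nat list \<Rightarrow> bool" where
  "slow z \<longleftrightarrow> (\<forall>i. Suc (Suc i) < length z \<longrightarrow> z ! Suc (Suc i) \<le> E (z ! i))"

definition even_gap :: "nat list \<Rightarrow> bool" where
  "even_gap z \<longleftrightarrow> (\<exists>i. even i \<and> Suc (Suc i) < length z \<and> z ! Suc (Suc i) < E (z ! i))"

text \<open>This is \<open>word_degree_bound\<close> for the tail of \<open>y\<close> from index
  \<open>j\<close>, continued by the sentinel \<open>Suc L\<close>. The inequality at the sentinel
  holds because the last piece of \<open>y\<close> is not bad.\<close>

lemma slow_bound:
  assumes "valid y" "slow y" "last y = L" "y ! j \<le> t" "Suc j < length y" "word t cs" "cs \<noteq> []"
  shows "degsum cs + 2 + j \<le> length y + length cs"
proof -
  define p where "p = length y - 1 - j"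
  define c where "c = (\<lambda>i. if i + j < length y then y ! (i + j) else Suc L)"
  have p: "length y = p + j + 1" "0 < p" using assms(5) by (auto simp: p_def)
  have "y ! (p + j) = L" using assms(3) p
    by (metis add_diff_cancel_right' last_conv_nth length_0_conv add_is_0 one_neq_zero)
  moreover have "c (Suc (Suc i)) \<le> E (c i)" if i: "Suc i \<le> p" for i
  proof (cases "Suc (Suc i) + j < length y")
    case True
    then show ?thesis using assms(2) by (auto simp: c_def slow_def)
  next
    case False
    then have "Suc (i + j) = p + j" using p i by auto
    then have "\<not> bad (y ! (i + j)) (y ! Suc (i + j))" "y ! Suc (i + j) = L"
      using assms(1) p calculation by (auto simp: valid_def)
    then have "L < E (y ! (i + j))" using less_E_iff by auto
    then show ?thesis using False i p by (auto simp: c_def)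
  qed
  ultimately have "degsum cs + 1 \<le> p + length cs"
    using word_degree_bound[OF assms(6,7), of c p] assms(4) p by (auto simp: c_def)
  then show ?thesis using p by auto
qed

text \<open>If \<open>last f\<close> were at least the entry of \<open>z\<close> at the same index,
  \<open>slow_bound\<close> for the remaining chains would leave the total degree one too small. So
  \<open>f\<close> ends strictly below \<open>z\<close>, which \<open>chain_above\<close> permits
  only at an odd index.\<close>

lemma odd_first_chain:
  assumes "valid z" "slow z" "last z = L" "word (hd z) (f # cs)" "cs \<noteq> []"
    and deg: "degsum (f # cs) + 2 = length z + length (f # cs)"
  shows "odd (length f - 1)" "last f < z ! (length f - 1)" "length f \<le> length z"
proof -
  define j where "j = length f - 1"
  have f: "chain f" "hd f = hd z" "word (last f) cs" using assms(4) by auto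
  then have v: "valid f" by (simp add: chain_def)
  then have len: "length f = Suc j" "0 < j" unfolding j_def by (auto simp: valid_def)
  have last: "last f = f ! j" using len by (metis diff_Suc_1 last_conv_nth length_0_conv nat.simps(3))
  have z: "2 \<le> length z" "z \<noteq> []" using assms(1) by (auto simp: valid_def)
  have lt: "last f < L" using word_less[OF f(3) assms(5)] .
  have ab: "(even i \<longrightarrow> z ! i \<le> f ! i) \<and> (odd i \<longrightarrow> z ! (i - 1) < f ! i)"
    if "i < length f" "i < length z" for i
    using chain_above[OF f(1), of i "(!) z" "length z - 2"] that z assms(2) f(2)
    by (auto simp: hd_conv_nth slow_def)
  have zL: "z ! (length z - 1) = L" using assms(3) z by (simp add: last_conv_nth)
  have nf: "f ! Suc i = nxt f i" if "Suc i < length f" for i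
    using f(1) that by (auto simp: chain_def pre_def)
  \<comment> \<open>Otherwise \<open>f\<close> reaches or passes L while more chains follow: for
    even \<open>e\<close> because the last piece of \<open>z\<close> is not bad, for odd
    \<open>e\<close> because even break points of \<open>f\<close> lie above those of
    \<open>z\<close>.\<close>
  have jz: "j < length z"
  proof (rule ccontr)
    assume j: "\<not> j < length z"
    obtain e where e: "length z = Suc (Suc e)" using z(1) by (metis Suc_diff_le Suc_eq_plus1 add_2_eq_Suc diff_add le_add_diff_inverse)
    have fj: "f ! i < L" if "i \<le> j" for i
      using valid_mono[OF v, of i j] that len last lt by simp
    show False
    proof (cases "even e")
      case True
      have "\<not> bad (z ! e) (z ! Suc e)" using assms(1) e by (simp add: valid_def)
      then have "L < E (z ! e)" using zL e less_E_iff by simp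
      also have "\<dots> \<le> E (f ! e)" using ab[of e] True e j len by (intro E_mono) auto
      also have "\<dots> = f ! Suc (Suc e)" using nf[of "Suc e"] e j len by (simp add: nxt_def)
      finally show False using fj[of "Suc (Suc e)"] j e by simp
    next
      case False
      then have "L \<le> f ! Suc e" using ab[of "Suc e"] zL e j len by simp
      then show False using fj[of "Suc e"] j e by simp
    qed
  qed
  then show "length f \<le> length z" using len by simp
  have *: "\<not> z ! j \<le> last f"
  proof (cases "Suc j < length z")
    case True
    then show ?thesis using slow_bound[OF assms(1-3) _ _ f(3) assms(5), of j] deg len by auto
  next
    case False
    then show ?thesis using jz zL lt by (metis Suc_lessI diff_Suc_1 leD)
  qed
  then show "last f < z ! (length f - 1)" using len by simp
  show "odd (length f - 1)" using * ab[of j] last len jz by auto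
qed

text \<open>The first chain has odd degree by \<open>odd_first_chain\<close>. Its end lies strictly
  between two neighbouring entries of \<open>z\<close>, so replacing the entries before it by this
  end gives a shorter slow list for which the remaining word is again of largest degree.\<close>

lemma top_word_odd:
  assumes "valid z" "slow z" "last z = L" "word (hd z) cs" "cs \<noteq> []"
    and "degsum cs + 2 = length z + length cs" "Suc i < length cs"
  shows "odd (length (cs ! i) - 1)"
  using assms
proof (induction cs arbitrary: z i)
  case Nil
  then show ?case by simp
next
  case (Cons f cs)
  have ne: "cs \<noteq> []" using Cons.prems(7) by auto
  note of = odd_first_chain[OF Cons.prems(1-4) ne Cons.prems(6)]
  show ?case
  proof (cases i)
    case 0
    then show ?thesis using of by simp
  next
    case (Suc l)
    define j where "j = length f - 1"
    have f: "chain f" "hd f = hd z" "word (last f) cs" using Cons.prems(4) by auto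
    then have v: "valid f" by (simp add: chain_def)
    then have len: "length f = Suc j" "0 < j" unfolding j_def by (auto simp: valid_def)
    obtain p where p: "j = Suc p" using len by (cases j) auto
    have last: "last f = f ! j" using len by (metis diff_Suc_1 last_conv_nth length_0_conv nat.simps(3))
    let ?z = "last f # drop j z"
    have z: "2 \<le> length z" "z \<noteq> []" using Cons.prems(1) by (auto simp: valid_def)
    have zp: "z ! p < last f"
      using chain_above[OF f(1), of j "(!) z" "length z - 2"] of z Cons.prems(2) f(2) len p last
      by (auto simp: hd_conv_nth slow_def)
    have nz: "?z ! Suc i = z ! (j + i)" if "j + i < length z" for i using that by simp
    have jz: "j < length z" using of(3) len by simp
    have "valid ?z"
      unfolding valid_def
    proof (intro conjI allI impI)
      show "2 \<le> length ?z" using jz by simp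
      show "sorted_wrt (<) ?z"
      proof -
        have "last f < x" if "x \<in> set (drop j z)" for x
        proof -
          obtain i where "x = z ! (j + i)" "j + i < length z"
            using \<open>x \<in> set (drop j z)\<close> jz
            by (auto simp: in_set_conv_nth less_diff_conv add.commute)
          then show ?thesis using of(2) valid_mono[OF Cons.prems(1), of j "j + i"] len by simp
        qed
        then show ?thesis using Cons.prems(1) by (auto simp: valid_def sorted_wrt_drop)
      qed
      show "\<forall>x\<in>set ?z. x \<le> L" using Cons.prems(1) word_le[OF f(3)]
        by (auto simp: valid_def dest: in_set_dropD)
      fix i assume i: "Suc i < length ?z"
      show "\<not> bad (?z ! i) (?z ! Suc i)"
      proof (cases i)
        case 0
        have "\<not> bad (z ! p) (z ! j)" using Cons.prems(1) jz p by (auto simp: valid_def)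
        then show ?thesis using 0 zp bad_mono[of "last f" "z ! j" "z ! p" "z ! j"] jz by auto
      next
        case (Suc i')
        then show ?thesis using Cons.prems(1) i by (auto simp: valid_def)
      qed
    qed
    moreover have "slow ?z"
      unfolding slow_def
    proof (intro allI impI)
      fix i assume i: "Suc (Suc i) < length ?z"
      show "?z ! Suc (Suc i) \<le> E (?z ! i)"
      proof (cases i)
        case 0
        have "z ! Suc j \<le> E (z ! p)" using Cons.prems(2) i 0 p by (auto simp: slow_def)
        then show ?thesis using 0 i E_mono[of "z ! p" "last f"] zp by auto
      next
        case (Suc i')
        then show ?thesis using Cons.prems(2) i by (auto simp: slow_def)
      qed
    qed
    moreover have "last ?z = L" using Cons.prems(3) jz by auto
    moreover have "degsum cs + 2 = length ?z + length cs" using Cons.prems(6) len jz by auto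
    ultimately have "odd (length (cs ! l) - 1)"
      using Cons.IH[of ?z l] f(3) ne Cons.prems(7) Suc by auto
    then show ?thesis using Suc by simp
  qed
qed

lemma finite_words: "finite (words n d t)"
proof -
  have "cs \<in> {cs. set cs \<subseteq> {c. set c \<subseteq> {..L} \<and> length c \<le> Suc L} \<and> length cs = n}"
    if "cs \<in> words n d t" for cs
  proof -
    have "set c \<subseteq> {..L} \<and> length c \<le> Suc L" if "c \<in> set cs" "word t cs" for c t
      using that
    proof (induction cs arbitrary: t)
      case (Cons a cs)
      have "valid a" using Cons.prems by (simp add: chain_def)
      then have s: "set a \<subseteq> {..L}" "sorted_wrt (<) a" by (auto simp: valid_def)
      then have "card (set a) = length a" by (simp add: distinct_card strict_sorted_iff)
      then have "length a \<le> Suc L" using card_mono[OF _ s(1)] by simp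
      then show ?case using Cons s by auto
    qed simp
    then show ?thesis using that by (auto simp: words_def)
  qed
  moreover
  have "finite {c. set c \<subseteq> {..L} \<and> length c \<le> Suc L}"
    by (rule finite_lists_length_le) simp
  then have "finite {cs. set cs \<subseteq> {c. set c \<subseteq> {..L} \<and> length c \<le> Suc L} \<and> length cs = n}"
    by (rule finite_lists_length_eq)
  ultimately show ?thesis by (blast intro: finite_subset)
qed

text \<open>If \<open>y\<close> begins with an arrow, the comparison with a chain \<open>f\<close>
  holds at odd indices too, so \<open>f\<close> cannot end strictly below \<open>y\<close> as
  \<open>odd_first_chain\<close> demands.\<close>

lemma no_top_word:
  assumes "valid y" "slow y" "last y = L" "y ! 1 = Suc (y ! 0)" "2 \<le> n"
  shows "words n (length y + n - 2) (hd y) = {}"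
proof (rule ccontr)
  assume "\<not> ?thesis"
  then obtain f cs where f: "word (hd y) (f # cs)" "length (f # cs) = n" "degsum (f # cs) = length y + n - 2"
  proof -
    obtain cs where "word (hd y) cs" "length cs = n" "degsum cs = length y + n - 2"
      using \<open>words n (length y + n - 2) (hd y) \<noteq> {}\<close> unfolding words_def by blast
    with that assms(5) show thesis by (cases cs) auto
  qed
  have len: "2 \<le> length y" "y \<noteq> []" using assms(1) by (auto simp: valid_def)
  have ne: "cs \<noteq> []" using f(2) assms(5) by auto
  have deg: "degsum (f # cs) + 2 = length y + length (f # cs)"
    unfolding f(2,3) using len(1) assms(5) by linarith
  note of = odd_first_chain[OF assms(1-3) f(1) ne deg]
  have cf: "chain f" "hd f = hd y" using f(1) by auto
  have vf: "valid f" using cf by (simp add: chain_def)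
  have nf: "f ! Suc i = nxt f i" if "Suc i < length f" for i
    using cf that by (auto simp: chain_def pre_def)
  have f0: "f ! 0 = y ! 0" using cf valid_hd_last(2)[OF vf] len by (simp add: hd_conv_nth)
  have "y ! i \<le> f ! i" if "i < length f" for i
    using that
  proof (induction i rule: less_induct)
    case (less i)
    consider "i = 0" | "i = 1" | l where "i = Suc (Suc l)"
      by (metis One_nat_def old.nat.exhaust)
    then show ?case
    proof cases
      case 1 then show ?thesis using f0 by simp
    next
      case 2 then show ?thesis using f0 nf[of 0] less.prems assms(4) by (simp add: nxt_def)
    next
      case 3
      have "y ! i \<le> E (y ! l)" using assms(2) 3 less.prems of(3) by (auto simp: slow_def)
      also have "\<dots> \<le> E (f ! l)" using less.IH[of l] less.prems 3 by (intro E_mono) auto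
      also have "\<dots> = f ! i" using nf[of "Suc l"] 3 less.prems by (simp add: nxt_def)
      finally show ?thesis .
    qed
  qed
  then have "y ! (length f - 1) \<le> last f" using valid_hd_last(2)[OF vf] by (simp add: last_conv_nth)
  then show False using of(2) by simp
qed

section \<open>Inserting, moving and removing a break point\<close>

lemma ins_nth:
  assumes "Suc k < length z"
  shows "length (ins z k) = Suc (length z)"
    and "i \<le> k \<Longrightarrow> ins z k ! i = z ! i"
    and "ins z k ! Suc k = nxt z k"
    and "k < i \<Longrightarrow> i < length z \<Longrightarrow> ins z k ! Suc i = z ! i"
  using assms by (auto simp: ins_def nth_append nth_Cons' min_def)

lemma nxt_greater:
  assumes "valid z" "pre z k" shows "z ! k < nxt z k"
proof (cases k)
  case (Suc l)
  have "\<not> bad (z ! l) (z ! k)" "z ! k \<le> L"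
    using assms(1) Suc assms(2) valid_le[OF assms(1), of k] unfolding valid_def pre_def by fastforce+
  then show ?thesis using Suc less_E_iff by (simp add: nxt_def)
qed (simp add: nxt_def)

lemma valid_ne: "valid z \<Longrightarrow> hd z = z ! 0" "valid z \<Longrightarrow> last z = z ! (length z - 1)"
  using valid_hd_last(2) by (simp_all add: hd_conv_nth last_conv_nth)

lemma valid_insert:
  assumes "valid zs" "Suc k < length zs" "zs ! k < c" "c < zs ! Suc k"
  shows "valid (take (Suc k) zs @ c # drop (Suc k) zs)"
proof -
  let ?x = "take (Suc k) zs @ c # drop (Suc k) zs"
  have nb: "\<not> bad (zs ! k) (zs ! Suc k)" using assms by (simp add: valid_def)
  have step: "?x ! i < ?x ! Suc i \<and> \<not> bad (?x ! i) (?x ! Suc i)" if "Suc i < length ?x" for i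
  proof -
    consider "i < k" | "i = k" | "i = Suc k" | l where "i = Suc l" "k < l"
      by (metis Suc_lessI not_less_eq less_imp_Suc_add linorder_neqE_nat)
    then show ?thesis
    proof cases
      case 1
      then show ?thesis using valid_less[OF assms(1), of i "Suc i"] assms(1,2) by (auto simp: valid_def nth_append)
    next
      case 2
      then show ?thesis using assms nb bad_mono[of "zs ! k" c "zs ! k" "zs ! Suc k"] by (auto simp: nth_append)
    next
      case 3
      then show ?thesis using assms nb bad_mono[of c "zs ! Suc k" "zs ! k" "zs ! Suc k"] by (auto simp: nth_append)
    next
      case 4
      then show ?thesis using that valid_less[OF assms(1), of l "Suc l"] assms(1,2)
        by (auto simp: valid_def nth_append nth_Cons')
    qed
  qed
  have "sorted_wrt (<) ?x"
    using step by (subst sorted_wrt_iff_nth_Suc_transp) auto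
  moreover have "\<forall>y\<in>set ?x. y \<le> L"
    using assms(1) less_le_trans[OF assms(4) valid_le[OF assms(1,2)]]
    by (auto simp: valid_def dest: in_set_takeD in_set_dropD)
  ultimately show ?thesis using step assms by (auto simp: valid_def)
qed

text \<open>The inserted point lengthens the chain prefix by one. The piece that was cut is not bad,
  so the following break point comes before the one that a chain would now require.\<close>

lemma valid_ins:
  assumes "valid z" "typeA z k" shows "valid (ins z k)" "typeB (ins z k) (Suc k)"
proof -
  have k: "Suc k < length z" "pre z k" "nxt z k < z ! Suc k" using assms(2) by (auto simp: typeA_def)
  have gr: "z ! k < nxt z k" using nxt_greater assms(1) k(2) .
  have cL: "nxt z k \<le> L" using k valid_le[OF assms(1) k(1)] by simp
  have nb: "\<not> bad (z ! k) (z ! Suc k)" using assms(1) k by (simp add: valid_def)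
  note n = ins_nth[OF k(1)]
  show "valid (ins z k)" unfolding ins_def by (rule valid_insert[OF assms(1) k(1) gr k(3)])
  have "pre (ins z k) (Suc k)"
    unfolding pre_def
  proof (intro conjI allI impI)
    fix i assume i: "i < Suc k"
    show "ins z k ! Suc i = nxt (ins z k) i"
    proof (cases "i = k")
      case True
      then show ?thesis using n by (auto simp: nxt_def)
    next
      case False
      then show ?thesis using n(2)[of i] n(2)[of "Suc i"] n(2)[of "i - 1"] n(2)[of 0] i k(2)
        by (auto simp: nxt_def pre_def)
    qed
  qed (use n k in simp)
  moreover have "z ! Suc k < E (z ! k)" using nb less_E_iff valid_le[OF assms(1) k(1)] by simp
  ultimately show "typeB (ins z k) (Suc k)"
    using n(1) n(2)[of k] n(4)[of "Suc k"] k by (simp add: typeB_def nxt_def)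
qed

text \<open>A dotted arrow followed by the continuing undotted one moves break point
  \<open>Suc k\<close> to where a chain needs it. The prefix grows while the length stays fixed,
  which is why zigzags terminate.\<close>

lemma valid_update:
  assumes "valid z" "typeA z k" "continues z k"
  shows "valid (z[Suc k := nxt z k])" "pre (z[Suc k := nxt z k]) (Suc k)"
proof -
  have k: "Suc k < length z" "pre z k" "nxt z k < z ! Suc k" using assms(2) by (auto simp: typeA_def)
  have c: "Suc (Suc k) < length z" "\<not> bad (nxt z k) (z ! Suc (Suc k))"
    using assms(3) by (auto simp: continues_def)
  have gr: "z ! k < nxt z k" using nxt_greater assms(1) k(2) .
  have cL: "nxt z k \<le> L" using k valid_le[OF assms(1) k(1)] by simp
  have nb: "\<not> bad (z ! k) (z ! Suc k)" using assms(1) k by (simp add: valid_def)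
  let ?y = "z[Suc k := nxt z k]"
  have step: "?y ! i < ?y ! Suc i \<and> \<not> bad (?y ! i) (?y ! Suc i)"
    if "Suc i < length z" for i
  proof -
    consider "i < k" | "i = k" | "i = Suc k" | "Suc k < i" by linarith
    then show ?thesis
    proof cases
      case 2
      then show ?thesis using gr k nb bad_mono[of "z ! k" "nxt z k" "z ! k" "z ! Suc k"] by auto
    next
      case 3
      then show ?thesis using k c valid_less[OF assms(1), of "Suc k" "Suc (Suc k)"] by auto
    qed (use valid_less[OF assms(1), of i "Suc i"] assms(1) that in \<open>auto simp: valid_def\<close>)
  qed
  have "sorted_wrt (<) ?y"
    using step by (subst sorted_wrt_iff_nth_Suc_transp) auto
  moreover have "\<forall>x\<in>set ?y. x \<le> L"
    using assms(1) cL set_update_subset_insert[of z "Suc k" "nxt z k"]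
    by (auto simp: valid_def)
  ultimately show "valid ?y" using step assms(1) by (auto simp: valid_def)
  show "pre ?y (Suc k)"
    unfolding pre_def
  proof (intro conjI allI impI)
    fix i assume i: "i < Suc k"
    show "?y ! Suc i = nxt ?y i"
      using i k by (cases "i = k") (auto simp: nxt_def pre_def nth_list_update)
  qed (use k in simp)
qed

lemma sub_valid:
  assumes "valid z" "Suc j < length z" shows "valid (drop j z)"
  using assms by (auto simp: valid_def sorted_wrt_drop add.commute dest: in_set_dropD)

lemma take_valid:
  assumes "valid z" "1 \<le> j" "j < length z" shows "valid (take (Suc j) z)"
  using assms by (auto simp: valid_def sorted_wrt_take dest: in_set_takeD)

lemma take_pre:
  assumes "pre z k" "j \<le> k" shows "pre (take (Suc j) z) j"
  using assms by (auto simp: pre_def nxt_def)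

lemma take_chain:
  assumes "valid z" "pre z k" "1 \<le> j" "j \<le> k" shows "chain (take (Suc j) z)"
proof -
  have "j < length z" using assms by (auto simp: pre_def)
  then show ?thesis unfolding chain_def using take_valid[OF assms(1,3)] take_pre[OF assms(2,4)]
    \<open>j < length z\<close> by simp
qed

text \<open>A chain is determined by its starting point, so the first chain of a word is a prefix of
  \<open>x\<close> once it is known to be short enough. \<open>P\<close> collects what else is known
  about its degree: parity in the recursion, being a proper prefix in the final computation.\<close>

lemma words_split:
  assumes "pre x k" "valid x" "last x = L"
    and bd: "\<And>f cs. word (hd x) (f # cs) \<Longrightarrow> length (f # cs) = Suc n \<Longrightarrow> degsum (f # cs) = d \<Longrightarrow>
      P (length f - 1) \<and> length f \<le> Suc k"
  shows "words (Suc n) d (hd x) =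
    (\<Union>j\<in>{j. P j \<and> 1 \<le> j \<and> j \<le> k \<and> j \<le> d}. (#) (take (Suc j) x) ` words n (d - j) (x ! j))"
    (is "?L = ?R")
proof
  have klen: "k < length x" using assms(1) by (simp add: pre_def)
  have *: "last (take (Suc j) x) = x ! j" "hd (take (Suc j) x) = hd x" if "j \<le> k" for j
    using that klen valid_ne(1)[OF assms(2)] by (auto simp: take_Suc_conv_app_nth hd_append hd_conv_nth nth_append)
  show "?L \<subseteq> ?R"
  proof
    fix cs assume "cs \<in> ?L"
    then obtain f gs where f: "cs = f # gs" "word (hd x) (f # gs)" "length (f # gs) = Suc n" "degsum (f # gs) = d"
      by (cases cs) (auto simp: words_def)
    define j where "j = length f - 1"
    have j: "P j" "length f \<le> Suc k" using bd[OF f(2-4)] by (auto simp: j_def)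
    have cf: "chain f" "hd f = hd x" using f(2) by auto
    then have "2 \<le> length f" by (simp add: chain_def valid_def)
    then have len: "length f = Suc j" "1 \<le> j" "j \<le> k" using j by (auto simp: j_def)
    have "f = take (Suc j) x" using chain_prefix[OF cf(1) assms(1) cf(2)] j len by simp
    moreover have "gs \<in> words n (d - j) (x ! j)" "j \<le> d"
      using f *[of j] len calculation by (auto simp: words_def)
    ultimately show "cs \<in> ?R" using f j len by blast
  qed
  show "?R \<subseteq> ?L"
  proof
    fix cs assume "cs \<in> ?R"
    then obtain j gs where j: "1 \<le> j" "j \<le> k" "j \<le> d" "cs = take (Suc j) x # gs" "gs \<in> words n (d - j) (x ! j)"
      by auto
    then have "chain (take (Suc j) x)" using take_chain[OF assms(2,1)] by simp
    then show "cs \<in> ?L" using j * klen by (auto simp: words_def)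
  qed
qed

text \<open>On break points, the terms of the bar differential are the removals of an inner
  point.\<close>

definition rem :: "nat list \<Rightarrow> nat \<Rightarrow> nat list" where
  "rem x j = take j x @ drop (Suc j) x"

lemma rem_nth:
  assumes "j < length x"
  shows "length (rem x j) = length x - 1" "i < j \<Longrightarrow> rem x j ! i = x ! i"
    "j \<le> i \<Longrightarrow> i < length x - 1 \<Longrightarrow> rem x j ! i = x ! Suc i"
  using assms by (auto simp: rem_def nth_append min_def)

lemma valid_rem:
  assumes "valid x" "1 \<le> j" "Suc j < length x" "\<not> bad (x ! (j - 1)) (x ! Suc j)"
  shows "valid (rem x j)"
proof -
  have j: "j < length x" using assms by simp
  note n = rem_nth[OF j]
  have step: "rem x j ! i < rem x j ! Suc i \<and> \<not> bad (rem x j ! i) (rem x j ! Suc i)"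
    if i: "Suc i < length x - 1" for i
  proof -
    consider "Suc i < j" | "Suc i = j" | "j \<le> i" by linarith
    then show ?thesis
    proof cases
      case 1
      then show ?thesis using n i valid_less[OF assms(1), of i "Suc i"] assms(1) by (auto simp: valid_def)
    next
      case 2
      then show ?thesis using n(2)[of i] n(3)[of "Suc i"] i valid_less[OF assms(1), of i "Suc (Suc i)"] assms by auto
    next
      case 3
      then show ?thesis using n(3)[of i] n(3)[of "Suc i"] i
          valid_less[OF assms(1), of "Suc i" "Suc (Suc i)"] assms(1) by (auto simp: valid_def)
    qed
  qed
  have "sorted_wrt (<) (rem x j)"
    using step n(1) by (subst sorted_wrt_iff_nth_Suc_transp) auto
  moreover have "\<forall>y\<in>set (rem x j). y \<le> L"
    using assms(1) by (auto simp: rem_def valid_def dest: in_set_takeD in_set_dropD)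
  ultimately show ?thesis using step n(1) assms by (auto simp: valid_def)
qed

lemma hd_rem: "1 \<le> j \<Longrightarrow> j < length x \<Longrightarrow> hd (rem x j) = hd x"
  by (cases x) (auto simp: rem_def hd_append take_Cons')

lemma rem_insert: "Suc k < length zs \<Longrightarrow> rem (take (Suc k) zs @ c # drop (Suc k) zs) (Suc k) = zs"
  by (simp add: rem_def)

lemma rem_ins: "Suc k < length zs \<Longrightarrow> rem (ins zs k) (Suc k) = zs"
  unfolding ins_def by (rule rem_insert)

lemma rem_inj: "rem x i = rem x j \<Longrightarrow> valid x \<Longrightarrow> i < length x \<Longrightarrow> j < length x \<Longrightarrow> i = j"
proof -
  have *: False if "rem x i = rem x j" "valid x" "i < j" "j < length x" for i j
    using rem_nth(3)[of i x i] rem_nth(2)[of j x i] that valid_less[of x i "Suc i"] by auto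
  assume "rem x i = rem x j" "valid x" "i < length x" "j < length x"
  then show "i = j" using *[of i j] *[of j i] by (metis linorder_neqE_nat)
qed

lemma pre_le: "pre x k \<Longrightarrow> l \<le> k \<Longrightarrow> pre x l"
  by (auto simp: pre_def)

lemma type_unique:
  "pre x k \<Longrightarrow> \<not> pre x (Suc k) \<Longrightarrow> pre x l \<Longrightarrow> \<not> pre x (Suc l) \<Longrightarrow> k = l"
  by (meson Suc_leI linorder_neqE_nat pre_le)

lemma type_not_pre: "typeA x k \<Longrightarrow> \<not> pre x (Suc k)" "typeB x k \<Longrightarrow> \<not> pre x (Suc k)"
  by (auto simp: typeA_def typeB_def pre_def)

lemma chain_types: "chain x \<Longrightarrow> \<not> typeA x k" "chain x \<Longrightarrow> \<not> typeB x k"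
  by (auto simp: chain_def typeA_def typeB_def pre_def)

text \<open>The converse of \<open>valid_ins\<close>. The break point after \<open>k\<close> lies
  before the end of the first bad segment from index \<open>k - 1\<close>, so merging the two pieces
  around \<open>k\<close> gives a piece that is not bad.\<close>

lemma typeB_rem:
  assumes "valid x" "typeB x k"
  obtains l where "k = Suc l" "valid (rem x k)" "typeA (rem x k) l" "x = ins (rem x k) l"
proof -
  have k: "Suc k < length x" "pre x k" "x ! Suc k < nxt x k" using assms(2) by (auto simp: typeB_def)
  have "k \<noteq> 0"
    using k valid_less[OF assms(1), of 0 1] by (cases k) (auto simp: nxt_def)
  then obtain l where l: "k = Suc l" by (cases k) auto
  have "x ! Suc k < E (x ! l)" using k(3) l by (simp add: nxt_def)
  then have "\<not> bad (x ! l) (x ! Suc k)" using less_E_iff valid_le[OF assms(1) k(1)] by simp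
  then have v: "valid (rem x k)" using valid_rem[OF assms(1)] k l by simp
  have kx: "k < length x" using k by simp
  note n = rem_nth[OF kx]
  have nx: "nxt (rem x k) i = nxt x i" if "i \<le> l" for i
    using that l n(2)[of 0] n(2)[of "i - 1"] by (auto simp: nxt_def)
  have p: "pre (rem x k) l"
    unfolding pre_def
  proof (intro conjI allI impI)
    fix i assume "i < l"
    then show "rem x k ! Suc i = nxt (rem x k) i" using nx[of i] n(2)[of "Suc i"] l k(2) by (simp add: pre_def)
  qed (use n(1) l k in simp)
  have c: "nxt (rem x k) l = x ! k" using nx[of l] k(2) l by (simp add: pre_def)
  have A: "typeA (rem x k) l"
    unfolding typeA_def using p c n(1) n(3)[of "Suc l"] l k valid_less[OF assms(1), of k "Suc k"] by simp
  have "ins (rem x k) l = x"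
  proof -
    have "take k (rem x k) = take k x" "drop k (rem x k) = drop (Suc k) x"
      using kx by (simp_all add: rem_def)
    then show ?thesis using c kx by (simp add: ins_def flip: l) (simp add: id_take_nth_drop[symmetric])
  qed
  then show ?thesis using that l v A by simp
qed

text \<open>Every chain has degree at least one, so \<open>n\<close> chains of total degree
  \<open>n\<close> are all single arrows.\<close>

lemma words_arrows:
  "words n n t = (if t + n = L then {map (\<lambda>i. [t + i, t + Suc i]) [0..<n]} else {})"
proof (induction n arbitrary: t)
  case 0
  then show ?case by (auto simp: words_def)
next
  case (Suc n)
  have long: "length cs \<le> degsum cs" if "word s cs" for s cs
    using that
  proof (induction cs arbitrary: s)
    case (Cons c cs)
    then have "2 \<le> length c" by (simp add: chain_def valid_def)
    then show ?case using Cons by fastforce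
  qed simp
  have c2: "chain c \<and> length c = 2 \<and> hd c = t \<longleftrightarrow> c = [t, Suc t] \<and> Suc t \<le> L" for c t
    by (auto simp: chain_def pre_def nxt_def valid_def not_bad_Suc length_Suc_conv numeral_2_eq_2 less_Suc_eq)
  have "words (Suc n) (Suc n) t = (if Suc t \<le> L then (#) [t, Suc t] ` words n n (Suc t) else {})" (is "?L = ?R")
  proof
    show "?L \<subseteq> ?R"
    proof
      fix cs assume "cs \<in> ?L"
      then obtain f gs where f: "cs = f # gs" "chain f" "hd f = t" "word (last f) gs" "length gs = n"
          "length f - 1 + degsum gs = Suc n"
        by (cases cs) (auto simp: words_def)
      have "2 \<le> length f" using f by (simp add: chain_def valid_def)
      then have l: "length f = 2" using long[OF f(4)] f by simp
      then have "f = [t, Suc t]" "Suc t \<le> L" using c2[of f t] f by auto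
      then show "cs \<in> ?R" using f l by (auto simp: words_def)
    qed
    show "?R \<subseteq> ?L" using c2[of "[t, Suc t]" t] by (auto simp: words_def)
  qed
  also have "\<dots> = (if t + Suc n = L then {map (\<lambda>i. [t + i, t + Suc i]) [0..<Suc n]} else {})"
  proof -
    have "map (\<lambda>i. [t + i, t + Suc i]) [0..<Suc n] = [t, Suc t] # map (\<lambda>i. [Suc t + i, Suc t + Suc i]) [0..<n]"
      by (simp add: upt_conv_Cons map_Suc_upt[symmetric] comp_def del: upt_Suc)
    then show ?thesis by (auto simp: Suc.IH)
  qed
  finally show ?case .
qed

section \<open>The stages of the zigzag that starts at a slow list\<close>

text \<open>The zigzag from \<open>z\<close> has reached \<open>y\<close>, and everything after
  index \<open>k\<close> is still untouched. Two break points are processed at a time: the one at an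
  odd index may have to be moved, the one at the next even index either fits or is a gap of
  \<open>z\<close> itself.\<close>

definition state :: "nat list \<Rightarrow> nat list \<Rightarrow> nat \<Rightarrow> bool" where
  "state z y k \<longleftrightarrow> even k \<and> valid y \<and> pre y k \<and> length y = length z \<and> hd y = hd z \<and>
     (\<forall>i. k \<le> i \<longrightarrow> i < length z \<longrightarrow> y ! i = z ! i) \<and>
     (\<forall>i. even i \<longrightarrow> Suc (Suc i) \<le> k \<longrightarrow> E (z ! i) = z ! Suc (Suc i))"

context
  fixes z y k
  assumes st: "state z y k" and A: "typeA y k" and z: "valid z" "slow z"
begin

private lemma facts:
  shows k: "Suc k < length y" and len: "length y = length z"
    and tail: "\<And>i. k \<le> i \<Longrightarrow> i < length z \<Longrightarrow> y ! i = z ! i"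
    and yk: "y ! k = z ! k" and vy: "valid y" and c: "z ! k < nxt y k" "nxt y k < z ! Suc k"
    and zk: "z ! Suc k < E (z ! k)"
proof -
  show k: "Suc k < length y" and len: "length y = length z"
    and tail: "\<And>i. k \<le> i \<Longrightarrow> i < length z \<Longrightarrow> y ! i = z ! i" and vy: "valid y"
    using st A by (auto simp: state_def typeA_def)
  then show yk: "y ! k = z ! k" by simp
  show "z ! k < nxt y k" using nxt_greater[OF vy, of k] A yk by (simp add: typeA_def)
  show "nxt y k < z ! Suc k" using A tail[of "Suc k"] k len by (simp add: typeA_def)
  show "z ! Suc k < E (z ! k)" using z(1) k len valid_le[OF z(1), of "Suc k"]
    by (auto simp: less_E_iff valid_def)
qed

private lemma x_nth:
  shows "length (ins y k) = Suc (length z)" "i \<le> k \<Longrightarrow> ins y k ! i = y ! i"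
    "ins y k ! Suc k = nxt y k" "k < i \<Longrightarrow> i < length z \<Longrightarrow> ins y k ! Suc i = z ! i"
    "Suc (Suc i) \<le> Suc k \<Longrightarrow> ins y k ! Suc (Suc i) = E (ins y k ! i)"
  using ins_nth[OF k] len tail valid_ins(2)[OF vy A]
  by (auto simp: typeB_def pre_def nxt_def)

text \<open>The new point lies above \<open>z ! k\<close> and E is monotone, so the inequality that
  started at \<open>z ! k\<close> may start at the new point.\<close>

lemma slow_ins: "slow (ins y k)"
  unfolding slow_def
proof (intro allI impI)
  fix i assume i: "Suc (Suc i) < length (ins y k)"
  consider "Suc (Suc i) \<le> Suc k" | "i = k" | "i = Suc k" | l where "i = Suc l" "k < l"
    by (metis Suc_le_mono Suc_lessI not_less_eq_eq less_Suc_eq_le less_imp_Suc_add linorder_neqE_nat not_less_eq)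
  then show "ins y k ! Suc (Suc i) \<le> E (ins y k ! i)"
  proof cases
    case 1
    then show ?thesis using x_nth(5)[of i] by simp
  next
    case 2
    then show ?thesis using x_nth(4)[of "Suc k"] x_nth(2)[of k] k len yk zk by simp
  next
    case 3
    have "z ! Suc (Suc k) \<le> E (z ! k)" using z(2) 3 i x_nth(1) by (simp add: slow_def)
    also have "\<dots> \<le> E (nxt y k)" using c by (simp add: E_mono)
    finally show ?thesis using 3 i x_nth by simp
  next
    case 4
    then show ?thesis using x_nth(4)[of l] x_nth(4)[of "Suc (Suc l)"] z(2) i x_nth(1) by (simp add: slow_def)
  qed
qed

lemma drop_ins:
  assumes "j \<le> Suc k"
  shows "valid (drop j (ins y k))" "slow (drop j (ins y k))" "last (drop j (ins y k)) = last z"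
    "length (drop j (ins y k)) = Suc (length z) - j" "hd (drop j (ins y k)) = ins y k ! j"
proof -
  show "valid (drop j (ins y k))"
    by (rule sub_valid[OF valid_ins(1)[OF vy A]]) (use assms k len x_nth(1) in simp)
  show "slow (drop j (ins y k))" using slow_ins by (auto simp: slow_def add.commute)
  show "length (drop j (ins y k)) = Suc (length z) - j" using x_nth(1) by simp
  have "last (ins y k) = last z"
  proof -
    have "ins y k ! length z = z ! (length z - 1)" using x_nth(4)[of "length z - 1"] k len by (cases "length z") auto
    then show ?thesis using valid_ne(2)[OF valid_ins(1)[OF vy A]] valid_ne(2)[OF z(1)] x_nth(1) by simp
  qed
  then show "last (drop j (ins y k)) = last z" using assms k len x_nth(1) by (simp add: last_drop)
  show "hd (drop j (ins y k)) = ins y k ! j" using assms k len x_nth(1) by (simp add: hd_drop_conv_nth)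
qed

private lemma gapI:
  assumes "j \<le> i" "even (i - j)" "Suc (Suc i) < Suc (length z)" "ins y k ! Suc (Suc i) < E (ins y k ! i)"
  shows "even_gap (drop j (ins y k))"
  unfolding even_gap_def using assms x_nth(1) by (intro exI[of _ "i - j"]) auto

text \<open>Cutting the piece from \<open>z ! k\<close> to \<open>z ! Suc k\<close>, which is not
  bad, creates a gap at the even index \<open>k\<close>. This is why even splittings contribute
  nothing.\<close>

lemma gap_even: "even j \<Longrightarrow> j \<le> Suc k \<Longrightarrow> even_gap (drop j (ins y k))"
proof -
  assume "even j" "j \<le> Suc k"
  then show ?thesis
    using st k len yk zk x_nth(2)[of k] x_nth(4)[of "Suc k"]
    by (intro gapI[of j k]) (auto simp: state_def le_Suc_eq)
qed

text \<open>If the zigzag can continue, there is another gap at the odd index \<open>Suc k\<close>.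
  Then all splittings of the inserted term vanish and only the continuation counts.\<close>

lemma gap_improper:
  assumes "j \<le> Suc k" "Suc (Suc k) < length z" "z ! Suc (Suc k) < E (nxt y k)"
  shows "even_gap (drop j (ins y k))"
proof (cases "even j")
  case False
  then show ?thesis
    using st assms x_nth(3) x_nth(4)[of "Suc (Suc k)"]
    by (intro gapI[of j "Suc k"]) (auto simp: state_def)
qed (use gap_even assms in simp)

text \<open>Insertion shifts later entries by one and an odd splitting restores the parity, so a gap
  of \<open>z\<close> remains a gap at an even index. If it sits at \<open>k\<close> itself, it
  passes to the inserted point.\<close>

lemma gap_inherited:
  assumes "j \<le> Suc k" "even_gap z"
  shows "even_gap (drop j (ins y k))"
proof (cases "even j")
  case False
  obtain i where i: "even i" "Suc (Suc i) < length z" "z ! Suc (Suc i) < E (z ! i)"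
    using assms(2) by (auto simp: even_gap_def)
  have "\<not> Suc (Suc i) \<le> k" using i st by (auto simp: state_def)
  then have "k \<le> i" using i(1) st by (auto simp: state_def not_less_eq_eq le_Suc_eq)
  show ?thesis
  proof (cases "i = k")
    case True
    have "E (z ! k) \<le> E (nxt y k)" using c by (simp add: E_mono)
    then show ?thesis using True i gap_improper[OF assms(1)] by auto
  next
    case neq: False
    then show ?thesis
      using \<open>k \<le> i\<close> i False assms x_nth(4)[of i] x_nth(4)[of "Suc (Suc i)"]
      by (intro gapI[of j "Suc i"]) auto
  qed
qed (use gap_even assms in simp)

text \<open>After an odd splitting the relevant indices of the enlarged list are odd. Up to the
  insertion the chain equations hold there, at the insertion the last hypothesis applies, and beyond
  it the indices are even indices of \<open>z\<close>.\<close>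

lemma gap_none:
  assumes "odd j" "j \<le> Suc k" "\<not> even_gap z" "Suc (Suc k) < length z \<Longrightarrow> E (nxt y k) = z ! Suc (Suc k)"
  shows "\<not> even_gap (drop j (ins y k))"
proof
  assume "even_gap (drop j (ins y k))"
  then obtain i' where i': "even i'" "Suc (Suc i') < length (drop j (ins y k))"
      "drop j (ins y k) ! Suc (Suc i') < E (drop j (ins y k) ! i')"
    unfolding even_gap_def by blast
  define i where "i = j + i'"
  have i: "odd i" "Suc (Suc i) < Suc (length z)" "ins y k ! Suc (Suc i) < E (ins y k ! i)"
    using i' assms(1) x_nth(1) by (auto simp: i_def)
  have "\<not> Suc (Suc i) \<le> Suc k" using x_nth(5)[of i] i by auto
  moreover have "i \<noteq> Suc k" using i assms(4) x_nth(3) x_nth(4)[of "Suc (Suc k)"] by auto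
  moreover have "i \<noteq> k" using i st by (auto simp: state_def)
  ultimately have "Suc k < i" by simp
  then obtain l where l: "i = Suc l" "k < l" by (cases i) auto
  then show False using i x_nth(4)[of l] x_nth(4)[of "Suc (Suc l)"] assms(3) z(2)
    by (auto simp: even_gap_def)
qed

end

end

section \<open>The recursion satisfied by the transferred maps, and its solution\<close>

text \<open>\<open>FF m\<close> stands for the m-th comultiplication of the bar construction
  followed by the m-th tensor power of p. \<open>Phi m\<close> is its composite with h before it,
  and p itself for \<open>m = 1\<close>. Stated abstractly, the solution is pure combinatorics of
  lists.\<close>

locale transfer_recursion = overlaps L bad for L bad +
  fixes b :: "nat list \<Rightarrow> 'x"
    and Phi FF :: "nat \<Rightarrow> nat list \<Rightarrow> ('x list \<Rightarrow>\<^sub>0 'k::field)"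
  assumes Phi_chain: "\<And>m z. 1 \<le> m \<Longrightarrow> chain z \<Longrightarrow>
      Phi m z = (if m = 1 then Poly_Mapping.single [b z] 1 else 0)"
    and Phi_B: "\<And>m z k. 1 \<le> m \<Longrightarrow> valid z \<Longrightarrow> typeB z k \<Longrightarrow> Phi m z = 0"
    and Phi_A: "\<And>m z k. 1 \<le> m \<Longrightarrow> valid z \<Longrightarrow> typeA z k \<Longrightarrow>
      Phi m z = (if m = 1 then 0 else smul ((-1) ^ k) (FF m (ins z k)))
        + (if continues z k then Phi m (z[Suc k := nxt z k]) else 0)"
    and FF_B: "\<And>m z k. 1 \<le> m \<Longrightarrow> valid z \<Longrightarrow> typeB z k \<Longrightarrow>
      FF (Suc m) z = (\<Sum>j = 1..k. smul ((-1) ^ (Suc m * Suc j))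
         (tens (Poly_Mapping.single [b (take (Suc j) z)] 1) (Phi m (drop j z))))"
begin

text \<open>The total degree is forced: \<open>z\<close> has degree \<open>length z - 1\<close>, h
  raises it by 1 and the m-th comultiplication by \<open>m - 2\<close>. It is also the largest
  degree that \<open>slow_bound\<close> allows.\<close>

definition target :: "nat \<Rightarrow> nat list \<Rightarrow> ('x list \<Rightarrow>\<^sub>0 'k)" where
  "target m z = (if even_gap z then 0
     else (\<Sum>cs\<in>words m (length z + m - 2) (hd z). Poly_Mapping.single (map b cs) 1))"

text \<open>The lists are aligned at their right ends: the last entry of \<open>z\<close> is
  compared with \<open>c D\<close>.\<close>

definition dominates :: "(nat \<Rightarrow> nat) \<Rightarrow> nat \<Rightarrow> nat list \<Rightarrow> bool" where
  "dominates c D z \<longleftrightarrow> length z \<le> Suc D \<and> (\<forall>i<length z. c (Suc D - length z + i) \<le> z ! i)"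

text \<open>Models the chain from which the computation starts, of degree \<open>D\<close>, with
  sentinel \<open>Suc L\<close>. Only the recursion by E is kept, so a single piece that is not bad
  and ends at \<open>L\<close> qualifies for \<open>D = 1\<close> as well.\<close>

definition base :: "(nat \<Rightarrow> nat) \<Rightarrow> nat \<Rightarrow> bool" where
  "base c D \<longleftrightarrow> c D = L \<and> c (Suc D) = Suc L \<and> (\<forall>i<D. c (Suc (Suc i)) = E (c i)) \<and> (\<forall>i<D. c i \<le> c (Suc i))"

text \<open>A list split after \<open>j\<close> pieces moves against \<open>c\<close> by
  \<open>j - 1\<close> places, since insertion has added an entry. At least one place of slack is
  needed at odd indices, where the new entries are not bounded by the recursion.\<close>

lemma dominates_drop:
  assumes "base c D" "dominates c D z" "state z y k" "typeA y k" "valid z" "slow z" "1 \<le> j" "j \<le> Suc k"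
  shows "dominates c D (drop j (ins y k))"
proof -
  define s where "s = Suc D - length z"
  note n = ins_nth[of k y]
  have k: "Suc k < length z" "length y = length z" "valid y" "hd y = hd z"
    and tail: "\<And>i. k \<le> i \<Longrightarrow> i < length z \<Longrightarrow> y ! i = z ! i"
    using assms(3,4) by (auto simp: state_def typeA_def)
  have zne: "z \<noteq> []" using valid_hd_last(2)[OF assms(5)] .
  have sD: "s + length z = Suc D" and dz: "\<And>i. i < length z \<Longrightarrow> c (s + i) \<le> z ! i"
    using assms(2) by (auto simp: dominates_def s_def)
  have vx: "valid (ins y k)" "pre (ins y k) (Suc k)"
    using valid_ins[OF k(3) assms(4)] by (auto simp: typeB_def)
  \<comment> \<open>At even indices of the prefix both sides obey the recursion by E, so the
    comparison holds even without the shift.\<close>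
  have ev: "c (s + i) \<le> ins y k ! i" if "even i" "i \<le> Suc k" for i
    using that
  proof (induction i rule: less_induct)
    case (less i)
    show ?case
    proof (cases "i = 0")
      case True
      then show ?thesis using dz[of 0] n(2)[of 0] k valid_ne(1)[OF k(3)] valid_ne(1)[OF assms(5)] zne by auto
    next
      case False
      then obtain l where l: "i = Suc (Suc l)" using less.prems by (metis even_Suc even_zero not0_implies_Suc)
      have "c (s + i) = E (c (s + l))" using assms(1) l less.prems k sD by (auto simp: base_def)
      also have "\<dots> \<le> E (ins y k ! l)" using less l by (intro E_mono) auto
      also have "\<dots> = ins y k ! i" using vx(2) l less.prems by (auto simp: pre_def nxt_def)
      finally show ?thesis .
    qed
  qed
  have all: "c (s + i - 1) \<le> ins y k ! i" if i: "1 \<le> i" "i < Suc (length z)" for i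
  proof -
    obtain l where l: "i = Suc l" using i by (cases i) auto
    consider "even l" "l \<le> k" | "odd l" "l \<le> k" | "k < l" by linarith
    then show ?thesis
    proof cases
      case 1
      then have "c (s + l) \<le> ins y k ! l" using ev by simp
      also have "\<dots> \<le> ins y k ! i" using valid_mono[OF vx(1), of l i] l i n(1) k by simp
      finally show ?thesis using l by simp
    next
      case 2
      then have "c (s + l) \<le> c (s + i)" using assms(1) l k(1) sD by (auto simp: base_def)
      then show ?thesis using ev[of i] 2 l by simp
    next
      case 3
      then show ?thesis using n(4)[of l] tail[of l] l i k dz[of l] by simp
    qed
  qed
  show ?thesis
    unfolding dominates_def
  proof (intro conjI allI impI)
    have len: "length (drop j (ins y k)) = Suc (length z) - j" using n(1) k by simp
    show "length (drop j (ins y k)) \<le> Suc D" using len sD assms(7) by simp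
    fix i assume i: "i < length (drop j (ins y k))"
    have "Suc D - length (drop j (ins y k)) + i = s + (j + i) - 1"
      using len sD assms(7,8) k by simp
    then show "c (Suc D - length (drop j (ins y k)) + i) \<le> drop j (ins y k) ! i"
      using all[of "j + i"] i n(1) k assms(7) by simp
  qed
qed

lemma tens_single_words:
  "tens (Poly_Mapping.single [b f] 1) (\<Sum>cs\<in>A. Poly_Mapping.single (map b cs) 1)
     = (\<Sum>cs\<in>(#) f ` A. Poly_Mapping.single (map b cs) (1 :: 'k))"
  by (simp add: tens_sum_right sum.reindex)

text \<open>The competitor \<open>f\<close> starts strictly below the second entry of the aligned
  part of \<open>c\<close>, hence its first break point does not exceed that entry. From there
  monotonicity of E keeps the odd break points of \<open>f\<close> below those of \<open>c\<close>,
  and so below those of \<open>z\<close>.\<close>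

lemma no_dominated_chain:
  assumes "base c D" "dominates c D z" "valid z" "chain f" "hd f = hd z" "length f = length z" "last f = L"
    and "odd i" "i < length z"
  shows "f ! i \<le> z ! i"
proof -
  define s where "s = Suc D - length z"
  have sD: "s + length z = Suc D" and dz: "\<And>i. i < length z \<Longrightarrow> c (s + i) \<le> z ! i"
    using assms(2) by (auto simp: dominates_def s_def)
  have zl: "2 \<le> length z" using assms(3) by (simp add: valid_def)
  have vf: "valid f" and nf: "\<And>i. Suc i < length f \<Longrightarrow> f ! Suc i = nxt f i"
    using assms(4) by (auto simp: chain_def pre_def)
  have f0: "f ! 0 = hd z" using valid_ne(1)[OF vf] assms(5) by simp
  \<comment> \<open>Otherwise \<open>f\<close> would start above \<open>c (Suc s)\<close>, and
    \<open>word_degree_bound\<close> with \<open>length z - 2\<close> pieces would contradict its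
    degree \<open>length z - 1\<close>.\<close>
  have "hd z < c (Suc s)"
  proof (rule ccontr)
    assume "\<not> hd z < c (Suc s)"
    then have h: "c (Suc s) \<le> hd z" by simp
    have w: "word (hd z) [f]" using assms by simp
    show False
    proof (cases "length z = 2")
      case True
      then have "c (Suc s) = L" using sD assms(1) by (simp add: base_def)
      then show False using word_less[OF w] h by simp
    next
      case False
      have "degsum [f] + 1 \<le> (length z - 2) + length [f]"
      proof (rule word_degree_bound[OF w, of "\<lambda>i. c (Suc s + i)"])
        have e: "Suc s + (length z - 2) = D" using sD zl by simp
        then show "c (Suc s + (length z - 2)) = L" "c (Suc s + Suc (length z - 2)) = Suc L"
          using assms(1) by (auto simp: base_def)
        fix i assume "Suc i \<le> length z - 2"
        then have "Suc s + i < D" using e by simp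
        then show "c (Suc s + Suc (Suc i)) \<le> E (c (Suc s + i))"
          using assms(1) by (auto simp: base_def)
      qed (use h zl False in auto)
      then show False using assms(6) zl by simp
    qed
  qed
  then have f1: "f ! 1 \<le> c (s + 1)" using nf[of 0] assms(6) zl f0 by (simp add: nxt_def)
  have "f ! i \<le> c (s + i)"
    using assms(8,9)
  proof (induction i rule: less_induct)
    case (less i)
    show ?case
    proof (cases "i = 1")
      case False
      then obtain l where l: "i = Suc (Suc l)" using less.prems
        by (metis One_nat_def even_zero old.nat.exhaust)
      have "f ! i = E (f ! l)" using nf[of "Suc l"] l less.prems assms(6) by (simp add: nxt_def)
      also have "\<dots> \<le> E (c (s + l))" using less l by (intro E_mono) auto
      also have "\<dots> = c (s + i)" using assms(1) l less.prems sD by (auto simp: base_def)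
      finally show ?thesis .
    qed (use f1 in simp)
  qed
  then show ?thesis using dz[OF assms(9)] by simp
qed

text \<open>For one factor \<open>y\<close> is the only chain of its degree with its starting point.
  For more factors \<open>y\<close> begins with an arrow, so \<open>no_top_word\<close> applies to
  it.\<close>

lemma target_chain:
  assumes "chain y" "length y = length z" "hd y = hd z" "last y = L" "\<not> even_gap z" "1 \<le> m"
  shows "target m z = (if m = 1 then Poly_Mapping.single [b y] 1 else 0)"
proof -
  have v: "valid y" "pre y (length y - 1)" using assms(1) by (auto simp: chain_def)
  have l: "2 \<le> length y" using v by (simp add: valid_def)
  show ?thesis
  proof (cases "m = 1")
    case True
    have "words 1 (length z - 1) (hd z) = {[y]}"
    proof -
      have "cs = [y]" if w: "word (hd z) cs" "length cs = 1" "degsum cs = length z - 1" for cs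
      proof -
        obtain f where f: "cs = [f]" using w(2) by (auto simp: length_Suc_conv)
        then have "chain f" "hd f = hd y" "length f - 1 = length y - 1" using w assms by auto
        moreover have "2 \<le> length f" using calculation(1) by (simp add: chain_def valid_def)
        ultimately have "length f = length y" using l by simp
        then show ?thesis using chain_prefix[OF \<open>chain f\<close> v(2) \<open>hd f = hd y\<close>] f l by simp
      qed
      moreover have "word (hd z) [y]" using assms by simp
      moreover have "degsum [y] = length z - 1" using assms by simp
      ultimately show ?thesis unfolding words_def by fastforce
    qed
    then show ?thesis using True assms by (simp add: target_def)
  next
    case False
    have "slow y"
      using v(2) by (auto simp: slow_def pre_def nxt_def)
    moreover have "y ! 1 = Suc (y ! 0)" using v(2) l by (auto simp: pre_def nxt_def)
    ultimately have "words m (length y + m - 2) (hd y) = {}"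
      using no_top_word[OF v(1) _ assms(4)] False assms(6) by simp
    then show ?thesis using False assms by (simp add: target_def)
  qed
qed

text \<open>The outer induction on \<open>m\<close> evaluates the right factors after a splitting.
  The inner one follows the zigzag through the states \<open>y\<close> of the fixed list
  \<open>z\<close>, where each \<open>y\<close> must yield the same value, that of
  \<open>z\<close>.\<close>

lemma Phi_eq_target:
  assumes base: "base c D"
  shows "1 \<le> m \<Longrightarrow> valid z \<Longrightarrow> slow z \<Longrightarrow> last z = L \<Longrightarrow> dominates c D z \<Longrightarrow> Phi m z = target m z"
proof (induction m arbitrary: z)
  case 0
  then show ?case by simp
next
  case (Suc m)
  note z = Suc.prems(2-5)
  have zL: "z ! (length z - 1) = L" using valid_ne(2)[OF z(1)] z(3) by simp
  have main: "Phi (Suc m) y = target (Suc m) z" if "state z y k" for y k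
    using that
  proof (induction "length z - k" arbitrary: y k rule: less_induct)
    case less
    note st = less.prems
    have y: "even k" "valid y" "pre y k" "length y = length z" "hd y = hd z"
      and tail: "\<And>i. k \<le> i \<Longrightarrow> i < length z \<Longrightarrow> y ! i = z ! i"
      and good: "\<And>i. even i \<Longrightarrow> Suc (Suc i) \<le> k \<Longrightarrow> E (z ! i) = z ! Suc (Suc i)"
      using st by (auto simp: state_def)
    have kl: "k < length z" using y by (simp add: pre_def)
    have yL: "last y = L" using valid_ne(2)[OF y(2)] tail[of "length z - 1"] y(4) kl zL by simp
    have yk: "y ! k = z ! k" using tail kl by simp
    \<comment> \<open>With index \<open>Suc k\<close> in order, the next required break point is E
      of \<open>z ! k\<close>, whatever moves were made before. Slowness leaves equality, which
      leads to the next state, or a strict inequality, which is an even gap of \<open>z\<close> and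
      a dead end of the zigzag.\<close>
    have advance: "Phi (Suc m) w = target (Suc m) z"
      if w: "valid w" "pre w (Suc k)" "length w = length z" "hd w = hd z" "w ! k = z ! k"
        and wt: "\<And>i. Suc k < i \<Longrightarrow> i < length z \<Longrightarrow> w ! i = z ! i" and l: "Suc (Suc k) < length z" for w
    proof (cases "E (z ! k) = z ! Suc (Suc k)")
      case True
      have "state z w (Suc (Suc k))"
        unfolding state_def
      proof (intro conjI allI impI)
        show "pre w (Suc (Suc k))"
          unfolding pre_def
        proof (intro conjI allI impI)
          fix i assume "i < Suc (Suc k)"
          then show "w ! Suc i = nxt w i"
            using w(2) wt[of "Suc (Suc k)"] l w(5) True
            by (cases "i = Suc k") (auto simp: pre_def nxt_def)
        qed (use l w in simp)
      next
        fix i assume i: "even i" "Suc (Suc i) \<le> Suc (Suc k)"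
        then show "E (z ! i) = z ! Suc (Suc i)"
          using good[of i] True y(1) by (cases "i = k") (auto simp: le_Suc_eq)
      qed (use w wt y in auto)
      then show ?thesis using less.hyps[of "Suc (Suc k)" w] l by simp
    next
      case False
      then have lt: "z ! Suc (Suc k) < E (z ! k)" using z(2) l by (simp add: slow_def less_le)
      then have "typeB w (Suc k)"
        using w wt[of "Suc (Suc k)"] l by (simp add: typeB_def nxt_def)
      moreover have "even_gap z" using lt l y(1) by (auto simp: even_gap_def)
      ultimately show ?thesis using Phi_B[OF _ w(1), of "Suc m"] by (simp add: target_def)
    qed
    have finish: "Phi (Suc m) y = target (Suc m) z" if "chain y" "length z \<le> Suc (Suc k)"
    proof -
      have "\<not> even_gap z"
      proof
        assume "even_gap z"
        then obtain i where i: "even i" "Suc (Suc i) < length z" "z ! Suc (Suc i) < E (z ! i)"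
          unfolding even_gap_def by blast
        then have "i < k" using that(2) by simp
        then have "Suc (Suc i) \<le> k" using i(1) y(1) by presburger
        then show False using good i by simp
      qed
      then show ?thesis using Phi_chain[OF _ that(1), of "Suc m"] target_chain[OF that(1) y(4,5) yL, of "Suc m"] by simp
    qed
    show ?case
    proof (cases "Suc k = length z")
      case True
      then have "chain y" using y by (simp add: chain_def flip: True)
      then show ?thesis using finish True by simp
    next
      case False
      then have k: "Suc k < length z" using kl by simp
      have yk1: "y ! Suc k = z ! Suc k" using tail[of "Suc k"] k by simp
      consider (eq) "nxt y k = z ! Suc k" | (A) "typeA y k" | (B) "typeB y k"
        unfolding typeA_def typeB_def using y k yk1 by (metis linorder_neqE_nat)
      then show ?thesis
      proof cases
        case eq
        then have p: "pre y (Suc k)" using y(3) k y(4) yk1 by (auto simp: pre_def less_Suc_eq)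
        show ?thesis
        proof (cases "Suc (Suc k) = length z")
          case True
          then have "chain y" using y p by (simp add: chain_def flip: True)
          then show ?thesis using finish True by simp
        next
          case False
          show ?thesis by (rule advance[OF y(2) p y(4,5) yk]) (use tail k False in auto)
        qed
      next
        case B
        then have c: "z ! Suc k < nxt y k" using yk1 by (simp add: typeB_def)
        \<comment> \<open>The zigzag stops at the type B list \<open>y\<close>, so the target must
          vanish too. For one factor domination excludes a competing chain; for more factors
          \<open>y\<close> is itself slow and begins with an arrow.\<close>
        have "target (Suc m) z = 0"
        proof (cases "m = 0")
          case True
          have "words 1 (length z - 1) (hd z) = {}"
          proof (rule ccontr)
            assume "words 1 (length z - 1) (hd z) \<noteq> {}"
            then obtain cs where cs: "word (hd z) cs" "length cs = 1" "degsum cs = length z - 1"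
              by (auto simp: words_def)
            then obtain f where f: "cs = [f]" by (auto simp: length_Suc_conv)
            then have fc: "chain f" "hd f = hd z" "last f = L" using cs by auto
            have "2 \<le> length f" using fc by (simp add: chain_def valid_def)
            then have fl: "length f = length z" using cs f k by simp
            have eq: "f ! i = y ! i" if "i \<le> k" for i
              using chain_unique[OF fc(1) y(3)] fc y that fl kl by simp
            have "f ! Suc k = nxt f k" using fc(1) fl k by (auto simp: chain_def pre_def)
            also have "\<dots> = nxt y k" using eq[of 0] eq[of "k - 1"] by (simp add: nxt_def)
            finally show False
              using no_dominated_chain[OF base z(4) z(1) fc(1,2) fl fc(3), of "Suc k"] c y(1) k by simp
          qed
          then show ?thesis using True by (simp add: target_def)
        next
          case False
          have "k \<noteq> 0"
          proof
            assume "k = 0"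
            then have "y ! 1 < Suc (y ! 0)" using B by (simp add: typeB_def nxt_def)
            then show False using valid_less[OF y(2), of 0 1] k y(4) \<open>k = 0\<close> by simp
          qed
          then have "y ! 1 = Suc (y ! 0)" using y(3) by (auto simp: pre_def nxt_def)
          moreover have "slow y"
            unfolding slow_def
          proof (intro allI impI)
            fix i assume i: "Suc (Suc i) < length y"
            consider "Suc (Suc i) \<le> k" | "Suc i = k" | "k \<le> i" by linarith
            then show "y ! Suc (Suc i) \<le> E (y ! i)"
            proof cases
              case 1
              then show ?thesis using y(3) by (auto simp: pre_def nxt_def)
            next
              case 2
              then show ?thesis using c yk1 by (auto simp: nxt_def)
            next
              case 3
              then show ?thesis using z(2) tail[of i] tail[of "Suc (Suc i)"] i y(4) by (simp add: slow_def)
            qed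
          qed
          ultimately have "words (Suc m) (length z + Suc m - 2) (hd z) = {}"
            using no_top_word[OF y(2) _ yL, of "Suc m"] y(4,5) False by simp
          then show ?thesis by (simp add: target_def)
        qed
        then show ?thesis using Phi_B[OF _ y(2) B, of "Suc m"] by simp
      next
        case A
        let ?x = "ins y k" and ?c = "nxt y k"
        have c: "z ! k < ?c" "?c < z ! Suc k"
          using nxt_greater[OF y(2,3)] yk A yk1 by (auto simp: typeA_def)
        note d = drop_ins[OF st A z(1,2)]
        note vx = valid_ins[OF y(2) A]
        have IH: "Phi m (drop j ?x) = target m (drop j ?x)" if "1 \<le> m" "1 \<le> j" "j \<le> Suc k" for j
          using Suc.IH[OF that(1) d(1,2)] d(3) z(3) dominates_drop[OF base z(4) st A z(1,2)] that by simp
        have FF: "FF (Suc m) ?x = (\<Sum>j = 1..Suc k. smul ((-1) ^ (Suc m * Suc j))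
             (tens (Poly_Mapping.single [b (take (Suc j) ?x)] 1) (target m (drop j ?x))))" if "1 \<le> m"
          using IH that by (subst FF_B[OF that vx]) (intro sum.cong refl, simp)
        have FF0: "(if Suc m = 1 then 0 else smul ((-1) ^ k) (FF (Suc m) ?x)) = 0"
          if "\<And>j. 1 \<le> j \<Longrightarrow> j \<le> Suc k \<Longrightarrow> even_gap (drop j ?x)"
          using FF that by (cases "m = 0") (auto simp: target_def intro!: sum.neutral)
        have PA: "Phi (Suc m) y = (if Suc m = 1 then 0 else smul ((-1) ^ k) (FF (Suc m) ?x))
            + (if continues y k then Phi (Suc m) (y[Suc k := ?c]) else 0)"
          by (rule Phi_A[OF _ y(2) A]) simp
        show ?thesis
        proof (cases "continues y k")
          case True
          then have l: "Suc (Suc k) < length z" and nb: "\<not> bad ?c (z ! Suc (Suc k))"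
            using y(4) tail[of "Suc (Suc k)"] by (auto simp: continues_def)
          have "z ! Suc (Suc k) < E ?c" using nb less_E_iff valid_le[OF z(1) l] by simp
          then have "even_gap (drop j ?x)" if "j \<le> Suc k" for j
            using gap_improper[OF st A z(1,2) that l] by simp
          then have "Phi (Suc m) y = Phi (Suc m) (y[Suc k := ?c])" using PA FF0 True by simp
          also have "\<dots> = target (Suc m) z"
            by (rule advance[OF valid_update[OF y(2) A True]])
              (use y yk tail l valid_ne(1)[OF y(2)] valid_ne(1)[OF z(1)] in
                \<open>auto simp: hd_conv_nth simp flip: length_greater_0_conv\<close>)
          finally show ?thesis .
        next
          case False
          \<comment> \<open>Badness gives one inequality; slowness at \<open>k\<close> and
            monotonicity of E give the other.\<close>
          have proper: "E ?c = z ! Suc (Suc k)" "bad ?c (z ! Suc (Suc k))" if l: "Suc (Suc k) < length z"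
          proof -
            show bd: "bad ?c (z ! Suc (Suc k))"
              using False l y(4) tail[of "Suc (Suc k)"] by (simp add: continues_def)
            have "z ! Suc (Suc k) \<le> E (z ! k)" using z(2) l by (simp add: slow_def)
            also have "\<dots> \<le> E ?c" using c by (simp add: E_mono)
            finally show "E ?c = z ! Suc (Suc k)" using bd E_le_iff valid_le[OF z(1) l]
              by (simp add: le_antisym)
          qed
          have PF: "Phi (Suc m) y = (if m = 0 then 0 else FF (Suc m) ?x)"
            using PA False y(1) by simp
          have xhd: "hd ?x = hd z" using valid_ne(1)[OF vx(1)] valid_ne(1)[OF y(2)] y(5) ins_nth(2)[of k y 0] k y(4) by simp
          have preX: "pre ?x (Suc k)" using vx(2) by (simp add: typeB_def)
          \<comment> \<open>A longer chain would contain a piece from \<open>?c\<close> to E of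
            \<open>z ! k\<close>, which is bad by \<open>proper\<close> or ends beyond L. So all
            first chains of words are prefixes of the enlarged list.\<close>
          have short: "length f \<le> Suc (Suc k)" if f: "chain f" "hd f = hd z" for f
          proof (rule ccontr)
            assume "\<not> ?thesis"
            then have lf: "Suc (Suc k) < length f" by simp
            have vf: "valid f" using f by (simp add: chain_def)
            have "f ! i = ?x ! i" if "i \<le> Suc k" for i
              using chain_unique[OF f(1) preX, of i] f xhd that lf by simp
            then have fk: "f ! k = z ! k" "f ! Suc k = ?c"
              using ins_nth[of k y] k y(4) yk by auto
            have E: "f ! Suc (Suc k) = E (z ! k)"
              using f(1) lf fk by (auto simp: chain_def pre_def nxt_def)
            show False
            proof (cases "Suc (Suc k) < length z")
              case True
              then have "z ! Suc (Suc k) \<le> f ! Suc (Suc k)" using z(2) E by (simp add: slow_def)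
              then have "bad ?c (f ! Suc (Suc k))" using proper(2)[OF True] bad_mono by blast
              then show False using vf lf fk by (auto simp: valid_def)
            next
              case False
              then have "z ! Suc k = L" using zL k by (metis Suc_lessI diff_Suc_1)
              moreover have "\<not> bad (z ! k) (z ! Suc k)" using z(1) k by (simp add: valid_def)
              ultimately have "L < E (z ! k)" by (simp add: less_E_iff)
              then show False using valid_le[OF vf lf] E by simp
            qed
          qed
          show ?thesis
          proof (cases "even_gap z")
            case True
            then have "even_gap (drop j ?x)" if "j \<le> Suc k" for j
              using gap_inherited[OF st A z(1,2) that] by simp
            then show ?thesis using PF FF0 True y(1) by (auto simp: target_def split: if_splits)
          next
            case ng: False
            show ?thesis
            proof (cases "m = 0")
              case True
              have "words 1 (length z - 1) (hd z) = {}"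
              proof (rule ccontr)
                assume "words 1 (length z - 1) (hd z) \<noteq> {}"
                then obtain cs where cs: "word (hd z) cs" "length cs = 1" "degsum cs = length z - 1"
                  by (auto simp: words_def)
                then obtain f where f: "cs = [f]" by (auto simp: length_Suc_conv)
                then have fc: "chain f" "hd f = hd z" "last f = L" using cs by auto
                have "2 \<le> length f" using fc by (simp add: chain_def valid_def)
                then have fl: "length f = length z" using cs f k by simp
                then have lz: "length z = Suc (Suc k)" using short[OF fc(1,2)] k by simp
                have "last f = f ! Suc k" using fc(3) fl lz fc(1) valid_ne(2)[of f] by (simp add: chain_def)
                also have "\<dots> = ?x ! Suc k"
                  using chain_unique[OF fc(1) preX, of "Suc k"] fc xhd fl lz by simp
                also have "\<dots> = ?c" using ins_nth(3)[of k y] k y(4) by simp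
                finally show False using fc(3) c valid_le[OF z(1) k] by simp
              qed
              then show ?thesis using True PF ng by (simp add: target_def)
            next
              case False
              let ?d = "length z + Suc m - 2"
              let ?J = "{j. odd j \<and> 1 \<le> j \<and> j \<le> Suc k \<and> j \<le> ?d}"
              have xL: "last ?x = L" using d(3)[of 0] z(3) by simp
              have first: "words (Suc m) ?d (hd ?x) =
                  (\<Union>j\<in>?J. (#) (take (Suc j) ?x) ` words m (?d - j) (?x ! j))"
              proof (rule words_split[OF preX vx(1) xL])
                fix f cs
                assume w: "word (hd ?x) (f # cs)" "length (f # cs) = Suc m" "degsum (f # cs) = ?d"
                have "odd (length f - 1)"
                  using odd_first_chain(1)[OF z(1-3), of f cs] w xhd False k by auto
                then show "odd (length f - 1) \<and> length f \<le> Suc (Suc k)"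
                  using short[of f] w xhd by auto
              qed
              have m1: "1 \<le> m" using False by simp
              have J: "?J = {j \<in> {1..Suc k}. odd j}" using k by (auto simp: Suc_le_eq odd_pos)
              \<comment> \<open>For odd \<open>j\<close> the exponent is even; for even
                \<open>j\<close> the right factor has an even gap.\<close>
              have summand: "smul ((-1) ^ (Suc m * Suc j))
                  (tens (Poly_Mapping.single [b (take (Suc j) ?x)] 1) (target m (drop j ?x)))
                = (if odd j then (\<Sum>cs\<in>(#) (take (Suc j) ?x) ` words m (?d - j) (?x ! j).
                     Poly_Mapping.single (map b cs) 1) else 0)" if j: "j \<in> {1..Suc k}" for j
              proof (cases "odd j")
                case True
                have "\<not> even_gap (drop j ?x)"
                  using gap_none[OF st A z(1,2) True _ ng] proper(1) j by simp
                moreover have "Suc (length z) - j + m - 2 = ?d - j" using j k by simp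
                ultimately show ?thesis
                  using True d(4,5)[of j] j by (simp add: target_def tens_single_words)
              next
                case ev: False
                then show ?thesis using gap_even[OF st A z(1,2), of j] j by (simp add: target_def)
              qed
              have "FF (Suc m) ?x = (\<Sum>j = 1..Suc k. if odd j then
                  (\<Sum>cs\<in>(#) (take (Suc j) ?x) ` words m (?d - j) (?x ! j). Poly_Mapping.single (map b cs) 1) else 0)"
                unfolding FF[OF m1] by (rule sum.cong[OF refl]) (rule summand)
              also have "\<dots> = (\<Sum>j\<in>?J. \<Sum>cs\<in>(#) (take (Suc j) ?x) ` words m (?d - j) (?x ! j).
                  Poly_Mapping.single (map b cs) 1)"
                unfolding J by (rule sum.inter_filter[symmetric]) simp
              also have "\<dots> = (\<Sum>cs\<in>words (Suc m) ?d (hd ?x). Poly_Mapping.single (map b cs) 1)"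
                unfolding first
              proof (rule sum.UNION_disjoint[symmetric])
                show "finite ?J" by simp
                show "\<forall>j\<in>?J. finite ((#) (take (Suc j) ?x) ` words m (?d - j) (?x ! j))"
                  by (simp add: finite_words)
                have "take (Suc i) ?x \<noteq> take (Suc j) ?x" if "i \<in> ?J" "j \<in> ?J" "i \<noteq> j" for i j
                proof -
                  have "length (take (Suc i) ?x) \<noteq> length (take (Suc j) ?x)"
                    using that k ins_nth(1)[of k y] y(4) by auto
                  then show ?thesis by metis
                qed
                then show "\<forall>i\<in>?J. \<forall>j\<in>?J. i \<noteq> j \<longrightarrow>
                    (#) (take (Suc i) ?x) ` words m (?d - i) (?x ! i) \<inter>
                    (#) (take (Suc j) ?x) ` words m (?d - j) (?x ! j) = {}"
                  by blast
              qed
              finally show ?thesis using PF False ng xhd by (simp add: target_def)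
            qed
          qed
        qed
      qed
    qed
  qed
  have "state z z 0" using z(1) by (auto simp: state_def pre_def valid_def)
  then show ?case by (rule main)
qed

end

section \<open>Normal forms in a toupie algebra\<close>

context fin_digraph begin

lemma tgt_append: "tgt (x, xs @ ys) = tgt (tgt (x, xs), ys)"
  using tgt_pcat[of G "(x, xs)" "(tgt (x, xs), ys)"] by (simp add: pcat_def)

lemma tgt_Nil [simp]: "tgt (x, []) = x"
  by (simp add: tgt_def)

lemma qpaths_tgt: "p \<in> qpaths \<Longrightarrow> awalk (fst p) (snd p) (tgt p)"
  by (auto simp: qpaths_def tgt_def awalk_ends)

lemma qpathsI: "awalk x as y \<Longrightarrow> (x, as) \<in> qpaths"
  by (auto simp: qpaths_def)

lemma qpaths_append:
  "(x, xs @ ys) \<in> qpaths \<longleftrightarrow> (x, xs) \<in> qpaths \<and> (tgt (x, xs), ys) \<in> qpaths"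
proof
  assume "(x, xs @ ys) \<in> qpaths"
  then obtain y where "awalk x (xs @ ys) y" by (auto simp: qpaths_def)
  then show "(x, xs) \<in> qpaths \<and> (tgt (x, xs), ys) \<in> qpaths"
    using qpathsI by (auto simp: awalk_append_iff tgt_def)
next
  assume "(x, xs) \<in> qpaths \<and> (tgt (x, xs), ys) \<in> qpaths"
  then show "(x, xs @ ys) \<in> qpaths"
    using qpaths_pcat[of "(x, xs)" "(tgt (x, xs), ys)"] by (simp add: pcat_def)
qed

lemma subpath_refl: "subpath p p"
  unfolding subpath_def by (intro exI[of _ "[]"]) simp

lemma subpath_append_left: "subpath s (tgt (x, xs), ys) \<Longrightarrow> subpath s (x, xs @ ys)"
  unfolding subpath_def by (auto simp: tgt_append) (metis append.assoc tgt_append)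

lemma subpath_append_right: "subpath s (x, xs) \<Longrightarrow> subpath s (x, xs @ ys)"
  unfolding subpath_def by (metis append.assoc fst_conv snd_conv)

lemma subpath_pcat:
  "subpath s p \<Longrightarrow> subpath s (pcat p q)"
  "tgt p = fst q \<Longrightarrow> subpath s q \<Longrightarrow> subpath s (pcat p q)"
  using subpath_append_right[of s "fst p" "snd p"] subpath_append_left[of s "fst p" "snd p" "snd q"]
  by (auto simp: pcat_def)

lemma carrier_path_algebra: "x \<in> carrier path_algebra \<longleftrightarrow> Poly_Mapping.keys x \<subseteq> qpaths"
  by (simp add: path_algebra_def)

lemma path_algebra_simps [simp]:
  "x \<otimes>\<^bsub>path_algebra\<^esub> y = path_mult x y" "x \<oplus>\<^bsub>path_algebra\<^esub> y = x + y" "\<zero>\<^bsub>path_algebra\<^esub> = 0"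
  by (simp_all add: path_algebra_def)

lemma a_inv_path_algebra:
  fixes x :: "('a, 'b) qpath \<Rightarrow>\<^sub>0 'k::field"
  assumes "x \<in> carrier path_algebra" shows "\<ominus>\<^bsub>path_algebra\<^esub> x = - x"
proof -
  interpret ring "path_algebra :: (('a, 'b) qpath \<Rightarrow>\<^sub>0 'k) ring" by (rule ring_path_algebra)
  show ?thesis using assms by (intro minus_equality) (auto simp: carrier_path_algebra)
qed

text \<open>By bilinearity it is enough to multiply by scalar multiples of single paths.\<close>

lemma path_idealI:
  fixes S :: "(('a, 'b) qpath \<Rightarrow>\<^sub>0 'k::field) set"
  assumes sub: "\<And>x. x \<in> S \<Longrightarrow> Poly_Mapping.keys x \<subseteq> qpaths" and zero: "0 \<in> S"
    and add: "\<And>x y. x \<in> S \<Longrightarrow> y \<in> S \<Longrightarrow> x + y \<in> S" and neg: "\<And>x. x \<in> S \<Longrightarrow> - x \<in> S"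
    and left: "\<And>p \<alpha> x. p \<in> qpaths \<Longrightarrow> x \<in> S \<Longrightarrow> path_mult (Poly_Mapping.single p \<alpha>) x \<in> S"
    and right: "\<And>p \<alpha> x. p \<in> qpaths \<Longrightarrow> x \<in> S \<Longrightarrow> path_mult x (Poly_Mapping.single p \<alpha>) \<in> S"
  shows "ideal S path_algebra"
proof (rule idealI)
  have sum: "sum f A \<in> S" if "finite A" "\<And>a. a \<in> A \<Longrightarrow> f a \<in> S" for f :: "('a, 'b) qpath \<Rightarrow> _" and A
    using that by (induction A rule: finite_induct) (auto simp: zero add)
  show "ring (path_algebra :: (('a, 'b) qpath \<Rightarrow>\<^sub>0 'k) ring)" by (rule ring_path_algebra)
  show "subgroup S (add_monoid (path_algebra :: (('a, 'b) qpath \<Rightarrow>\<^sub>0 'k) ring))"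
  proof
    fix x assume "x \<in> S"
    then have "inv\<^bsub>add_monoid path_algebra\<^esub> x = - x"
      using a_inv_path_algebra[of x] sub by (simp add: a_inv_def carrier_path_algebra)
    then show "inv\<^bsub>add_monoid path_algebra\<^esub> x \<in> S" using neg \<open>x \<in> S\<close> by simp
  qed (use sub add zero in \<open>auto simp: carrier_path_algebra\<close>)
  fix a x :: "('a, 'b) qpath \<Rightarrow>\<^sub>0 'k"
  assume a: "a \<in> S" "x \<in> carrier path_algebra"
  then have k: "p \<in> qpaths" if "p \<in> Poly_Mapping.keys x" for p
    using that by (auto simp: carrier_path_algebra)
  have x: "x = (\<Sum>p\<in>Poly_Mapping.keys x. Poly_Mapping.single p (Poly_Mapping.lookup x p))"
    by (simp add: poly_mapping_expand)
  show "x \<otimes>\<^bsub>path_algebra\<^esub> a \<in> S"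
    by (subst x) (simp, simp add: path_mult_sum_left sum left a k)
  show "a \<otimes>\<^bsub>path_algebra\<^esub> x \<in> S"
    by (subst x) (simp, simp add: path_mult_sum_right sum right a k)
qed

lemma of_path_mult: "tgt p = fst q \<Longrightarrow> path_mult (of_path p) (of_path q) = (of_path (pcat p q) :: _ \<Rightarrow>\<^sub>0 'k::field)"
  by (simp add: of_path_def path_mult_single)

lemma of_path_carrier: "p \<in> qpaths \<Longrightarrow> of_path p \<in> carrier (path_algebra :: (('a, 'b) qpath \<Rightarrow>\<^sub>0 'k::field) ring)"
  by (simp add: carrier_path_algebra of_path_def)

lemma subpath_in_ideal:
  fixes S :: "(('a, 'b) qpath \<Rightarrow>\<^sub>0 'k::field) set"
  assumes "ideal S path_algebra" "of_path s \<in> S" "subpath s p" "p \<in> qpaths"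
  shows "of_path p \<in> S"
proof -
  interpret ideal S path_algebra by fact
  obtain x as where p: "p = (x, as)" by (cases p)
  obtain xs ys where s: "as = xs @ snd s @ ys" "fst s = tgt (x, xs)"
    using assms(3) by (auto simp: subpath_def p)
  obtain ss where ss: "s = (tgt (x, xs), ss)" using s(2) by (cases s) auto
  have q: "(x, xs) \<in> qpaths" "(tgt s, ys) \<in> qpaths"
    using assms(4) s(1) by (auto simp: p ss qpaths_append)
  have "path_mult (of_path s) (of_path (tgt s, ys)) \<in> S"
    using I_r_closed[OF assms(2) of_path_carrier[OF q(2)]] by simp
  then have "path_mult (of_path (x, xs)) (path_mult (of_path s) (of_path (tgt s, ys))) \<in> S"
    using I_l_closed[OF _ of_path_carrier[OF q(1)]] by simp
  then show ?thesis using s(1) by (simp add: of_path_mult p ss pcat_def)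
qed

lemma lookup_path_mult_single_left:
  "Poly_Mapping.lookup (path_mult (Poly_Mapping.single p \<alpha>) x) r =
     (\<Sum>q\<in>{q \<in> Poly_Mapping.keys x. tgt p = fst q \<and> pcat p q = r}. \<alpha> * Poly_Mapping.lookup x q)"
  by (subst path_mult_superset[where A = "{p}" and B = "Poly_Mapping.keys x"])
    (auto simp: lookup_sum lookup_single when_def if_distrib[of "\<lambda>f. Poly_Mapping.lookup f r"]
      sum.inter_filter intro!: sum.cong)

lemma lookup_path_mult_single_right:
  "Poly_Mapping.lookup (path_mult x (Poly_Mapping.single p \<alpha>)) r =
     (\<Sum>q\<in>{q \<in> Poly_Mapping.keys x. tgt q = fst p \<and> pcat q p = r}. Poly_Mapping.lookup x q * \<alpha>)"
  by (subst path_mult_superset[where A = "Poly_Mapping.keys x" and B = "{p}"])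
    (auto simp: lookup_sum lookup_single when_def if_distrib[of "\<lambda>f. Poly_Mapping.lookup f r"]
      sum.inter_filter intro!: sum.cong)

lemma keys_mult_single_left:
  "r \<in> Poly_Mapping.keys (path_mult (Poly_Mapping.single p \<alpha>) x) \<Longrightarrow>
     \<exists>q\<in>Poly_Mapping.keys x. tgt p = fst q \<and> pcat p q = r"
  unfolding in_keys_iff[of r] lookup_path_mult_single_left by (rule ccontr) (simp, subst (asm) sum.neutral, auto)

lemma keys_mult_single_right:
  "r \<in> Poly_Mapping.keys (path_mult x (Poly_Mapping.single p \<alpha>)) \<Longrightarrow>
     \<exists>q\<in>Poly_Mapping.keys x. tgt q = fst p \<and> pcat q p = r"
  unfolding in_keys_iff[of r] lookup_path_mult_single_right by (rule ccontr) (simp, subst (asm) sum.neutral, auto)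

end

section \<open>The ideal of relations and the basis of paths without tips\<close>

context toupie_algebra begin

sublocale tip_presentation Q I W .

abbreviation "R \<equiv> (path_algebra :: (('a, 'b) qpath \<Rightarrow>\<^sub>0 'k) ring)"

sublocale R: ring R by (rule ring_path_algebra)

lemma no_arc_into_z: "a \<in> arcs Q \<Longrightarrow> head Q a \<noteq> z"
  using source_unique by (auto simp: in_arcs_def)

lemma no_arc_from_sink: "a \<in> arcs Q \<Longrightarrow> tail Q a \<noteq> \<omega>"
  using sink_unique by (auto simp: out_arcs_def)

lemma path_to_z: "p \<in> qpaths \<Longrightarrow> tgt p = z \<Longrightarrow> p = (z, [])"
proof -
  assume p: "p \<in> qpaths" "tgt p = z"
  then have w: "awalk (fst p) (snd p) z" using qpaths_tgt by fastforce
  show ?thesis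
  proof (cases "snd p" rule: rev_cases)
    case Nil
    then show ?thesis using w by (cases p) (auto simp: awalk_Nil_iff)
  next
    case (snoc as a)
    then have "a \<in> arcs Q" "head Q a = z" using w by (auto simp: awalk_append_iff awalk_Cons_iff awalk_Nil_iff)
    then show ?thesis using no_arc_into_z by blast
  qed
qed

lemma path_from_sink: "p \<in> qpaths \<Longrightarrow> fst p = \<omega> \<Longrightarrow> p = (\<omega>, [])"
proof -
  assume p: "p \<in> qpaths" "fst p = \<omega>"
  then have w: "awalk \<omega> (snd p) (tgt p)" using qpaths_tgt by fastforce
  show ?thesis
  proof (cases "snd p")
    case Nil
    then show ?thesis using p by (cases p) auto
  next
    case (Cons a as)
    then have "a \<in> arcs Q" "tail Q a = \<omega>" using w by (auto simp: awalk_Cons_iff)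
    then show ?thesis using no_arc_from_sink by blast
  qed
qed

lemma branches_qpaths: "p \<in> branches \<Longrightarrow> p \<in> qpaths"
  by (simp add: branches_def)

text \<open>A branch cannot be extended, since no arrow enters the source or leaves the sink. In
  particular a tip divides no other branch.\<close>

lemma branch_subpath:
  assumes "s \<in> branches" "p \<in> branches" "subpath s p"
  shows "s = p"
proof -
  obtain xs ys where x: "snd p = xs @ snd s @ ys" "fst s = tgt (fst p, xs)"
    using assms(3) by (auto simp: subpath_def)
  obtain ss where ss: "s = (tgt (fst p, xs), ss)" using x(2) by (cases s) auto
  have "(fst p, snd p) \<in> qpaths" using branches_qpaths[OF assms(2)] by simp
  then have q: "(fst p, xs) \<in> qpaths" "(tgt s, ys) \<in> qpaths"
    unfolding x(1) by (auto simp: ss qpaths_append)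
  have "xs = []" using path_to_z[OF q(1)] x(2) assms(1) by (auto simp: branches_def)
  moreover have "ys = []" using path_from_sink[OF q(2)] assms(1) by (auto simp: branches_def)
  ultimately show ?thesis using x by (cases p, cases s) auto
qed

lemma rho_keys: "i < m \<Longrightarrow> Poly_Mapping.keys (\<rho> i) \<subseteq> set B4"
  using B4_involved by blast

lemma rho_lookup: "i < m \<Longrightarrow> l < length B4 \<Longrightarrow> Poly_Mapping.lookup (\<rho> i) (B4 ! l) = C i l"
  using B4_distinct by (auto simp: rho_eq lookup_sum lookup_single when_def nth_eq_iff_index_eq if_distrib
      cong: if_cong)

text \<open>The form in which the reduced echelon shape is used: evaluation at the tips separates
  the relations.\<close>

lemma rho_tip: "i < m \<Longrightarrow> j < m \<Longrightarrow> Poly_Mapping.lookup (\<rho> i) (tip j) = (if i = j then 1 else 0)"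
  using rho_lookup pivots(2) pivot_one reduced by (auto simp: tip_eq)

lemma B4_qpaths: "p \<in> set B4 \<Longrightarrow> p \<in> qpaths"
  using B4_branches branches_qpaths by blast

lemma tip_B4: "i < m \<Longrightarrow> tip i \<in> set B4"
  by (simp add: tip_eq pivots(2))

lemma tip_branch: "i < m \<Longrightarrow> tip i \<in> branches"
  using tip_B4 B4_branches by blast

lemma W_cases: "s \<in> W \<longleftrightarrow> s \<in> Gmon \<or> (\<exists>i<m. s = tip i)"
  by (subst W_eq) auto

lemma W_qpaths: "s \<in> W \<Longrightarrow> s \<in> qpaths"
  using W_eq Gmon_paths tip_B4 B4_qpaths by blast

lemma generators_carrier: "of_path ` Gmon \<union> \<rho> ` {..<m} \<subseteq> carrier R"
  using Gmon_paths rho_keys B4_qpaths by (fastforce simp: carrier_path_algebra of_path_def)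

lemma ideal_I: "ideal I R"
  using admissible by (simp add: admissible_def)

lemma generators_in_I: "s \<in> Gmon \<Longrightarrow> of_path s \<in> I" "i < m \<Longrightarrow> \<rho> i \<in> I"
  using R.genideal_self[OF generators_carrier] by (auto simp: generates)

lemma W_length: "s \<in> W \<Longrightarrow> 2 \<le> length (snd s)"
proof -
  have I2: "p \<in> Poly_Mapping.keys x \<Longrightarrow> x \<in> I \<Longrightarrow> 2 \<le> length (snd p)" for p x
    using admissible unfolding admissible_def arrow_power_def by auto
  assume "s \<in> W"
  then consider "s \<in> Gmon" | i where "i < m" "s = tip i" using W_eq by auto
  then show ?thesis
  proof cases
    case 1
    then show ?thesis using I2[OF _ generators_in_I(1)] by (simp add: of_path_def)
  next
    case 2
    then have "s \<in> Poly_Mapping.keys (\<rho> i)" by (simp add: in_keys_iff rho_tip)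
    then show ?thesis using I2 generators_in_I(2) 2 by blast
  qed
qed

lemma B4_length: "p \<in> set B4 \<Longrightarrow> 2 \<le> length (snd p)"
proof -
  assume "p \<in> set B4"
  then obtain i where "i < m" "p \<in> Poly_Mapping.keys (\<rho> i)" using B4_involved by auto
  then show ?thesis using admissible generators_in_I(2) unfolding admissible_def arrow_power_def by auto
qed

definition Gfree :: "('a, 'b) qpath \<Rightarrow> bool" where
  "Gfree p \<longleftrightarrow> \<not> (\<exists>s\<in>Gmon. subpath s p)"

text \<open>Coefficients at paths with a subpath in \<open>Gmon\<close> are left free, which makes
  the set stable under multiplication by paths.\<close>

definition rho_span :: "(('a, 'b) qpath \<Rightarrow>\<^sub>0 'k) set" where
  "rho_span = {x. Poly_Mapping.keys x \<subseteq> qpaths \<and>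
     (\<exists>c. \<forall>p. Gfree p \<longrightarrow> Poly_Mapping.lookup x p = (\<Sum>i<m. c i * Poly_Mapping.lookup (\<rho> i) p))}"

lemma rho_spanI:
  "Poly_Mapping.keys x \<subseteq> qpaths \<Longrightarrow>
     (\<And>p. Gfree p \<Longrightarrow> Poly_Mapping.lookup x p = (\<Sum>i<m. c i * Poly_Mapping.lookup (\<rho> i) p)) \<Longrightarrow>
     x \<in> rho_span"
  unfolding rho_span_def by blast

lemma rho_lookup_nonbranch: "i < m \<Longrightarrow> p \<notin> branches \<Longrightarrow> Poly_Mapping.lookup (\<rho> i) p = 0"
  using rho_keys B4_branches by (metis in_keys_iff subsetD)

text \<open>
  No arrow ends in the source and none starts in the sink, so a non monomial relation is annihilated
  by the arrows on both sides: modulo paths with a subpath in \<open>Gmon\<close>, \<open>I\<close> is spanned by the \<open>\<rho> i\<close>.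
\<close>
lemma ideal_rho_span: "ideal rho_span R"
proof (rule path_idealI)
  fix p x and \<alpha> :: 'k
  assume p: "p \<in> qpaths" and x: "x \<in> rho_span"
  then obtain c where c: "\<And>p. Gfree p \<Longrightarrow> Poly_Mapping.lookup x p = (\<Sum>i<m. c i * Poly_Mapping.lookup (\<rho> i) p)"
    by (auto simp: rho_span_def)
  have kx: "Poly_Mapping.keys x \<subseteq> qpaths" using x by (simp add: rho_span_def)
  have zero: "Poly_Mapping.lookup x q = 0" if "Gfree q" "q \<notin> branches" for q
    using c[OF that(1)] rho_lookup_nonbranch[OF _ that(2)] by simp
  have "Poly_Mapping.lookup (path_mult (Poly_Mapping.single p \<alpha>) x) r =
      (\<Sum>i<m. (if p = (z, []) then \<alpha> * c i else 0) * Poly_Mapping.lookup (\<rho> i) r)" if r: "Gfree r" for r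
  proof (cases "p = (z, [])")
    case True
    have "Poly_Mapping.lookup (path_mult (Poly_Mapping.single p \<alpha>) x) r =
        (if fst r = z then \<alpha> * Poly_Mapping.lookup x r else 0)"
    proof -
      have "{q \<in> Poly_Mapping.keys x. tgt p = fst q \<and> pcat p q = r} =
          (if fst r = z \<and> r \<in> Poly_Mapping.keys x then {r} else {})"
        using True by (auto simp: pcat_def)
      then show ?thesis by (simp add: lookup_path_mult_single_left in_keys_iff)
    qed
    also have "\<dots> = \<alpha> * Poly_Mapping.lookup x r"
      using zero[OF r] by (auto simp: branches_def)
    finally show ?thesis using c[OF r] True by (simp add: sum_distrib_left mult.assoc)
  next
    case False
    have "Poly_Mapping.lookup x q = 0" if q: "q \<in> Poly_Mapping.keys x" "tgt p = fst q" "pcat p q = r" for q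
    proof (rule zero)
      show "Gfree q" using r q subpath_pcat(2)[OF q(2)] by (auto simp: Gfree_def)
      show "q \<notin> branches" using False path_to_z[OF p] q by (auto simp: branches_def)
    qed
    then show ?thesis using False by (auto simp: lookup_path_mult_single_left intro!: sum.neutral)
  qed
  moreover have "Poly_Mapping.keys (path_mult (Poly_Mapping.single p \<alpha>) x) \<subseteq> qpaths"
    using p kx by (intro keys_path_mult) auto
  ultimately show "path_mult (Poly_Mapping.single p \<alpha>) x \<in> rho_span"
    by (intro rho_spanI)
  have "Poly_Mapping.lookup (path_mult x (Poly_Mapping.single p \<alpha>)) r =
      (\<Sum>i<m. (if p = (\<omega>, []) then \<alpha> * c i else 0) * Poly_Mapping.lookup (\<rho> i) r)" if r: "Gfree r" for r
  proof (cases "p = (\<omega>, [])")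
    case True
    have "Poly_Mapping.lookup (path_mult x (Poly_Mapping.single p \<alpha>)) r =
        (if tgt r = \<omega> then Poly_Mapping.lookup x r * \<alpha> else 0)"
    proof -
      have "{q \<in> Poly_Mapping.keys x. tgt q = fst p \<and> pcat q p = r} =
          (if tgt r = \<omega> \<and> r \<in> Poly_Mapping.keys x then {r} else {})"
        using True by (auto simp: pcat_def)
      then show ?thesis by (simp add: lookup_path_mult_single_right in_keys_iff)
    qed
    also have "\<dots> = \<alpha> * Poly_Mapping.lookup x r"
      using zero[OF r] by (auto simp: branches_def)
    finally show ?thesis using c[OF r] True by (simp add: sum_distrib_left mult.assoc)
  next
    case False
    have "Poly_Mapping.lookup x q = 0" if q: "q \<in> Poly_Mapping.keys x" "tgt q = fst p" "pcat q p = r" for q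
    proof (rule zero)
      show "Gfree q" using r q subpath_pcat(1)[of _ q p] by (auto simp: Gfree_def)
      show "q \<notin> branches" using False path_from_sink[OF p] q by (auto simp: branches_def)
    qed
    then show ?thesis using False by (auto simp: lookup_path_mult_single_right intro!: sum.neutral)
  qed
  moreover have "Poly_Mapping.keys (path_mult x (Poly_Mapping.single p \<alpha>)) \<subseteq> qpaths"
    using p kx by (intro keys_path_mult) auto
  ultimately show "path_mult x (Poly_Mapping.single p \<alpha>) \<in> rho_span"
    by (intro rho_spanI)
next
  fix x y assume "x \<in> rho_span" "y \<in> rho_span"
  then obtain c d where
    "\<And>p. Gfree p \<Longrightarrow> Poly_Mapping.lookup x p = (\<Sum>i<m. c i * Poly_Mapping.lookup (\<rho> i) p)"
    "\<And>p. Gfree p \<Longrightarrow> Poly_Mapping.lookup y p = (\<Sum>i<m. d i * Poly_Mapping.lookup (\<rho> i) p)"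
    and k: "Poly_Mapping.keys x \<subseteq> qpaths" "Poly_Mapping.keys y \<subseteq> qpaths"
    by (auto simp: rho_span_def)
  then have "Gfree p \<Longrightarrow> Poly_Mapping.lookup (x + y) p = (\<Sum>i<m. (c i + d i) * Poly_Mapping.lookup (\<rho> i) p)" for p
    by (simp add: lookup_add distrib_right sum.distrib)
  then show "x + y \<in> rho_span"
    using k Poly_Mapping.keys_add[of x y] by (intro rho_spanI) auto
next
  fix x assume "x \<in> rho_span"
  then obtain c where
    "\<And>p. Gfree p \<Longrightarrow> Poly_Mapping.lookup x p = (\<Sum>i<m. c i * Poly_Mapping.lookup (\<rho> i) p)"
    and k: "Poly_Mapping.keys x \<subseteq> qpaths"
    by (auto simp: rho_span_def)
  then have "Gfree p \<Longrightarrow> Poly_Mapping.lookup (- x) p = (\<Sum>i<m. (- c i) * Poly_Mapping.lookup (\<rho> i) p)" for p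
    by (simp add: sum_negf)
  then show "- x \<in> rho_span" using k by (intro rho_spanI[where c = "\<lambda>i. - c i"]) auto
next
  show "0 \<in> rho_span" unfolding rho_span_def by (auto intro!: exI[of _ "\<lambda>i. 0"])
qed (auto simp: rho_span_def)

lemma I_subset_rho_span: "I \<subseteq> rho_span"
proof -
  have "of_path ` Gmon \<union> \<rho> ` {..<m} \<subseteq> rho_span"
  proof (intro subsetI, elim UnE imageE)
    fix x :: "('a, 'b) qpath \<Rightarrow>\<^sub>0 'k" and s assume "s \<in> Gmon" "x = of_path s"
    then have "\<forall>p. Gfree p \<longrightarrow> Poly_Mapping.lookup x p = (\<Sum>i<m. 0 * Poly_Mapping.lookup (\<rho> i) p)"
      using subpath_refl by (auto simp: Gfree_def of_path_def lookup_single when_def)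
    moreover have "Poly_Mapping.keys x \<subseteq> qpaths" using \<open>s \<in> Gmon\<close> \<open>x = of_path s\<close> Gmon_paths by (auto simp: of_path_def)
    ultimately show "x \<in> rho_span" unfolding rho_span_def by (auto intro!: exI[of _ "\<lambda>i. 0"])
  next
    fix x i assume i: "x = \<rho> i" "i \<in> {..<m}"
    then have "Poly_Mapping.lookup x p = (\<Sum>l<m. (if l = i then 1 else 0) * Poly_Mapping.lookup (\<rho> l) p)" for p
      by (simp add: if_distrib[of "\<lambda>c. c * _"] cong: if_cong)
    moreover have "Poly_Mapping.keys x \<subseteq> qpaths" using i rho_keys B4_qpaths by blast
    ultimately show "x \<in> rho_span" by (intro rho_spanI)
  qed
  from R.genideal_minimal[OF ideal_rho_span this] show ?thesis by (simp only: generates)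
qed

lemma NonTip_Gfree: "p \<in> NonTip \<Longrightarrow> Gfree p"
  using W_cases by (auto simp: NonTip_def Gfree_def)

lemma tip_not_NonTip: "i < m \<Longrightarrow> tip i \<notin> NonTip"
  using subpath_refl W_cases by (fastforce simp: NonTip_def)

lemma B4_Gfree: "p \<in> set B4 \<Longrightarrow> Gfree p"
  using B4_not_B3 by (auto simp: Gfree_def)

text \<open>Away from \<open>Gmon\<close> an element of \<open>I\<close> is a combination of the
  relations. Its coefficients are read off at the tips, where \<open>y\<close> vanishes.\<close>

lemma NonTip_independent:
  assumes "y \<in> I" "Poly_Mapping.keys y \<subseteq> NonTip"
  shows "y = 0"
proof (rule poly_mapping_eqI)
  fix p
  obtain c where c: "\<And>p. Gfree p \<Longrightarrow> Poly_Mapping.lookup y p = (\<Sum>i<m. c i * Poly_Mapping.lookup (\<rho> i) p)"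
    using assms(1) I_subset_rho_span by (auto simp: rho_span_def)
  have "c j = 0" if "j < m" for j
  proof -
    have "Poly_Mapping.lookup y (tip j) = 0"
      using assms(2) tip_not_NonTip[OF that] by (auto simp: in_keys_iff)
    moreover have "(\<Sum>i<m. c i * Poly_Mapping.lookup (\<rho> i) (tip j)) = (\<Sum>i<m. if i = j then c i else 0)"
      using that by (intro sum.cong) (auto simp: rho_tip)
    ultimately show ?thesis using c[OF B4_Gfree[OF tip_B4[OF that]]] that by simp
  qed
  then show "Poly_Mapping.lookup y p = Poly_Mapping.lookup 0 p"
    using c[of p] NonTip_Gfree assms(2) by (cases "p \<in> NonTip") (auto simp: in_keys_iff)
qed

lemma I_closed: "0 \<in> I" "x \<in> I \<Longrightarrow> y \<in> I \<Longrightarrow> x + y \<in> I" "x \<in> I \<Longrightarrow> y \<in> I \<Longrightarrow> x - y \<in> I"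
proof -
  interpret ideal I R by (rule ideal_I)
  show "0 \<in> I" using zero_closed by simp
  show add: "x \<in> I \<Longrightarrow> y \<in> I \<Longrightarrow> x + y \<in> I" for x y using a_closed[of x y] by simp
  have neg: "y \<in> I \<Longrightarrow> - y \<in> I" for y
    using a_inv_closed[of y] a_inv_path_algebra[OF Icarr[of y]] by simp
  show "x \<in> I \<Longrightarrow> y \<in> I \<Longrightarrow> x - y \<in> I" using add[of x "- y"] neg by simp
qed

text \<open>Independence makes the representative unique, so a normal form is established by
  exhibiting it.\<close>

lemma nf_eq:
  assumes "Poly_Mapping.keys y \<subseteq> NonTip" "x - y \<in> I"
  shows "nf x = y"
proof -
  have coset: "I +>\<^bsub>R\<^esub> w = I +>\<^bsub>R\<^esub> x \<longleftrightarrow> x - w \<in> I" for w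
  proof
    assume "I +>\<^bsub>R\<^esub> w = I +>\<^bsub>R\<^esub> x"
    moreover have "x \<in> I +>\<^bsub>R\<^esub> x"
      unfolding a_r_coset_def' path_algebra_simps using I_closed(1) by force
    ultimately obtain h where "h \<in> I" "x = h + w"
      unfolding a_r_coset_def' path_algebra_simps by blast
    then show "x - w \<in> I" by simp
  next
    assume d: "x - w \<in> I"
    have "h + w = (h - (x - w)) + x" "h + x = (h + (x - w)) + w" for h by simp_all
    then have "\<exists>h'\<in>I. h + w = h' + x" "\<exists>h'\<in>I. h + x = h' + w" if "h \<in> I" for h
      using I_closed(2,3)[OF that d] by blast+
    then show "I +>\<^bsub>R\<^esub> w = I +>\<^bsub>R\<^esub> x"
      unfolding a_r_coset_def' path_algebra_simps by blast
  qed
  show ?thesis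
    unfolding nf_def
  proof (rule the_equality)
    show "Poly_Mapping.keys y \<subseteq> NonTip \<and> I +>\<^bsub>R\<^esub> y = I +>\<^bsub>R\<^esub> x" using assms coset by simp
    fix w assume w: "Poly_Mapping.keys w \<subseteq> NonTip \<and> I +>\<^bsub>R\<^esub> w = I +>\<^bsub>R\<^esub> x"
    then have "x - w \<in> I" using coset by simp
    then have "w - y \<in> I" using I_closed(3)[OF assms(2), of "x - w"] by simp
    moreover have "Poly_Mapping.keys (w - y) \<subseteq> NonTip"
      using w assms(1) Poly_Mapping.keys_diff[of w y] by blast
    ultimately have "w - y = 0" by (rule NonTip_independent)
    then show "w = y" by simp
  qed
qed

lemma nf_NonTip: "p \<in> NonTip \<Longrightarrow> nf (of_path p) = of_path p"
  by (rule nf_eq) (auto simp: of_path_def NonTip_def I_closed)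

lemma nf_mon: "p \<in> qpaths \<Longrightarrow> \<not> Gfree p \<Longrightarrow> nf (of_path p) = 0"
  using subpath_in_ideal[OF ideal_I generators_in_I(1), of _ p] unfolding Gfree_def
  by (intro nf_eq) (simp, metis diff_zero)

lemma B4_NonTip:
  assumes "p \<in> set B4" "\<And>i. i < m \<Longrightarrow> p \<noteq> tip i"
  shows "p \<in> NonTip"
proof -
  have "\<not> subpath s p" if s: "s \<in> W" for s
  proof (cases "s \<in> Gmon")
    case False
    then obtain i where "i < m" "s = tip i" using s W_cases by blast
    then show ?thesis
      using branch_subpath[of s p] tip_branch assms B4_branches by blast
  qed (use B4_not_B3 assms in blast)
  then show ?thesis using B4_qpaths[OF assms(1)] by (auto simp: NonTip_def)
qed

text \<open>By reducedness the other branches of a relation are not tips of further relations, so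
  one substitution already gives the normal form of a tip.\<close>

lemma rho_key_NonTip: "i < m \<Longrightarrow> p \<in> Poly_Mapping.keys (\<rho> i) \<Longrightarrow> p \<noteq> tip i \<Longrightarrow> p \<in> NonTip"
  using rho_keys rho_tip by (intro B4_NonTip) (blast, auto simp: in_keys_iff split: if_splits)

lemma nf_tip: "i < m \<Longrightarrow> nf (of_path (tip i)) = of_path (tip i) - \<rho> i"
proof (rule nf_eq)
  assume i: "i < m"
  show "Poly_Mapping.keys (of_path (tip i) - \<rho> i) \<subseteq> NonTip"
  proof
    fix p assume p: "p \<in> Poly_Mapping.keys (of_path (tip i) - \<rho> i)"
    have "p \<noteq> tip i" using p i by (auto simp: in_keys_iff lookup_minus rho_tip of_path_def)
    moreover have "p \<in> Poly_Mapping.keys (\<rho> i)"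
      using p calculation by (auto simp: in_keys_iff lookup_minus of_path_def lookup_single when_def split: if_splits)
    ultimately show "p \<in> NonTip" using rho_key_NonTip i by blast
  qed
qed (use generators_in_I B4_qpaths tip_B4 in \<open>auto simp: of_path_def\<close>)

text \<open>By admissibility long paths lie in \<open>I\<close>, and by independence no path of
  \<open>NonTip\<close> does.\<close>

lemma finite_NonTip: "finite NonTip"
proof -
  obtain n where n: "2 \<le> n" "arrow_power n \<subseteq> I" using admissible by (auto simp: admissible_def)
  have short: "length (snd p) < n" if p: "p \<in> NonTip" for p
  proof (rule ccontr)
    assume "\<not> length (snd p) < n"
    then have "of_path p \<in> arrow_power n"
      using p by (auto simp: arrow_power_def carrier_path_algebra of_path_def NonTip_def)
    then have "of_path p \<in> I" using n by blast
    then have "of_path p = (0 :: ('a, 'b) qpath \<Rightarrow>\<^sub>0 'k)"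
      using p by (intro NonTip_independent) (auto simp: of_path_def)
    then show False by (metis lookup_single_eq lookup_zero of_path_def zero_neq_one)
  qed
  have "NonTip \<subseteq> verts Q \<times> {as. set as \<subseteq> arcs Q \<and> length as \<le> n}"
  proof
    fix p assume p: "p \<in> NonTip"
    then have "awalk (fst p) (snd p) (tgt p)" using qpaths_tgt by (simp add: NonTip_def)
    then show "p \<in> verts Q \<times> {as. set as \<subseteq> arcs Q \<and> length as \<le> n}"
      using short[OF p] by (cases p) (auto simp: awalk_def)
  qed
  moreover have "finite {as. set as \<subseteq> arcs Q \<and> length as \<le> n}"
    by (rule finite_lists_length_le) simp
  ultimately show ?thesis by (meson finite_SigmaI finite_subset finite_verts)
qed

text \<open>The elements all of whose paths contain a tip form an ideal containing \<open>W\<close>;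
  hence they contain the ideal that \<open>W\<close> generates.\<close>

lemma tip_ideal_iff:
  assumes "p \<in> qpaths"
  shows "of_path p \<in> tip_ideal \<longleftrightarrow> (\<exists>s\<in>W. subpath s p)"
proof
  define K where "K = {x :: ('a, 'b) qpath \<Rightarrow>\<^sub>0 'k. Poly_Mapping.keys x \<subseteq> qpaths \<and>
    (\<forall>p\<in>Poly_Mapping.keys x. \<exists>s\<in>W. subpath s p)}"
  have "ideal K R"
  proof (rule path_idealI)
    fix p x and \<alpha> :: 'k assume p: "p \<in> qpaths" "x \<in> K"
    then have k: "Poly_Mapping.keys x \<subseteq> qpaths" "\<And>q. q \<in> Poly_Mapping.keys x \<Longrightarrow> \<exists>s\<in>W. subpath s q"
      "Poly_Mapping.keys (Poly_Mapping.single p \<alpha>) \<subseteq> qpaths"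
      by (auto simp: K_def)
    show "path_mult (Poly_Mapping.single p \<alpha>) x \<in> K"
      using keys_path_mult[OF k(3,1)] k(2) keys_mult_single_left[of _ p \<alpha> x] subpath_pcat(2)
      unfolding K_def by blast
    show "path_mult x (Poly_Mapping.single p \<alpha>) \<in> K"
      using keys_path_mult[OF k(1,3)] k(2) keys_mult_single_right[of _ x p \<alpha>] subpath_pcat(1)
      unfolding K_def by blast
  next
    fix x y assume "x \<in> K" "y \<in> K"
    then show "x + y \<in> K" using Poly_Mapping.keys_add[of x y] unfolding K_def by blast
  qed (auto simp: K_def)
  moreover have "of_path ` W \<subseteq> K" using W_qpaths subpath_refl by (fastforce simp: K_def of_path_def)
  ultimately have "tip_ideal \<subseteq> K" unfolding tip_ideal_def by (rule R.genideal_minimal)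
  then show "\<exists>s\<in>W. subpath s p" if "of_path p \<in> tip_ideal"
    using that by (auto simp: K_def of_path_def)
  assume "\<exists>s\<in>W. subpath s p"
  then obtain s where s: "s \<in> W" "subpath s p" by auto
  have sub: "of_path ` W \<subseteq> carrier R" using W_qpaths of_path_carrier by blast
  have "of_path s \<in> tip_ideal" using R.genideal_self[OF sub] s by (auto simp: tip_ideal_def)
  then show "of_path p \<in> tip_ideal"
    using subpath_in_ideal R.genideal_ideal[OF sub] s assms unfolding tip_ideal_def by blast
qed

end

section \<open>Zigzags\<close>

context tip_presentation begin

lemma matching_degree: "(s, t) \<in> matching \<Longrightarrow> bar_degree s = Suc (bar_degree t)"
  by (auto simp: matching_def bar_degree_def)

lemma bar_d_keys_degree:
  assumes "t \<in> Poly_Mapping.keys (bar_d s)" shows "bar_degree s = Suc (bar_degree t)"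
proof -
  obtain x ws where s: "s = (x, ws)" by (cases s)
  have keys_smul: "Poly_Mapping.keys (smul c y) \<subseteq> Poly_Mapping.keys y" for c :: 'k and y :: "('a,'b) bar \<Rightarrow>\<^sub>0 'k"
    by (auto simp: in_keys_iff)
  obtain j where j: "1 \<le> j" "j < length ws"
    "t \<in> Poly_Mapping.keys (smul ((-1) ^ j)
          (lin (\<lambda>p. Poly_Mapping.single (x, take (j - 1) ws @ [p] @ drop (j + 1) ws) 1)
             (nf (of_path (pcat (ws ! (j - 1)) (ws ! j))))))"
    using assms unfolding bar_d_def s prod.case by (drule_tac subsetD[OF keys_sum]) auto
  then have "t \<in> Poly_Mapping.keys (lin (\<lambda>p. Poly_Mapping.single (x, take (j - 1) ws @ [p] @ drop (j + 1) ws) (1 :: 'k))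
      (nf (of_path (pcat (ws ! (j - 1)) (ws ! j)))))"
    using keys_smul by blast
  then obtain p where "t \<in> Poly_Mapping.keys (smul (Poly_Mapping.lookup (nf (of_path (pcat (ws ! (j - 1)) (ws ! j)))) p)
      (Poly_Mapping.single (x, take (j - 1) ws @ [p] @ drop (j + 1) ws) (1 :: 'k)))"
    unfolding lin_def by (drule_tac subsetD[OF keys_sum]) (elim UN_E, rule that)
  then have "t = (x, take (j - 1) ws @ [p] @ drop (j + 1) ws)" by (auto split: if_splits)
  then show ?thesis using j s by (simp add: bar_degree_def)
qed

lemma dotted_degree: "dotted s t \<Longrightarrow> bar_degree t = Suc (bar_degree s)"
  using matching_degree by (simp add: dotted_def)

lemma undotted_degree: "undotted s t \<Longrightarrow> bar_degree s = Suc (bar_degree t)"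
  using bar_d_keys_degree by (simp add: undotted_def G_arrow_def in_keys_iff)

lemma undotted_not_dotted: "undotted s t \<Longrightarrow> \<not> dotted s t"
  using undotted_degree dotted_degree by fastforce

lemma dotted_bar_terms: "dotted s t \<Longrightarrow> s \<in> bar_terms \<and> t \<in> bar_terms"
  by (auto simp: dotted_def matching_def G_arrow_def)

lemma undotted_bar_terms: "undotted s t \<Longrightarrow> s \<in> bar_terms \<and> t \<in> bar_terms"
  by (auto simp: undotted_def G_arrow_def)

lemma zigzag_single [simp]: "zigzag [s] \<longleftrightarrow> s \<in> bar_terms"
  by (simp add: zigzag_def)

lemma zigzag_Cons:
  "zigzag (s # t # zs) \<longleftrightarrow> (dotted s t \<or> undotted s t) \<and> zigzag (t # zs) \<and>
     (zs = [] \<or> dotted s t \<noteq> dotted t (hd zs))"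
proof -
  have "set (s # t # zs) \<subseteq> bar_terms \<longleftrightarrow> set (t # zs) \<subseteq> bar_terms" if "dotted s t \<or> undotted s t"
    using that dotted_bar_terms[of s t] undotted_bar_terms[of s t] by auto
  then show ?thesis
    unfolding zigzag_def by (cases zs) (auto simp: All_less_Suc2)
qed

text \<open>Alternation confines a zigzag to two adjacent degrees, and the first arrow decides
  which.\<close>

lemma zigzag_degree:
  "zigzag (s # t # zs) \<Longrightarrow> i < length (s # t # zs) \<Longrightarrow>
     (if dotted s t then bar_degree ((s # t # zs) ! i) = bar_degree s + i mod 2
      else bar_degree s = bar_degree ((s # t # zs) ! i) + i mod 2)"
proof (induction zs arbitrary: s t i)
  case Nil
  then show ?case using dotted_degree[of s t] undotted_degree[of s t]
    by (auto simp: zigzag_Cons less_Suc_eq)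
next
  case (Cons u zs)
  have z: "zigzag (t # u # zs)" "dotted s t \<or> undotted s t" "dotted s t \<noteq> dotted t u"
    using Cons.prems(1) by (auto simp: zigzag_Cons)
  show ?case
  proof (cases i)
    case (Suc l)
    have l: "Suc l mod 2 = 1 - l mod 2" "l mod 2 \<le> 1" by (auto simp: mod_Suc)
    show ?thesis
      using Cons.IH[OF z(1), of l] Cons.prems(2) Suc z dotted_degree[of s t] undotted_degree[of s t] l
      by (auto split: if_splits)
  qed auto
qed

lemma zigzag_step_dotted:
  "zigzag (s # t # zs) \<Longrightarrow> Suc i < length (s # t # zs) \<Longrightarrow>
     dotted ((s # t # zs) ! i) ((s # t # zs) ! Suc i) \<longleftrightarrow> (dotted s t \<longleftrightarrow> even i)"
proof (induction zs arbitrary: s t i)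
  case (Cons u zs)
  have z: "zigzag (t # u # zs)" "dotted s t \<noteq> dotted t u"
    using Cons.prems(1) by (auto simp: zigzag_Cons)
  show ?case
  proof (cases i)
    case (Suc l)
    then show ?thesis using Cons.IH[OF z(1), of l] Cons.prems(2) z(2) by auto
  qed auto
qed (auto simp: less_Suc_eq)

text \<open>The two kinds of end points that occur in \<open>map_h\<close> and \<open>map_p\<close>.\<close>
definition target_of :: "('a, 'b) bar \<Rightarrow> ('a, 'b) bar \<Rightarrow> bool" where
  "target_of s t \<longleftrightarrow> bar_degree t = Suc (bar_degree s) \<or> bar_degree t = bar_degree s \<and> critical t"

definition zigzags :: "('a, 'b) bar \<Rightarrow> ('a, 'b) bar \<Rightarrow> ('a, 'b) bar list set" where
  "zigzags s t = {zs. zigzag zs \<and> hd zs = s \<and> last zs = t}"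

lemma total_weight_zigzags: "total_weight s t = (\<Sum>zs\<in>zigzags s t. zigzag_weight zs)"
  by (simp add: total_weight_def zigzags_def)

text \<open>A zigzag that starts undotted never rises above the degree of \<open>s\<close>, and it
  returns to that degree only by a dotted arrow, which cannot end in a critical vertex.\<close>

lemma zigzag_starts_dotted:
  assumes "zigzag (s # y # zs)" "last (s # y # zs) = t" "target_of s t"
  shows "dotted s y"
proof (rule ccontr)
  assume nd: "\<not> dotted s y"
  let ?zs = "s # y # zs"
  define i where "i = length ?zs - 1"
  have t: "?zs ! i = t" unfolding i_def by (subst last_conv_nth[symmetric]) (use assms(2) in simp_all)
  have "bar_degree s = bar_degree t + i mod 2"
    using zigzag_degree[OF assms(1), of i] nd t by (simp add: i_def)
  then have d: "bar_degree t = bar_degree s" "critical t" "even i"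
    using assms(3) by (auto simp: target_of_def)
  then obtain l where l: "i = Suc l" "odd l" unfolding i_def by (cases "length zs") auto
  then have "dotted (?zs ! l) t"
    using zigzag_step_dotted[OF assms(1), of l] nd t by (auto simp: i_def)
  then show False using d(2) unfolding dotted_def critical_def by blast
qed

lemma zigzags_dead:
  assumes "s \<in> bar_terms" "\<And>y. \<not> dotted s y" "target_of s t"
  shows "zigzags s t = (if s = t then {[s]} else {})"
proof -
  have "zs = [s]" if "zigzag zs" "hd zs = s" "last zs = t" for zs
  proof (cases zs)
    case (Cons a rest)
    then show ?thesis
      using zigzag_starts_dotted[of s _ _ t] that assms by (cases rest) auto
  qed (use that in \<open>simp add: zigzag_def\<close>)
  then have "zigzags s t \<subseteq> {[s]}" by (auto simp: zigzags_def)
  moreover have "[s] \<in> zigzags s t \<longleftrightarrow> s = t" using assms(1) by (auto simp: zigzags_def)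
  ultimately show ?thesis by auto
qed

text \<open>The deterministic step: \<open>x\<close> is the only dotted successor, and an undotted
  arrow from \<open>x\<close> leads to \<open>u0\<close> (present when \<open>c\<close> holds) or to
  a vertex that neither continues nor is an admissible end point.\<close>

lemma zigzags_step:
  assumes x: "\<And>y. dotted s y \<longleftrightarrow> y = x" and t: "target_of s t"
    and u: "\<And>u. undotted x u \<Longrightarrow> c \<and> u = u0 \<or> \<not> critical u \<and> (\<forall>y. \<not> dotted u y)"
    and u0: "c \<Longrightarrow> undotted x u0"
  shows "zigzags s t = (if t = x then {[s, x]} else {}) \<union>
    (if c then (\<lambda>zs. s # x # zs) ` zigzags u0 t else {})"
proof
  have dx: "dotted s x" using x by simp
  have bx: "s \<in> bar_terms" "x \<in> bar_terms" using dx dotted_bar_terms by auto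
  have nc: "\<not> critical s" using dx unfolding critical_def dotted_def by blast
  have deg: "bar_degree u = bar_degree s" if "undotted x u" for u
    using dotted_degree[OF dx] undotted_degree[OF that] by simp
  show "zigzags s t \<subseteq> (if t = x then {[s, x]} else {}) \<union>
    (if c then (\<lambda>zs. s # x # zs) ` zigzags u0 t else {})"
  proof
    fix zs assume "zs \<in> zigzags s t"
    then have zs: "zigzag zs" "hd zs = s" "last zs = t" by (auto simp: zigzags_def)
    then obtain rest where r: "zs = s # rest" by (cases zs) (auto simp: zigzag_def)
    have "rest \<noteq> []" using zs r nc t by (auto simp: target_of_def)
    then obtain y rest' where r': "rest = y # rest'" by (cases rest) auto
    have "dotted s y" using zigzag_starts_dotted[of s y rest' t] zs t r r' by simp
    then have y: "y = x" using x by simp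
    show "zs \<in> (if t = x then {[s, x]} else {}) \<union> (if c then (\<lambda>zs. s # x # zs) ` zigzags u0 t else {})"
    proof (cases rest')
      case Nil
      then show ?thesis using zs r r' y by auto
    next
      case (Cons v r'')
      have z: "zigzag (v # r'')" "undotted x v"
        using zs(1) dx unfolding r r' y Cons zigzag_Cons by auto
      have vin: "v # r'' \<in> zigzags v t" using z zs(3) r r' Cons by (auto simp: zigzags_def)
      have "target_of v t" using t deg[OF z(2)] by (simp add: target_of_def)
      from u[OF z(2)] have "c \<and> v = u0"
      proof
        assume d: "\<not> critical v \<and> (\<forall>y. \<not> dotted v y)"
        then have "v = t"
          using zigzags_dead[OF _ _ \<open>target_of v t\<close>] vin undotted_bar_terms[OF z(2)] by (auto split: if_splits)
        then show ?thesis using \<open>target_of v t\<close> d by (auto simp: target_of_def)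
      qed
      then show ?thesis using vin r r' y Cons by auto
    qed
  qed
  show "(if t = x then {[s, x]} else {}) \<union> (if c then (\<lambda>zs. s # x # zs) ` zigzags u0 t else {}) \<subseteq> zigzags s t"
  proof
    fix zs assume "zs \<in> (if t = x then {[s, x]} else {}) \<union> (if c then (\<lambda>zs. s # x # zs) ` zigzags u0 t else {})"
    then consider "t = x" "zs = [s, x]" | zs' where "c" "zs' \<in> zigzags u0 t" "zs = s # x # zs'"
      by (auto split: if_splits)
    then show "zs \<in> zigzags s t"
    proof cases
      case 1
      then show ?thesis using dx bx by (simp add: zigzags_def zigzag_Cons)
    next
      case 2
      have un: "undotted x u0" using u0 2 by simp
      obtain r where r: "zs' = u0 # r" using 2 by (cases zs') (auto simp: zigzags_def zigzag_def)
      have z': "zigzag (u0 # r)" "last (u0 # r) = t" using 2 r by (auto simp: zigzags_def)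
      have "target_of u0 t" using t deg[OF un] by (simp add: target_of_def)
      \<comment> \<open>Ensures alternation at \<open>u0\<close> when the step is put in front of
        the remaining zigzag.\<close>
      then have "r = [] \<or> dotted u0 (hd r)"
        using zigzag_starts_dotted[of u0 "hd r" "tl r" t] z' by (cases r) auto
      then have "zigzag (x # u0 # r)"
        using z' un undotted_not_dotted[OF un] by (auto simp: zigzag_Cons)
      then have "zigzag (s # x # u0 # r)"
        using dx undotted_not_dotted[OF un] by (subst zigzag_Cons) simp
      then show ?thesis using 2 r z' by (simp add: zigzags_def)
    qed
  qed
qed

lemma zigzag_weight_Cons: "zs \<noteq> [] \<Longrightarrow> zigzag_weight (s # zs) = step_weight s (hd zs) * zigzag_weight zs"
  unfolding zigzag_weight_def
  by (cases zs) (auto simp: prod.lessThan_Suc_shift simp del: prod.lessThan_Suc)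

lemma zigzag_weight_single [simp]: "zigzag_weight [s] = 1"
  by (simp add: zigzag_weight_def)

lemma total_weight_dead:
  assumes "s \<in> bar_terms" "\<And>y. \<not> dotted s y" "target_of s t"
  shows "total_weight s t = (if s = t then 1 else 0)"
  by (simp add: total_weight_zigzags zigzags_dead[OF assms])

text \<open>Finiteness is carried along because a sum over an infinite set has the value 0 by
  convention.\<close>

lemma total_weight_step:
  assumes "\<And>y. dotted s y \<longleftrightarrow> y = x" "target_of s t"
    and "\<And>u. undotted x u \<Longrightarrow> c \<and> u = u0 \<or> \<not> critical u \<and> (\<forall>y. \<not> dotted u y)"
    and "c \<Longrightarrow> undotted x u0" and fin: "c \<Longrightarrow> finite (zigzags u0 t)"
  shows "total_weight s t = step_weight s x *
      ((if t = x then 1 else 0) + (if c then step_weight x u0 * total_weight u0 t else 0))"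
    and "finite (zigzags s t)"
proof -
  note Z = zigzags_step[OF assms(1-4)]
  show "finite (zigzags s t)" using fin by (simp add: Z)
  have ne: "zs \<noteq> []" "hd zs = u0" if "zs \<in> zigzags u0 t" for zs
    using that by (auto simp: zigzags_def zigzag_def)
  have "(\<Sum>zs\<in>(\<lambda>zs. s # x # zs) ` zigzags u0 t. zigzag_weight zs) =
      step_weight s x * (step_weight x u0 * total_weight u0 t)"
    using ne by (subst sum.reindex)
      (auto simp: inj_on_def total_weight_zigzags sum_distrib_left zigzag_weight_Cons intro!: sum.cong)
  moreover have "{[s, x]} \<inter> (\<lambda>zs. s # x # zs) ` zigzags u0 t = {}" using ne by auto
  moreover have "zigzag_weight [s, x] = step_weight s x"
    by (simp add: zigzag_weight_Cons)
  ultimately show "total_weight s t = step_weight s x *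
      ((if t = x then 1 else 0) + (if c then step_weight x u0 * total_weight u0 t else 0))"
    using fin by (subst total_weight_zigzags, subst Z) (auto simp: sum.union_disjoint distrib_left)
qed

end

section \<open>The maps h, p and i in terms of zigzag weights\<close>

context toupie_algebra begin

lemma finite_bar_terms: "finite {y \<in> bar_terms. bar_degree y = n}"
proof -
  have "{y \<in> bar_terms. bar_degree y = n} \<subseteq> verts Q \<times> {ws. set ws \<subseteq> NonTip \<and> length ws = n}"
    by (auto simp: bar_terms_def bar_degree_def)
  then show ?thesis
    using finite_lists_length_eq[OF finite_NonTip] by (meson finite_SigmaI finite_subset finite_verts)
qed

lemma finite_critical: "finite {y. critical y \<and> bar_degree y = n}"
  by (rule finite_subset[OF _ finite_bar_terms[of n]]) (auto simp: critical_def)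

lemma lookup_map_h:
  "Poly_Mapping.lookup (map_h s) t =
     (if t \<in> bar_terms \<and> bar_degree t = Suc (bar_degree s) then total_weight s t else 0)"
  using finite_bar_terms[of "Suc (bar_degree s)"]
  by (simp add: map_h_def lookup_sum lookup_single when_def)

lemma lookup_map_p:
  "Poly_Mapping.lookup (map_p s) t =
     (if critical t \<and> bar_degree t = bar_degree s then total_weight s t else 0)"
  using finite_critical[of "bar_degree s"]
  by (simp add: map_p_def lookup_sum lookup_single when_def)

lemma lookup_map_i:
  "Poly_Mapping.lookup (map_i s) t =
     (if t \<in> bar_terms \<and> bar_degree t = bar_degree s then total_weight s t else 0)"
  using finite_bar_terms[of "bar_degree s"]
  by (simp add: map_i_def lookup_sum lookup_single when_def)

lemma map_h_dead:
  assumes "s \<in> bar_terms" "\<And>y. \<not> dotted s y" shows "map_h s = 0"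
  by (rule poly_mapping_eqI)
    (use total_weight_dead[OF assms] in \<open>auto simp: lookup_map_h target_of_def\<close>)

lemma map_p_dead:
  assumes "s \<in> bar_terms" "\<And>y. \<not> dotted s y"
  shows "map_p s = (if critical s then Poly_Mapping.single s 1 else 0)"
  by (rule poly_mapping_eqI)
    (use total_weight_dead[OF assms] in \<open>auto simp: lookup_map_p target_of_def lookup_single when_def\<close>)

text \<open>The vertex \<open>x\<close> is one degree higher than \<open>s\<close>, so it is an end
  point for h but not for p.\<close>

lemma map_step:
  assumes x: "\<And>y. dotted s y \<longleftrightarrow> y = x"
    and u: "\<And>u. undotted x u \<Longrightarrow> c \<and> u = u0 \<or> \<not> critical u \<and> (\<forall>y. \<not> dotted u y)"
    and u0: "c \<Longrightarrow> undotted x u0" and fin: "\<And>t. c \<Longrightarrow> target_of s t \<Longrightarrow> finite (zigzags u0 t)"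
  shows "map_h s = smul (step_weight s x)
      (Poly_Mapping.single x 1 + (if c then smul (step_weight x u0) (map_h u0) else 0))"
    and "map_p s = smul (step_weight s x) (if c then smul (step_weight x u0) (map_p u0) else 0)"
    and "\<And>t. target_of s t \<Longrightarrow> finite (zigzags s t)"
proof -
  have dx: "dotted s x" using x by simp
  have deg: "bar_degree x = Suc (bar_degree s)" "c \<Longrightarrow> bar_degree u0 = bar_degree s"
    using dotted_degree[OF dx] undotted_degree[OF u0] by auto
  note tw = total_weight_step[OF x _ u u0 fin]
  show "map_h s = smul (step_weight s x)
      (Poly_Mapping.single x 1 + (if c then smul (step_weight x u0) (map_h u0) else 0))"
  proof (rule poly_mapping_eqI)
    fix t
    show "Poly_Mapping.lookup (map_h s) t = Poly_Mapping.lookup (smul (step_weight s x)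
      (Poly_Mapping.single x 1 + (if c then smul (step_weight x u0) (map_h u0) else 0))) t"
      using tw(1)[of t] deg dotted_bar_terms[OF dx]
      by (auto simp: lookup_map_h target_of_def lookup_add lookup_single when_def)
  qed
  show "map_p s = smul (step_weight s x) (if c then smul (step_weight x u0) (map_p u0) else 0)"
  proof (rule poly_mapping_eqI)
    fix t
    show "Poly_Mapping.lookup (map_p s) t = Poly_Mapping.lookup (smul (step_weight s x)
      (if c then smul (step_weight x u0) (map_p u0) else 0)) t"
      using tw(1)[of t] deg by (auto simp: lookup_map_p target_of_def)
  qed
  show "\<And>t. target_of s t \<Longrightarrow> finite (zigzags s t)" using tw(2) .
qed

end

section \<open>Bar terms on a path without tips\<close>

context toupie_algebra begin

lemma composable_adjacent: "composable x (us @ p # q # vs) \<Longrightarrow> tgt p = fst q"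
  by (induction us arbitrary: x) auto

end

section \<open>Pieces of a path and their bad segments\<close>

locale tip_free_path = toupie_algebra Q z \<omega> I Gmon B4 m \<kappa> C \<rho> tip W
  for Q :: "('a, 'b) pre_digraph" and z \<omega>
    and I :: "(('a, 'b) qpath \<Rightarrow>\<^sub>0 'k::field_char_0) set" and Gmon B4 m \<kappa> C \<rho> tip W +
  fixes x0 :: 'a and as :: "'b list"
  assumes path: "(x0, as) \<in> qpaths" and no_tip: "\<And>i. i < m \<Longrightarrow> \<not> subpath (tip i) (x0, as)"
begin

definition vert :: "nat \<Rightarrow> 'a" where
  "vert i = tgt (x0, take i as)"

definition piece :: "nat \<Rightarrow> nat \<Rightarrow> ('a, 'b) qpath" where
  "piece i j = (vert i, take (j - i) (drop i as))"

text \<open>The bound \<open>j' \<le> length as\<close> rules out pieces truncated at the end of the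
  path.\<close>

definition bad :: "nat \<Rightarrow> nat \<Rightarrow> bool" where
  "bad i j \<longleftrightarrow> (\<exists>i' j'. i \<le> i' \<and> i' \<le> j' \<and> j' \<le> j \<and> j' \<le> length as \<and> piece i' j' \<in> W)"

sublocale overlaps "length as" bad
proof
  show "bad i j \<Longrightarrow> i' \<le> i \<Longrightarrow> j \<le> j' \<Longrightarrow> bad i' j'" for i j i' j'
    unfolding bad_def by (meson order_trans)
  show "\<not> bad i (Suc i)" for i
    using W_length by (fastforce simp: bad_def piece_def)
qed

lemma take_split: "i \<le> j \<Longrightarrow> take j as = take i as @ take (j - i) (drop i as)"
  by (metis le_add_diff_inverse take_add)

lemma tgt_piece: "i \<le> j \<Longrightarrow> tgt (piece i j) = vert j"
  using tgt_append[of x0 "take i as" "take (j - i) (drop i as)"] by (simp add: piece_def vert_def take_split)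

lemma pcat_piece: "i \<le> j \<Longrightarrow> j \<le> k \<Longrightarrow> pcat (piece i j) (piece j k) = piece i k"
proof -
  assume a: "i \<le> j" "j \<le> k"
  then have "take (k - i) (drop i as) = take (j - i) (drop i as) @ take (k - i - (j - i)) (drop (j - i) (drop i as))"
    by (metis diff_le_mono le_add_diff_inverse take_add)
  then show ?thesis using a by (simp add: pcat_def piece_def add.commute)
qed

lemma length_piece: "i \<le> j \<Longrightarrow> j \<le> length as \<Longrightarrow> length (snd (piece i j)) = j - i"
  by (simp add: piece_def)

lemma piece_qpaths:
  assumes "i \<le> j" "j \<le> length as" shows "piece i j \<in> qpaths"
proof -
  have as: "as = take i as @ take (j - i) (drop i as) @ drop j as"
    using assms by (metis append.assoc append_take_drop_id take_split)
  then have "(x0, take i as @ take (j - i) (drop i as) @ drop j as) \<in> qpaths" using path by simp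
  then show ?thesis by (simp add: qpaths_append piece_def vert_def)
qed

lemma subpath_piece:
  assumes "i \<le> j" "j \<le> length as"
  shows "subpath s (piece i j) \<longleftrightarrow> (\<exists>i' j'. i \<le> i' \<and> i' \<le> j' \<and> j' \<le> j \<and> s = piece i' j')"
proof
  assume "subpath s (piece i j)"
  then obtain xs ys where s: "take (j - i) (drop i as) = xs @ snd s @ ys" "fst s = tgt (vert i, xs)"
    by (auto simp: subpath_def piece_def)
  define i' where "i' = i + length xs"
  define j' where "j' = i' + length (snd s)"
  have len: "j - i = length xs + (length (snd s) + length ys)"
    using arg_cong[OF s(1), of length] assms by simp
  have xs: "xs = take (length xs) (drop i as)"
  proof -
    have "xs = take (length xs) (take (j - i) (drop i as))" by (simp add: s(1))
    then show ?thesis using len by (simp add: min_def)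
  qed
  have "snd s = take (length (snd s)) (drop (length xs) (take (j - i) (drop i as)))" by (simp add: s(1))
  then have ss: "snd s = take (length (snd s)) (drop i' as)"
    using len by (simp add: drop_take i'_def add.commute min_def)
  have "fst s = vert i'"
  proof -
    have "take i' as = take i as @ xs" unfolding i'_def take_add by (simp flip: xs)
    then show ?thesis using s(2) by (simp add: vert_def tgt_append)
  qed
  moreover have "snd s = take (j' - i') (drop i' as)" unfolding j'_def diff_add_inverse by (rule ss)
  ultimately have "s = piece i' j'"
    unfolding piece_def by (intro prod_eqI) (simp_all only: fst_conv snd_conv)
  moreover have "i \<le> i'" "i' \<le> j'" "j' \<le> j" using len assms by (auto simp: i'_def j'_def)
  ultimately show "\<exists>i' j'. i \<le> i' \<and> i' \<le> j' \<and> j' \<le> j \<and> s = piece i' j'" by blast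
next
  assume "\<exists>i' j'. i \<le> i' \<and> i' \<le> j' \<and> j' \<le> j \<and> s = piece i' j'"
  then obtain i' j' where i': "i \<le> i'" "i' \<le> j'" "j' \<le> j" "s = piece i' j'" by blast
  have "subpath s (pcat s (piece j' j))" by (rule subpath_pcat(1)[OF subpath_refl])
  then have "subpath s (pcat (piece i i') (pcat s (piece j' j)))"
    using i' by (intro subpath_pcat(2)[where p = "piece i i'"]) (auto simp: tgt_piece, simp add: pcat_def piece_def)
  then show "subpath s (piece i j)" using i' by (simp add: pcat_piece)
qed

lemma bad_iff: "i \<le> j \<Longrightarrow> j \<le> length as \<Longrightarrow> bad i j \<longleftrightarrow> (\<exists>s\<in>W. subpath s (piece i j))"
proof -
  assume a: "i \<le> j" "j \<le> length as"
  show ?thesis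
    unfolding bad_def subpath_piece[OF a] using a(2)
    by (intro iffI; elim exE bexE conjE) (blast, blast intro: order_trans)
qed

lemma piece_NonTip: "i \<le> j \<Longrightarrow> j \<le> length as \<Longrightarrow> piece i j \<in> NonTip \<longleftrightarrow> \<not> bad i j"
  using piece_qpaths by (simp add: NonTip_def bad_iff)

text \<open>The element of \<open>W\<close> inside a bad piece is no tip of a relation, hence it
  lies in \<open>Gmon\<close> and the piece is zero in the algebra.\<close>

lemma nf_piece:
  assumes "i \<le> j" "j \<le> length as"
  shows "nf (of_path (piece i j)) = (if bad i j then 0 else of_path (piece i j))"
proof (cases "bad i j")
  case True
  then obtain s where s: "s \<in> W" "subpath s (piece i j)" using bad_iff assms by blast
  have whole: "piece 0 (length as) = (x0, as)" by (simp add: piece_def vert_def)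
  have "subpath s (piece 0 (length as))"
    using s(2) assms unfolding subpath_piece[OF assms] by (subst subpath_piece) (auto intro: order_trans)
  then have "s \<in> Gmon" using s(1) W_cases no_tip whole by auto
  then have "\<not> Gfree (piece i j)" using s(2) unfolding Gfree_def by blast
  then show ?thesis using nf_mon piece_qpaths[OF assms] True by simp
next
  case False
  then show ?thesis using nf_NonTip piece_NonTip[OF assms] by simp
qed

section \<open>Bar terms encoded by break points\<close>

definition pieces :: "nat list \<Rightarrow> ('a, 'b) qpath list" where
  "pieces zs = map (\<lambda>i. piece (zs ! i) (zs ! Suc i)) [0..<length zs - 1]"

definition bt :: "nat list \<Rightarrow> ('a, 'b) bar" where
  "bt zs = (vert (hd zs), pieces zs)"

lemma length_pieces [simp]: "length (pieces zs) = length zs - 1"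
  by (simp add: pieces_def)

lemma nth_pieces [simp]: "i < length zs - 1 \<Longrightarrow> pieces zs ! i = piece (zs ! i) (zs ! Suc i)"
  by (simp add: pieces_def)

lemma take_pieces: "take j (pieces zs) = pieces (take (Suc j) zs)"
  by (rule nth_equalityI) auto

lemma drop_pieces: "drop j (pieces zs) = pieces (drop j zs)"
  by (rule nth_equalityI) (auto simp: add.commute)

lemma pieces_Cons: "pieces (a # b # zs) = piece a b # pieces (b # zs)"
  by (rule nth_equalityI) (auto simp: nth_Cons split: nat.splits)

lemma pieces_simps [simp]: "pieces [a] = []" "pieces [] = []"
  by (simp_all add: pieces_def)

lemma pconcat_pieces:
  "sorted_wrt (<) (a # zs) \<Longrightarrow> pconcat (vert a) (pieces (a # zs)) = piece a (last (a # zs))"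
proof (induction zs arbitrary: a)
  case Nil
  then show ?case by (simp add: pconcat_def piece_def)
next
  case (Cons b zs)
  have "last (b # zs) \<in> set (b # zs)" by simp
  then have "b \<le> last (b # zs)" using Cons.prems unfolding sorted_wrt.simps by (metis less_imp_le order_refl set_ConsD)
  then have "pcat (piece a b) (piece b (last (b # zs))) = piece a (last (b # zs))"
    using Cons.prems by (intro pcat_piece) auto
  then show ?case using Cons.IH[of b] Cons.prems
    by (simp add: pieces_Cons pconcat_def pcat_def piece_def)
qed

lemma composable_pieces: "sorted_wrt (<) (a # zs) \<Longrightarrow> composable (vert a) (pieces (a # zs))"
proof (induction zs arbitrary: a)
  case (Cons b zs)
  then show ?case by (simp add: pieces_Cons tgt_piece) (simp add: piece_def)
qed simp

lemma vert_verts: "i \<le> length as \<Longrightarrow> vert i \<in> verts Q"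
  using qpaths_tgt[OF piece_qpaths[of i i]] by (simp add: piece_def awalk_Nil_iff)

lemma valid_bar_terms:
  assumes "valid zs" shows "bt zs \<in> bar_terms"
proof -
  obtain a y where zs: "zs = a # y" using assms by (cases zs) (auto simp: valid_def)
  have "p \<in> NonTip \<and> snd p \<noteq> []" if "p \<in> set (pieces zs)" for p
  proof -
    obtain i where i: "p = piece (zs ! i) (zs ! Suc i)" "Suc i < length zs"
      using \<open>p \<in> set (pieces zs)\<close> by (auto simp: pieces_def)
    then have "zs ! i < zs ! Suc i" "zs ! Suc i \<le> length as" "\<not> bad (zs ! i) (zs ! Suc i)"
      using assms valid_less[of zs i "Suc i"] valid_le[of zs] by (auto simp: valid_def)
    then show ?thesis using i piece_NonTip[of "zs ! i" "zs ! Suc i"] by (auto simp: piece_def)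
  qed
  then show ?thesis
    using composable_pieces[of a y] vert_verts[of a] assms by (auto simp: bar_terms_def bt_def zs valid_def)
qed

text \<open>The first break points are taken equal because \<open>bt\<close> records the position on
  the path only through vertices; the lengths of the pieces then give the rest.\<close>

lemma bt_inj:
  assumes "valid xs" "valid ys" "hd xs = hd ys" "bt xs = bt ys" shows "xs = ys"
proof (rule nth_equalityI)
  have "length (pieces xs) = length (pieces ys)" "2 \<le> length xs" "2 \<le> length ys"
    using assms by (auto simp: bt_def valid_def)
  then show len: "length xs = length ys" by simp
  fix i assume "i < length xs"
  then show "xs ! i = ys ! i"
  proof (induction i)
    case 0
    then show ?case using assms(3) valid_ne(1)[OF assms(1)] valid_ne(1)[OF assms(2)] by simp
  next
    case (Suc i)
    have eq: "xs ! i = ys ! i" using Suc by simp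
    have "pieces xs ! i = pieces ys ! i" using assms(4) by (simp add: bt_def)
    then have "piece (xs ! i) (xs ! Suc i) = piece (ys ! i) (ys ! Suc i)" using Suc.prems len by simp
    then have "length (snd (piece (xs ! i) (xs ! Suc i))) = length (snd (piece (ys ! i) (ys ! Suc i)))" by simp
    then show ?case
      using eq length_piece[of "xs ! i" "xs ! Suc i"] length_piece[of "ys ! i" "ys ! Suc i"] Suc.prems len
        valid_less[OF assms(1), of i "Suc i"] valid_less[OF assms(2), of i "Suc i"]
        valid_le[OF assms(1), of "Suc i"] valid_le[OF assms(2), of "Suc i"] by simp
  qed
qed

lemma bar_degree_bt [simp]: "bar_degree (bt xs) = length xs - 1"
  by (simp add: bar_degree_def bt_def)

lemma bar_path_bt: "valid xs \<Longrightarrow> bar_path (bt xs) = piece (hd xs) (last xs)"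
  using pconcat_pieces[of "hd xs" "tl xs"] valid_hd_last(2)[of xs]
  by (simp add: bar_path_def bt_def valid_def)

section \<open>The Uf-graph restricted to pieces of the path\<close>

lemma uf_verts_arrow: "i < length as \<Longrightarrow> piece i (Suc i) \<in> uf_verts"
proof -
  assume i: "i < length as"
  have "piece i (Suc i) = (vert i, [as ! i])" using i by (simp add: piece_def take_Suc_conv_app_nth hd_drop_conv_nth take_Suc)
  moreover have "(vert i, [as ! i]) \<in> qpaths" using piece_qpaths[of i "Suc i"] i calculation by simp
  then have "as ! i \<in> arcs Q" "vert i = tail Q (as ! i)" by (auto simp: qpaths_def awalk_Cons_iff)
  ultimately show ?thesis by (auto simp: uf_verts_def)
qed

lemma uf_arc_start:
  assumes "a < b" "b \<le> length as" "\<not> bad a b"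
  shows "uf_arc (vert a, []) (piece a b) \<longleftrightarrow> b = Suc a"
proof
  assume u: "uf_arc (vert a, []) (piece a b)"
  have "of_path (pcat (vert a, []) (piece a b)) \<notin> tip_ideal"
    using assms tip_ideal_iff[OF piece_qpaths[of a b]] bad_iff[of a b]
    by (simp add: pcat_def piece_def)
  then obtain e where "piece a b = (tail Q e, [e])" using u by (auto simp: uf_arc_def)
  then have "length (snd (piece a b)) = 1" by simp
  then show "b = Suc a" using assms length_piece[of a b] by simp
next
  assume b: "b = Suc a"
  have "piece a (Suc a) = (vert a, [as ! a])" using assms b by (simp add: piece_def take_Suc hd_drop_conv_nth)
  moreover have "(vert a, [as ! a]) \<in> qpaths" using piece_qpaths[of a "Suc a"] assms b calculation by simp
  then have "as ! a \<in> arcs Q" "vert a = tail Q (as ! a)" by (auto simp: qpaths_def awalk_Cons_iff)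
  moreover have "piece a (Suc a) \<in> uf_verts" using uf_verts_arrow assms by simp
  moreover have "(vert a, []) \<in> uf_verts" using vert_verts assms by (auto simp: uf_verts_def)
  ultimately show "uf_arc (vert a, []) (piece a b)" unfolding uf_arc_def b by auto
qed

text \<open>Left factors of a piece from \<open>a\<close> are the shorter pieces from
  \<open>a\<close>, so minimality in the definition of the Uf-graph says exactly that
  \<open>c\<close> is E of \<open>a\<close>. Membership in \<open>uf_verts\<close> is passed on from
  one piece to the next, as an induction along a chain needs it.\<close>

lemma uf_arc_step:
  assumes "a < b" "b < c" "c \<le> length as" "\<not> bad a b" "\<not> bad b c"
  shows "uf_arc (piece a b) (piece b c) \<Longrightarrow> c = E a"
    and "c = E a \<Longrightarrow> piece a b \<in> uf_verts \<Longrightarrow> uf_arc (piece a b) (piece b c) \<and> piece b c \<in> uf_verts"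
proof -
  have ne: "snd (piece a b) \<noteq> []" using assms by (simp add: piece_def)
  have pc: "pcat (piece a b) (piece b c) = piece a c" using pcat_piece assms by simp
  have tip: "of_path (piece a c') \<in> tip_ideal \<longleftrightarrow> bad a c'" if "a \<le> c'" "c' \<le> c" for c'
    using tip_ideal_iff[OF piece_qpaths[of a c']] bad_iff[of a c'] that assms by simp
  have left: "proper_left_factor q (piece a c) \<longleftrightarrow> (\<exists>c'. a \<le> c' \<and> c' < c \<and> q = piece a c')" for q
  proof
    assume "proper_left_factor q (piece a c)"
    then obtain ys where y: "ys \<noteq> []" "fst q = vert a" "take (c - a) (drop a as) = snd q @ ys"
      by (auto simp: proper_left_factor_def piece_def)
    have len: "c - a = length (snd q) + length ys" using arg_cong[OF y(3), of length] assms by simp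
    have "snd q = take (length (snd q)) (take (c - a) (drop a as))" by (simp add: y(3))
    then have "snd q = take (length (snd q)) (drop a as)" using len by (simp add: min_def)
    then have "q = piece a (a + length (snd q))"
      unfolding piece_def diff_add_inverse by (intro prod_eqI) (use y(2) in \<open>simp_all only: fst_conv snd_conv\<close>)
    moreover have "a + length (snd q) < c" using len y(1) by (cases ys) auto
    ultimately show "\<exists>c'. a \<le> c' \<and> c' < c \<and> q = piece a c'" by (metis le_add1)
  next
    assume "\<exists>c'. a \<le> c' \<and> c' < c \<and> q = piece a c'"
    then obtain c' where c': "a \<le> c'" "c' < c" "q = piece a c'" by blast
    then have "piece a c = pcat (piece a c') (piece c' c)" using pcat_piece by simp
    moreover have "snd (piece c' c) \<noteq> []" using c' assms by (simp add: piece_def)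
    ultimately show "proper_left_factor q (piece a c)" using c' by (auto simp: proper_left_factor_def pcat_def)
  qed
  have Eiff: "c = E a \<longleftrightarrow> bad a c \<and> (\<forall>c'. a \<le> c' \<and> c' < c \<longrightarrow> \<not> bad a c')"
  proof
    assume "c = E a"
    then show "bad a c \<and> (\<forall>c'. a \<le> c' \<and> c' < c \<longrightarrow> \<not> bad a c')"
      using E_le_iff[OF assms(3), of a] less_E_iff[of _ a] assms(3) by (metis order_refl less_imp_le order_trans)
  next
    assume h: "bad a c \<and> (\<forall>c'. a \<le> c' \<and> c' < c \<longrightarrow> \<not> bad a c')"
    then have "E a \<le> c" using E_le_iff[OF assms(3)] by simp
    moreover have "\<not> E a < c"
    proof
      assume l: "E a < c"
      have "b < E a" using less_E_iff assms by simp
      then show False using h l assms E_le_iff[of "E a" a] by simp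
    qed
    ultimately show "c = E a" by simp
  qed
  show "c = E a" if "uf_arc (piece a b) (piece b c)"
  proof -
    have "of_path (piece a c) \<in> tip_ideal \<and> (\<forall>q. proper_left_factor q (piece a c) \<longrightarrow> of_path q \<notin> tip_ideal)"
      using that ne unfolding uf_arc_def pc by auto
    then show ?thesis unfolding Eiff left using tip assms by (metis less_imp_le less_trans order_refl)
  qed
  assume c: "c = E a" and u: "piece a b \<in> uf_verts"
  have bd: "bad a c" "\<And>c'. a \<le> c' \<Longrightarrow> c' < c \<Longrightarrow> \<not> bad a c'" using c Eiff by auto
  obtain i' j' where ij: "a \<le> i'" "i' \<le> j'" "j' \<le> c" "piece i' j' \<in> W" using bd(1) by (auto simp: bad_def)
  have "bad a j'" unfolding bad_def using ij assms by (intro exI[of _ i'] exI[of _ j']) auto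
  then have j': "j' = c" using bd(2)[of j'] ij by (metis le_neq_implies_less order_trans)
  \<comment> \<open>A tip inside the minimal bad segment ends at \<open>c\<close> and, the last
    piece not being bad, starts before \<open>b\<close>. So this piece is a proper right factor of a
    tip.\<close>
  have "i' < b"
  proof (rule ccontr)
    assume "\<not> i' < b"
    then have "bad b c" unfolding bad_def using ij assms by (intro exI[of _ i'] exI[of _ j']) auto
    then show False using assms by simp
  qed
  then have "proper_right_factor (piece b c) (piece i' c)"
    unfolding proper_right_factor_def
    using pcat_piece[of i' b c] assms length_piece[of i' b] tgt_piece[of i' b]
    by (intro exI[of _ "snd (piece i' b)"]) (auto simp: pcat_def piece_def)
  then have v: "piece b c \<in> uf_verts" using ij j' by (auto simp: uf_verts_def)
  have "uf_arc (piece a b) (piece b c)"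
    unfolding uf_arc_def pc left using u v tip bd assms tgt_piece[of a b]
    by (auto simp: piece_def[of b c] less_imp_le)
  then show "uf_arc (piece a b) (piece b c) \<and> piece b c \<in> uf_verts" using v by simp
qed

lemma chains_iff:
  assumes v: "valid xs"
  shows "(vert (hd xs), take k (pieces xs)) \<in> chains k \<longleftrightarrow> pre xs k"
proof (cases "k < length xs")
  case False
  then show ?thesis using v by (auto simp: chains_def pre_def valid_def)
next
  case True
  have hd: "hd xs = xs ! 0" using valid_ne v by simp
  let ?ws = "take k (pieces xs)"
  have len: "length ?ws = k" using True by simp
  have "(vert (hd xs), ?ws) \<in> bar_terms"
  proof (cases "k = 0")
    case True
    then show ?thesis using vert_verts[of "hd xs"] v hd valid_le[OF v, of 0] valid_hd_last(2)[OF v]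
      by (auto simp: bar_terms_def)
  next
    case False
    then show ?thesis using valid_bar_terms[OF take_valid[OF v, of k]] True hd by (simp add: bt_def take_pieces hd_take)
  qed
  then have ch: "(vert (hd xs), ?ws) \<in> chains k \<longleftrightarrow>
      (\<forall>i<k. uf_arc (((vert (hd xs), []) # ?ws) ! i) (?ws ! i))"
    using len by (simp add: chains_def successively_Cons_nth)
  have ws: "?ws ! i = piece (xs ! i) (xs ! Suc i)" if "i < k" for i using that True by simp
  have f: "xs ! i < xs ! Suc i" "xs ! Suc i \<le> length as" "\<not> bad (xs ! i) (xs ! Suc i)" if "i < k" for i
    using valid_less[OF v, of i "Suc i"] valid_le[OF v, of "Suc i"] v that True by (auto simp: valid_def)
  have start: "uf_arc (vert (hd xs), []) (?ws ! 0) \<longleftrightarrow> xs ! 1 = nxt xs 0" if "0 < k"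
    using uf_arc_start[of "xs ! 0" "xs ! 1"] f[of 0] ws[of 0] that hd by (simp add: nxt_def)
  show ?thesis
  proof
    assume "(vert (hd xs), ?ws) \<in> chains k"
    then have u: "\<And>i. i < k \<Longrightarrow> uf_arc (((vert (hd xs), []) # ?ws) ! i) (?ws ! i)" using ch by simp
    have "xs ! Suc i = nxt xs i" if "i < k" for i
    proof (cases i)
      case 0
      then show ?thesis using start u[of 0] that by simp
    next
      case (Suc l)
      then have "uf_arc (piece (xs ! l) (xs ! i)) (piece (xs ! i) (xs ! Suc i))"
        using u[OF that] ws[of l] ws[of i] that by simp
      then show ?thesis
        using uf_arc_step(1)[of "xs ! l" "xs ! i" "xs ! Suc i"] f[of l] f[of i] Suc that by (simp add: nxt_def)
    qed
    then show "pre xs k" using True by (simp add: pre_def)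
  next
    assume p: "pre xs k"
    have "uf_arc (((vert (hd xs), []) # ?ws) ! i) (?ws ! i) \<and> ?ws ! i \<in> uf_verts" if "i < k" for i
      using that
    proof (induction i)
      case 0
      then have "xs ! 1 = nxt xs 0" using p by (simp add: pre_def)
      then show ?case using start 0 ws[of 0] uf_verts_arrow[of "xs ! 0"] f[of 0] by (simp add: nxt_def)
    next
      case (Suc i)
      have "xs ! Suc (Suc i) = E (xs ! i)" using p Suc.prems by (auto simp: pre_def nxt_def)
      then show ?case
        using uf_arc_step(2)[of "xs ! i" "xs ! Suc i" "xs ! Suc (Suc i)"] f[of i] f[of "Suc i"]
          Suc ws[of i] ws[of "Suc i"] by simp
    qed
    then show "(vert (hd xs), ?ws) \<in> chains k" using ch by simp
  qed
qed

lemma chain_bt: "valid xs \<Longrightarrow> bt xs \<in> chains (length xs - 1) \<longleftrightarrow> chain xs"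
  using chains_iff[of xs "length xs - 1"] by (simp add: bt_def chain_def)

lemma Vset_bt:
  assumes "valid xs"
  shows "bt xs \<in> Vset q k n \<longleftrightarrow> length xs - 1 = n \<and> piece (hd xs) (last xs) = q \<and> pre xs k \<and> \<not> pre xs (Suc k)"
  using chains_iff[OF assms] valid_bar_terms[OF assms] bar_path_bt[OF assms]
  by (auto simp: Vset_def bt_def)

section \<open>The differential and the Morse matching on break points\<close>

lemma pieces_rem:
  assumes "valid x" "1 \<le> j" "Suc j < length x"
  shows "pieces (rem x j) = take (j - 1) (pieces x) @ [piece (x ! (j - 1)) (x ! Suc j)] @ drop (j + 1) (pieces x)"
proof (rule nth_equalityI)
  have j: "j < length x" using assms by simp
  note n = rem_nth[OF j]
  show "length (pieces (rem x j)) = length (take (j - 1) (pieces x) @ [piece (x ! (j - 1)) (x ! Suc j)] @ drop (j + 1) (pieces x))"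
    using n(1) assms by simp
  fix i assume "i < length (pieces (rem x j))"
  then have i: "Suc i < length x - 1" using n(1) by simp
  consider "Suc i < j" | "Suc i = j" | l where "i = j + l"
    by (metis le_add_diff_inverse linorder_neqE_nat not_less_eq_eq Suc_leI)
  then show "pieces (rem x j) ! i = (take (j - 1) (pieces x) @ [piece (x ! (j - 1)) (x ! Suc j)] @ drop (j + 1) (pieces x)) ! i"
  proof cases
    case 1
    then have "i < j - 1" by simp
    then show ?thesis using 1 i n by (simp add: nth_append)
  next
    case 2
    then show ?thesis using i n(1) n(2)[of i] n(3)[of "Suc i"] by (auto simp: nth_append)
  next
    case 3
    moreover have "\<not> j + l < j - Suc 0" by simp
    ultimately show ?thesis using i n(1) n(3)[of i] n(3)[of "Suc i"] assms by (simp add: nth_append)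
  qed
qed

lemma bt_rem:
  assumes "valid x" "1 \<le> j" "Suc j < length x"
  shows "bt (rem x j) = (vert (hd x), take (j - 1) (pieces x) @ [piece (x ! (j - 1)) (x ! Suc j)] @ drop (j + 1) (pieces x))"
  using pieces_rem[OF assms] hd_rem[of j x] assms by (simp add: bt_def)

lemma bar_d_bt:
  assumes "valid x"
  shows "bar_d (bt x) = (\<Sum>j = 1..<length x - 1. if bad (x ! (j - 1)) (x ! Suc j) then 0
     else Poly_Mapping.single (bt (rem x j)) ((-1) ^ j))"
  unfolding bar_d_def bt_def[of x] prod.case length_pieces
proof (rule sum.cong)
  fix j assume j: "j \<in> {1..<length x - 1}"
  then obtain l where l: "j = Suc l" by (cases j) auto
  have lt: "x ! l < x ! j" "x ! j < x ! Suc j" "x ! Suc j \<le> length as"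
    using valid_less[OF assms] valid_le[OF assms, of "Suc j"] j l by auto
  have "pcat (pieces x ! (j - 1)) (pieces x ! j) = piece (x ! l) (x ! Suc j)"
    using j l lt pcat_piece[of "x ! l" "x ! j" "x ! Suc j"] by simp
  then show "smul ((-1) ^ j) (lin (\<lambda>p. Poly_Mapping.single (vert (hd x), take (j - 1) (pieces x) @ [p] @ drop (j + 1) (pieces x)) 1)
      (nf (of_path (pcat (pieces x ! (j - 1)) (pieces x ! j))))) =
    (if bad (x ! (j - 1)) (x ! Suc j) then 0 else Poly_Mapping.single (bt (rem x j)) ((-1) ^ j))"
    using nf_piece[of "x ! l" "x ! Suc j"] lt bt_rem[OF assms, of j] j l by (simp add: of_path_def)
qed simp

text \<open>Removing different break points gives different bar terms, so nothing cancels in the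
  differential.\<close>

lemma lookup_bar_d:
  assumes "valid x" "1 \<le> j" "Suc j < length x" "\<not> bad (x ! (j - 1)) (x ! Suc j)"
  shows "Poly_Mapping.lookup (bar_d (bt x)) (bt (rem x j)) = (-1) ^ j"
proof -
  have "Poly_Mapping.lookup (if bad (x ! (i - 1)) (x ! Suc i) then 0
     else Poly_Mapping.single (bt (rem x i)) ((-1) ^ i)) (bt (rem x j)) = (if i = j then (-1) ^ j else (0 :: 'k))"
    if i: "i \<in> {1..<length x - 1}" for i
  proof -
    have "bt (rem x i) \<noteq> bt (rem x j)" if "i \<noteq> j" "\<not> bad (x ! (i - 1)) (x ! Suc i)"
    proof
      assume "bt (rem x i) = bt (rem x j)"
      then have "rem x i = rem x j"
        using valid_rem assms i that hd_rem[of i x] hd_rem[of j x] by (intro bt_inj) auto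
      moreover have "i < length x" "j < length x" using i assms(3) by auto
      ultimately show False using rem_inj[of x i j] assms(1) that by blast
    qed
    then show ?thesis using assms(4) by (auto simp: lookup_single when_def)
  qed
  then have "Poly_Mapping.lookup (bar_d (bt x)) (bt (rem x j)) = (\<Sum>i = 1..<length x - 1. if i = j then (-1) ^ j else 0)"
    unfolding bar_d_bt[OF assms(1)] lookup_sum by (rule sum.cong[OF refl])
  then show ?thesis using assms by simp
qed

lemma G_arrow_bt:
  assumes "valid x"
  shows "G_arrow (bt x) t \<longleftrightarrow> (\<exists>j. 1 \<le> j \<and> Suc j < length x \<and> \<not> bad (x ! (j - 1)) (x ! Suc j) \<and> t = bt (rem x j))"
proof
  assume "G_arrow (bt x) t"
  then have "t \<in> Poly_Mapping.keys (bar_d (bt x))" by (simp add: G_arrow_def in_keys_iff)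
  then have "t \<in> (\<Union>j\<in>{1..<length x - 1}. Poly_Mapping.keys (if bad (x ! (j - 1)) (x ! Suc j) then 0
     else Poly_Mapping.single (bt (rem x j)) ((-1) ^ j :: 'k)))"
    unfolding bar_d_bt[OF assms] by (rule subsetD[OF keys_sum])
  then obtain j where "j \<in> {1..<length x - 1}" "t \<in> Poly_Mapping.keys (if bad (x ! (j - 1)) (x ! Suc j) then 0
     else Poly_Mapping.single (bt (rem x j)) ((-1) ^ j :: 'k))" by (elim UN_E)
  then show "\<exists>j. 1 \<le> j \<and> Suc j < length x \<and> \<not> bad (x ! (j - 1)) (x ! Suc j) \<and> t = bt (rem x j)"
    by (intro exI[of _ j]) (auto split: if_splits)
next
  assume "\<exists>j. 1 \<le> j \<and> Suc j < length x \<and> \<not> bad (x ! (j - 1)) (x ! Suc j) \<and> t = bt (rem x j)"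
  then obtain j where j: "1 \<le> j" "Suc j < length x" "\<not> bad (x ! (j - 1)) (x ! Suc j)" "t = bt (rem x j)" by blast
  then show "G_arrow (bt x) t"
    using lookup_bar_d[OF assms j(1-3)] valid_bar_terms[OF assms] valid_bar_terms[OF valid_rem[OF assms j(1-3)]]
    by (simp add: G_arrow_def)
qed

lemma list_split_two: "Suc k < length l \<Longrightarrow> l = take k l @ [l ! k, l ! Suc k] @ drop (Suc (Suc k)) l"
  by (simp add: Cons_nth_drop_Suc)

lemma matching_bt:
  assumes x: "valid x" "pre x (Suc k)" "\<not> pre x (Suc (Suc k))" "Suc (Suc k) < length x"
    and z: "valid (rem x (Suc k))" "pre (rem x (Suc k)) k" "\<not> pre (rem x (Suc k)) (Suc k)"
    and nb: "\<not> bad (x ! k) (x ! Suc (Suc k))"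
  shows "(bt x, bt (rem x (Suc k))) \<in> matching"
proof -
  define q where "q = piece (hd x) (last x)"
  have hl: "hd (rem x (Suc k)) = hd x" "last (rem x (Suc k)) = last x"
    using hd_rem[of "Suc k" x] x(4) by (auto simp: rem_def)
  have G: "G_arrow (bt x) (bt (rem x (Suc k)))" using G_arrow_bt[OF x(1)] x(4) nb by (intro iffD2[OF G_arrow_bt[OF x(1)]] exI[of _ "Suc k"]) simp
  have lt: "x ! k < x ! Suc k" "x ! Suc k < x ! Suc (Suc k)" using valid_less[OF x(1)] x(4) by auto
  have "bt x = (vert (hd x), take k (pieces x) @ [piece (x ! k) (x ! Suc k), piece (x ! Suc k) (x ! Suc (Suc k))] @ drop (Suc (Suc k)) (pieces x))"
    using list_split_two[of k "pieces x"] x(4) by (simp add: bt_def)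
  moreover have "bt (rem x (Suc k)) = (vert (hd x), take k (pieces x) @ [pcat (piece (x ! k) (x ! Suc k)) (piece (x ! Suc k) (x ! Suc (Suc k)))] @ drop (Suc (Suc k)) (pieces x))"
    using bt_rem[OF x(1), of "Suc k"] x(4) lt pcat_piece[of "x ! k" "x ! Suc k" "x ! Suc (Suc k)"] by simp
  moreover have "bt x \<in> Vset q (Suc (length (take k (pieces x)))) (Suc (length (snd (bt (rem x (Suc k))))))"
    using x by (simp add: Vset_bt[OF x(1)] q_def rem_nth(1)) (simp add: bt_def rem_nth(1))
  moreover have "bt (rem x (Suc k)) \<in> Vset q (length (take k (pieces x))) (length (snd (bt (rem x (Suc k)))))"
    using x(4) z hl by (simp add: Vset_bt[OF z(1)] q_def rem_nth(1)) (simp add: bt_def rem_nth(1))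
  ultimately show ?thesis using G unfolding matching_def by blast
qed

lemma matching_ins:
  assumes "valid zs" "typeA zs k" shows "(bt (ins zs k), bt zs) \<in> matching"
proof -
  have k: "Suc k < length zs" "pre zs k" using assms(2) by (auto simp: typeA_def)
  note n = ins_nth[OF k(1)] and r = rem_ins[OF k(1)] and v = valid_ins[OF assms]
  have "\<not> bad (zs ! k) (zs ! Suc k)" using assms(1) k by (simp add: valid_def)
  then have "(bt (ins zs k), bt (rem (ins zs k) (Suc k))) \<in> matching"
    using v r k n assms type_not_pre by (intro matching_bt) (auto simp: typeB_def)
  then show ?thesis by (simp add: r)
qed

lemma matching_source:
  assumes "valid x" "(bt x, t) \<in> matching"
  obtains k where "pre x (Suc k)" "\<not> pre x (Suc (Suc k))" "Suc (Suc k) < length x" "t = bt (rem x (Suc k))"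
proof -
  obtain y us w' w'' vs q where m: "bt x = (y, us @ [w', w''] @ vs)" "t = (y, us @ [pcat w' w''] @ vs)"
    "bt x \<in> Vset q (Suc (length us)) (Suc (length (snd t)))"
    using assms(2) unfolding matching_def mem_Collect_eq prod.case by (elim conjE exE) (rule that)
  define k where "k = length us"
  have px: "pieces x = us @ [w', w''] @ vs" "y = vert (hd x)" using m(1) by (auto simp: bt_def)
  have len: "length x - 1 = k + 2 + length vs" using arg_cong[OF px(1), of length] by (simp add: k_def)
  then have kl: "Suc (Suc k) < length x" by simp
  have lt: "x ! k < x ! Suc k" "x ! Suc k < x ! Suc (Suc k)" using valid_less[OF assms(1)] kl by auto
  have "w' = pieces x ! k" "w'' = pieces x ! Suc k" by (simp_all add: px(1) k_def nth_append)
  then have "pcat w' w'' = piece (x ! k) (x ! Suc (Suc k))" using kl len lt pcat_piece[of "x ! k" "x ! Suc k"] by simp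
  moreover have "us = take k (pieces x)" "vs = drop (Suc (Suc k)) (pieces x)" by (simp_all add: px(1) k_def)
  ultimately have "t = bt (rem x (Suc k))" using m(2) px(2) bt_rem[OF assms(1), of "Suc k"] kl by simp
  then show ?thesis using that[of k] kl m(3) Vset_bt[OF assms(1)] by (simp add: k_def)
qed

text \<open>The source of a matching arrow is not known to come from break points, so the cut inside
  the merged piece is recovered from the length of its left part. That the source has a longer chain
  prefix then forces the cut to be \<open>nxt zs k\<close>.\<close>

lemma matching_target:
  assumes "valid zs" "(s, bt zs) \<in> matching"
  obtains k where "typeA zs k" "s = bt (ins zs k)"
proof -
  obtain y us w' w'' vs q where m: "s = (y, us @ [w', w''] @ vs)" "bt zs = (y, us @ [pcat w' w''] @ vs)"
    "s \<in> Vset q (Suc (length us)) (Suc (length (snd (bt zs))))" "bt zs \<in> Vset q (length us) (length (snd (bt zs)))"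
    using assms(2) unfolding matching_def mem_Collect_eq prod.case by (elim conjE exE) (rule that)
  define k where "k = length us"
  have px: "pieces zs = us @ [pcat w' w''] @ vs" "y = vert (hd zs)" using m(2) by (auto simp: bt_def)
  have len: "length zs - 1 = k + 1 + length vs" using arg_cong[OF px(1), of length] by (simp add: k_def)
  then have kl: "Suc k < length zs" by simp
  have lt: "zs ! k < zs ! Suc k" "zs ! Suc k \<le> length as" using valid_less[OF assms(1)] valid_le[OF assms(1)] kl by auto
  have "pieces zs ! k = pcat w' w''" by (simp add: px(1) k_def nth_append)
  then have pc: "pcat w' w'' = piece (zs ! k) (zs ! Suc k)" using kl by simp
  have sb: "s \<in> bar_terms" using m(3) by (auto simp: Vset_def)
  then have w: "tgt w' = fst w''" "snd w' \<noteq> []" "snd w'' \<noteq> []"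
    using composable_adjacent[of y us w' w'' vs] by (auto simp: m(1) bar_terms_def)
  define c where "c = zs ! k + length (snd w')"
  have app: "snd w' @ snd w'' = take (zs ! Suc k - zs ! k) (drop (zs ! k) as)" "fst w' = vert (zs ! k)"
    using pc by (auto simp: pcat_def piece_def)
  have "length (snd w') + length (snd w'') = zs ! Suc k - zs ! k" using arg_cong[OF app(1), of length] lt by simp
  moreover have "0 < length (snd w')" "0 < length (snd w'')" using w by auto
  ultimately have c: "zs ! k < c" "c < zs ! Suc k" unfolding c_def by linarith+
  have pcs: "pcat (piece (zs ! k) c) (piece c (zs ! Suc k)) = piece (zs ! k) (zs ! Suc k)" using pcat_piece c by simp
  have "snd w' @ snd w'' = snd (piece (zs ! k) c) @ snd (piece c (zs ! Suc k))"
    using arg_cong[OF trans[OF pc pcs[symmetric]], of snd] by (simp add: pcat_def)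
  moreover have "length (snd w') = length (snd (piece (zs ! k) c))"
    using length_piece[of "zs ! k" c] c lt by (simp add: c_def)
  ultimately have sn: "snd w' = snd (piece (zs ! k) c)" "snd w'' = snd (piece c (zs ! Suc k))" by auto
  have w1: "w' = piece (zs ! k) c" using sn(1) app(2) by (intro prod_eqI) (simp_all add: piece_def)
  then have "fst w'' = vert c" using w(1) tgt_piece[of "zs ! k" c] c by simp
  then have w2: "w'' = piece c (zs ! Suc k)" using sn(2) by (intro prod_eqI) (simp_all add: piece_def)
  define x where "x = take (Suc k) zs @ c # drop (Suc k) zs"
  have vx: "valid x" unfolding x_def by (rule valid_insert[OF assms(1) kl c])
  have xk: "x ! k = zs ! k" "x ! Suc k = c" "x ! Suc (Suc k) = zs ! Suc k" "length x = Suc (length zs)"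
    using kl by (auto simp: x_def nth_append)
  have rx: "rem x (Suc k) = zs" unfolding x_def by (rule rem_insert[OF kl])
  have hx: "hd x = hd zs" using hd_rem[of "Suc k" x] rx xk kl by simp
  have pz: "pieces zs = take k (pieces x) @ [piece (zs ! k) (zs ! Suc k)] @ drop (Suc (Suc k)) (pieces x)"
    using pieces_rem[OF vx, of "Suc k"] xk kl rx by simp
  have "length (take k (pieces x)) = length us" using xk kl by (simp add: k_def)
  then have us: "us = take k (pieces x)" "vs = drop (Suc (Suc k)) (pieces x)"
    using pz unfolding px(1) by (simp_all add: append_eq_append_conv)
  have "pieces x = take k (pieces x) @ [pieces x ! k, pieces x ! Suc k] @ drop (Suc (Suc k)) (pieces x)"
    using xk kl by (intro list_split_two) simp
  then have "pieces x = us @ [w', w''] @ vs"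
    using us w1 w2 xk kl by simp
  then have s: "s = bt x" using m(1) px(2) hx by (simp add: bt_def)
  have "pre x (Suc k)" using m(3) Vset_bt[OF vx] by (simp add: s k_def)
  then have "c = nxt x k" using xk by (auto simp: pre_def)
  also have "nxt x k = nxt zs k" using kl by (auto simp: nxt_def x_def nth_append)
  finally have cn: "c = nxt zs k" .
  have "pre zs k" using m(4) Vset_bt[OF assms(1)] by (simp add: k_def)
  then have "typeA zs k" using c(2) cn kl by (simp add: typeA_def)
  then show ?thesis using that s cn by (simp add: ins_def x_def)
qed

section \<open>The deterministic zigzag and its weights\<close>

lemma dotted_bt: "valid zs \<Longrightarrow> dotted (bt zs) s \<longleftrightarrow> (\<exists>k. typeA zs k \<and> s = bt (ins zs k))"
  unfolding dotted_def using matching_ins matching_target by metis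

lemma typeA_unique: "typeA zs k \<Longrightarrow> typeA zs l \<Longrightarrow> k = l"
  using type_unique type_not_pre by (metis typeA_def)

lemma types_exclusive: "typeA zs k \<Longrightarrow> typeB zs l \<Longrightarrow> False"
  using type_unique[of zs k l] type_not_pre[of zs] by (auto simp: typeA_def typeB_def)

lemma typeB_dead: "valid zs \<Longrightarrow> typeB zs k \<Longrightarrow> \<not> dotted (bt zs) s"
  using dotted_bt types_exclusive by blast

lemma typeB_not_critical: "valid zs \<Longrightarrow> typeB zs k \<Longrightarrow> \<not> critical (bt zs)"
  using typeB_rem[of zs k] matching_ins[of "rem zs k"] unfolding critical_def by metis

lemma chain_dead: "chain zs \<Longrightarrow> \<not> dotted (bt zs) s"
  using dotted_bt chain_types by (auto simp: chain_def)

lemma undotted_ins: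
  assumes "valid zs" "typeA zs k" "undotted (bt (ins zs k)) u"
  shows "continues zs k \<and> u = bt (zs[Suc k := nxt zs k]) \<or> \<not> critical u \<and> (\<forall>y. \<not> dotted u y)"
proof -
  have k: "Suc k < length zs" "pre zs k" using assms(2) by (auto simp: typeA_def)
  let ?x = "ins zs k"
  note n = ins_nth[OF k(1)] and v = valid_ins[OF assms(1,2)]
  obtain j where j: "1 \<le> j" "Suc j < length ?x" "\<not> bad (?x ! (j - 1)) (?x ! Suc j)" "u = bt (rem ?x j)"
    and nm: "(bt ?x, u) \<notin> matching"
    using assms(3) G_arrow_bt[OF v(1)] unfolding undotted_def by blast
  have "j \<noteq> Suc k" using nm matching_ins[OF assms(1,2)] rem_ins[OF k(1)] j(4) by auto
  \<comment> \<open>Merging two neighbouring pieces of the chain prefix yields a bad piece, hence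
    the product 0.\<close>
  moreover have "\<not> j < Suc k"
  proof
    assume "j < Suc k"
    then have "?x ! Suc j = E (?x ! (j - 1))" using v(2) j(1) by (auto simp: typeB_def pre_def nxt_def)
    then show False using j(3) E_le_iff[of "?x ! Suc j" "?x ! (j - 1)"] valid_le[OF v(1) j(2)] by simp
  qed
  ultimately consider "j = Suc (Suc k)" | "Suc (Suc k) < j" by linarith
  then show ?thesis
  proof cases
    case 1
    have eq: "rem ?x j = zs[Suc k := nxt zs k]"
      using k(1) 1 n(1) j(2) by (auto simp: rem_def ins_def upd_conv_take_nth_drop take_Suc_conv_app_nth Suc_diff_Suc)
    moreover have "continues zs k"
      using j 1 n(1,3) n(4)[of "Suc (Suc k)"] by (simp add: continues_def)
    ultimately show ?thesis using j(4) by simp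
  next
    \<comment> \<open>Removing a later break point leaves the type B prefix intact, and type B lists
      are dead ends.\<close>
    case 2
    have jl: "j < length ?x" using j by simp
    note r = rem_nth[OF jl]
    have vr: "valid (rem ?x j)" using valid_rem[OF v(1) j(1-3)] .
    have nx: "nxt (rem ?x j) i = nxt ?x i" if "i \<le> Suc k" for i
      using that 2 r(2)[of 0] r(2)[of "i - 1"] by (auto simp: nxt_def)
    have "typeB (rem ?x j) (Suc k)"
      unfolding typeB_def pre_def
    proof (intro conjI allI impI)
      fix i assume "i < Suc k"
      then show "rem ?x j ! Suc i = nxt (rem ?x j) i" using nx[of i] r(2)[of "Suc i"] 2 v(2) by (auto simp: typeB_def pre_def)
    next
      show "rem ?x j ! Suc (Suc k) < nxt (rem ?x j) (Suc k)" using nx[of "Suc k"] r(2)[of "Suc (Suc k)"] 2 v(2) by (auto simp: typeB_def)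
    qed (use r(1) 2 j in auto)
    then show ?thesis using typeB_dead[OF vr] typeB_not_critical[OF vr] j(4) by blast
  qed
qed

text \<open>The removed break point has index \<open>k + 2\<close>. Together with the weight of the
  preceding dotted arrow the factor is 1, so continuing a zigzag costs no sign.\<close>

lemma undotted_continue:
  assumes "valid zs" "typeA zs k" "continues zs k"
  shows "undotted (bt (ins zs k)) (bt (zs[Suc k := nxt zs k]))"
    and "Poly_Mapping.lookup (bar_d (bt (ins zs k))) (bt (zs[Suc k := nxt zs k])) = (-1) ^ k"
proof -
  have k: "Suc k < length zs" "pre zs k" "Suc (Suc k) < length zs" "\<not> bad (nxt zs k) (zs ! Suc (Suc k))"
    using assms(2,3) by (auto simp: typeA_def continues_def)
  let ?x = "ins zs k" let ?j = "Suc (Suc k)"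
  note n = ins_nth[OF k(1)] and v = valid_ins[OF assms(1,2)]
  have eq: "rem ?x ?j = zs[Suc k := nxt zs k]"
    using k by (auto simp: rem_def ins_def upd_conv_take_nth_drop take_Suc_conv_app_nth Suc_diff_Suc)
  have nb: "\<not> bad (?x ! (?j - 1)) (?x ! Suc ?j)" using k n(3) n(4)[of "Suc (Suc k)"] by simp
  show "Poly_Mapping.lookup (bar_d (bt ?x)) (bt (zs[Suc k := nxt zs k])) = (-1) ^ k"
    using lookup_bar_d[OF v(1) _ _ nb] n(1) k eq by simp
  have "G_arrow (bt ?x) (bt (rem ?x ?j))"
    using nb n(1) k by (intro iffD2[OF G_arrow_bt[OF v(1)]] exI[of _ ?j]) simp
  moreover have "(bt ?x, bt (rem ?x ?j)) \<notin> matching"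
  proof
    assume "(bt ?x, bt (rem ?x ?j)) \<in> matching"
    then obtain l where l: "pre ?x (Suc l)" "\<not> pre ?x (Suc (Suc l))" "Suc (Suc l) < length ?x" "bt (rem ?x ?j) = bt (rem ?x (Suc l))"
      using matching_source[OF v(1)] by metis
    have "Suc l = Suc k" using type_unique[OF l(1,2)] v(2) type_not_pre(2) by (auto simp: typeB_def)
    then have "bt (rem ?x ?j) = bt zs" using l(4) rem_ins[OF k(1)] by simp
    then have "rem ?x ?j = zs"
      using bt_inj[OF valid_rem[OF v(1) _ _ nb] assms(1)] hd_rem[of ?j ?x] hd_rem[of "Suc k" ?x] rem_ins[OF k(1)] n(1) k by simp
    then have "rem ?x ?j = rem ?x (Suc k)" using rem_ins[OF k(1)] by simp
    then show False using rem_inj[OF _ v(1), of ?j "Suc k"] n(1) k by simp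
  qed
  ultimately show "undotted (bt ?x) (bt (zs[Suc k := nxt zs k]))" by (simp add: undotted_def eq)
qed

lemma step_weight_dotted:
  assumes "valid zs" "typeA zs k" shows "step_weight (bt zs) (bt (ins zs k)) = (-1) ^ k"
proof -
  have k: "Suc k < length zs" using assms(2) by (auto simp: typeA_def)
  note n = ins_nth[OF k(1)] and v = valid_ins[OF assms]
  have "\<not> bad (zs ! k) (zs ! Suc k)" using assms(1) k by (simp add: valid_def)
  then have "Poly_Mapping.lookup (bar_d (bt (ins zs k))) (bt zs) = (-1) ^ Suc k"
    using lookup_bar_d[OF v(1), of "Suc k"] n k rem_ins[OF k] by simp
  moreover have "inverse ((-1) ^ k :: 'k) = (-1) ^ k" by (simp add: power_inverse[symmetric])
  ultimately show ?thesis using matching_ins[OF assms] by (simp add: step_weight_def dotted_def)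
qed

text \<open>Finiteness of the zigzag sets follows by induction on the number of break points beyond
  the chain prefix.\<close>

lemma map_typeA:
  assumes zs: "valid zs" "typeA zs k"
  shows "map_h (bt zs) = smul ((-1) ^ k) (Poly_Mapping.single (bt (ins zs k)) 1)
      + (if continues zs k then map_h (bt (zs[Suc k := nxt zs k])) else 0)"
    and "map_p (bt zs) = (if continues zs k then map_p (bt (zs[Suc k := nxt zs k])) else 0)"
proof -
  have fin: "finite (zigzags (bt ys) t)" if "valid ys" "pre ys l" "target_of (bt ys) t" for ys l t
    using that
  proof (induction "length ys - l" arbitrary: ys l t rule: less_induct)
    case less
    show ?case
    proof (cases "\<exists>i. typeA ys i")
      case False
      then show ?thesis using zigzags_dead[OF valid_bar_terms[OF less.prems(1)] _ less.prems(3)] dotted_bt[OF less.prems(1)] by simp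
    next
      case True
      then obtain i where i: "typeA ys i" by blast
      have li: "l \<le> i"
      proof (rule ccontr)
        assume "\<not> l \<le> i"
        then show False using type_not_pre(1)[OF i] pre_le[OF less.prems(2), of "Suc i"] by simp
      qed
      have il: "Suc i < length ys" using i by (simp add: typeA_def)
      show ?thesis
      proof (rule map_step(3)[of "bt ys" "bt (ins ys i)" "continues ys i" "bt (ys[Suc i := nxt ys i])"])
        show "dotted (bt ys) y \<longleftrightarrow> y = bt (ins ys i)" for y
          using dotted_bt[OF less.prems(1)] i typeA_unique by blast
        show "continues ys i \<and> u = bt (ys[Suc i := nxt ys i]) \<or> \<not> critical u \<and> (\<forall>y. \<not> dotted u y)"
          if "undotted (bt (ins ys i)) u" for u using undotted_ins[OF less.prems(1) i that] .
        show "undotted (bt (ins ys i)) (bt (ys[Suc i := nxt ys i]))" if "continues ys i"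
          using undotted_continue(1)[OF less.prems(1) i that] .
        show "finite (zigzags (bt (ys[Suc i := nxt ys i])) t)" if "continues ys i" "target_of (bt ys) t" for t
        proof (rule less.hyps)
          show "valid (ys[Suc i := nxt ys i])" "pre (ys[Suc i := nxt ys i]) (Suc i)"
            by (rule valid_update[OF less.prems(1) i that(1)])+
          show "length (ys[Suc i := nxt ys i]) - Suc i < length ys - l" using li il by simp
          show "target_of (bt (ys[Suc i := nxt ys i])) t" using that(2) by (simp add: target_of_def)
        qed
        show "target_of (bt ys) t" by fact
      qed
    qed
  qed
  have kl: "Suc k < length zs" using zs by (simp add: typeA_def)
  have sw: "step_weight (bt (ins zs k)) (bt (zs[Suc k := nxt zs k])) = (-1) ^ k" if "continues zs k"
    using undotted_continue[OF zs that] undotted_not_dotted by (simp add: step_weight_def)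
  let ?x = "bt (ins zs k)" and ?u = "bt (zs[Suc k := nxt zs k])"
  have d: "dotted (bt zs) y \<longleftrightarrow> y = ?x" for y
    using dotted_bt[OF zs(1)] zs(2) typeA_unique by blast
  have f: "finite (zigzags ?u t)" if "continues zs k" "target_of (bt zs) t" for t
    using fin[OF valid_update[OF zs that(1)]] that(2) by (simp add: target_of_def)
  have ms: "map_h (bt zs) = smul (step_weight (bt zs) ?x)
      (Poly_Mapping.single ?x 1 + (if continues zs k then smul (step_weight ?x ?u) (map_h ?u) else 0))"
    by (rule map_step(1)) (use d undotted_ins[OF zs] undotted_continue(1)[OF zs] f in blast)+
  have mp: "map_p (bt zs) = smul (step_weight (bt zs) ?x)
      (if continues zs k then smul (step_weight ?x ?u) (map_p ?u) else 0)"
    by (rule map_step(2)) (use d undotted_ins[OF zs] undotted_continue(1)[OF zs] f in blast)+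
  have "((-1) ^ k * (-1) ^ k :: 'k) = 1" by (simp flip: power_add)
  then show "map_h (bt zs) = smul ((-1) ^ k) (Poly_Mapping.single (bt (ins zs k)) 1)
      + (if continues zs k then map_h (bt (zs[Suc k := nxt zs k])) else 0)"
    "map_p (bt zs) = (if continues zs k then map_p (bt (zs[Suc k := nxt zs k])) else 0)"
    unfolding ms mp using sw by (auto simp: step_weight_dotted[OF zs] smul_add)
qed

end

section \<open>The transferred comultiplications\<close>

context tip_presentation begin

definition FF :: "nat \<Rightarrow> ('a, 'b) bar \<Rightarrow> (('a, 'b) bar list \<Rightarrow>\<^sub>0 'k)" where
  "FF n y = lin (tensor_power map_p) (Delta_bar n y)"

text \<open>The case \<open>n = 1\<close> implements the convention that the first comultiplication
  composed with h is the identity.\<close>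

definition Phi :: "nat \<Rightarrow> ('a, 'b) bar \<Rightarrow> (('a, 'b) bar list \<Rightarrow>\<^sub>0 'k)" where
  "Phi n y = (if n = 1 then lin (\<lambda>t. Poly_Mapping.single [t] 1) (map_p y) else lin (FF n) (map_h y))"

lemma Phi_lin_Delta_bar: "n \<noteq> 1 \<Longrightarrow> lin (tensor_power map_p) (lin (Delta_bar n) (map_h y)) = Phi n y"
  by (simp add: Phi_def FF_def[abs_def] lin_lin)

text \<open>
  Only the summand \<open>s = 1\<close> of \<open>Delta_bar\<close> survives if \<open>map_h\<close> vanishes on the left factors.
\<close>
lemma FF_recursion:
  assumes n: "1 \<le> n" and h: "\<And>j. 1 \<le> j \<Longrightarrow> j < length ws \<Longrightarrow> map_h (x, take j ws) = 0"
  shows "FF (Suc n) (x, ws) = (\<Sum>j = 1..<length ws. smul ((-1) ^ (Suc n * Suc j))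
     (tens (lin (\<lambda>t. Poly_Mapping.single [t] 1) (map_p (x, take j ws)))
       (Phi n (fst (ws ! j), drop j ws))))"
proof (cases "n = 1")
  case True
  have "Delta_bar (Suc n) (x, ws) = bar_coprod (x, ws)" using True by (simp add: Delta_bar.simps)
  then show ?thesis
    using True by (simp add: FF_def bar_coprod_def lin_sum tensor_power_simps Phi_def)
next
  case False
  then have n2: "2 \<le> n" using n by simp
  define g where "g = (\<lambda>a. lin (Delta_bar n) (map_h a))"
  define T where "T = (\<lambda>s. smul ((-1) ^ (s * (Suc n - s + 1)))
     (lin (koszul_tensor
             (\<lambda>a. if s = 1 then Poly_Mapping.single [a] 1 else lin (Delta_bar s) (map_h a))
             (\<lambda>a. if Suc n - s = 1 then Poly_Mapping.single [a] 1
                  else lin (Delta_bar (Suc n - s)) (map_h a))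
             (Suc n - s - 1))
       (bar_coprod (x, ws))))"
  have "Delta_bar (Suc n) (x, ws) = (\<Sum>s\<in>{1..<Suc n}. T s)"
    using n2 unfolding T_def by (subst Delta_bar.simps) simp
  also have "\<dots> = (\<Sum>s\<in>{1}. T s)"
  proof (rule sum.mono_neutral_right)
    show "\<forall>s\<in>{1..<Suc n} - {1}. T s = 0"
      using h by (auto simp: T_def bar_coprod_def lin_sum koszul_tensor_def intro!: sum.neutral)
  qed (use n2 in auto)
  also have "\<dots> = (\<Sum>j = 1..<length ws. smul ((-1) ^ Suc n) (smul ((-1) ^ ((n - 1) * j))
      (tens (Poly_Mapping.single [(x, take j ws)] 1) (g (fst (ws ! j), drop j ws)))))"
    using n2 by (simp add: T_def bar_coprod_def lin_sum koszul_tensor_def smul_sum g_def bar_degree_def)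
  finally have D: "Delta_bar (Suc n) (x, ws) = (\<Sum>j = 1..<length ws. smul ((-1) ^ Suc n) (smul ((-1) ^ ((n - 1) * j))
      (tens (Poly_Mapping.single [(x, take j ws)] 1) (g (fst (ws ! j), drop j ws)))))" .
  \<comment> \<open>The first factor is the sign of the summand \<open>s = 1\<close>, the second the
    Koszul sign of a map of degree \<open>n - 1\<close> passing a left factor of degree
    \<open>j\<close>.\<close>
  have sgn: "(- 1 :: 'k) ^ Suc n * (-1) ^ ((n - 1) * j) = (-1) ^ (Suc n * Suc j)" for j
    unfolding power_add[symmetric] using n2 by (intro minus_one_power_cong) auto
  show ?thesis
    unfolding FF_def D lin_sum
    by (intro sum.cong refl)
      (simp only: smul_smul sgn, simp only: lin_smul lin_tensor_power_tens lin_single smul_one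
        tensor_power_single g_def Phi_lin_Delta_bar[OF False])
qed

lemma chains_take: "(x, ws) \<in> chains n \<Longrightarrow> k \<le> n \<Longrightarrow> (x, take k ws) \<in> chains k"
proof -
  assume c: "(x, ws) \<in> chains n" "k \<le> n"
  have comp: "composable x us \<Longrightarrow> composable x (take k us)" for x us k
    by (induction us arbitrary: x k) (auto simp: take_Cons')
  have "((x, []) # take k ws) ! i = ((x, []) # ws) ! i" if "i < k" for i
    using that by (cases i) auto
  then show ?thesis
    using c comp by (auto simp: chains_def bar_terms_def successively_Cons_nth dest: in_set_takeD)
qed

text \<open>A term on a matching arrow has a proper prefix that is not a chain, whereas all prefixes
  of a chain are chains.\<close>

lemma chains_unmatched:
  assumes "t \<in> chains n" shows "(s, t) \<notin> matching" "(t, s) \<notin> matching"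
proof -
  obtain x ws where t: "t = (x, ws)" by (cases t)
  have len: "length ws = n" using assms by (simp add: t chains_def)
  show "(s, t) \<notin> matching"
  proof
    assume "(s, t) \<in> matching"
    then obtain us w vs q where m: "ws = us @ [w] @ vs" "t \<in> Vset q (length us) (length ws)"
      unfolding matching_def mem_Collect_eq prod.case by (elim conjE exE) (rule that, auto simp: t)
    then show False using chains_take[of x ws n "Suc (length us)"] assms len by (auto simp: Vset_def t)
  qed
  show "(t, s) \<notin> matching"
  proof
    assume "(t, s) \<in> matching"
    then obtain us w w' vs q where m: "ws = us @ [w, w'] @ vs" "t \<in> Vset q (Suc (length us)) (length ws)"
      unfolding matching_def mem_Collect_eq prod.case by (elim conjE exE) (rule that, auto simp: t)
    then show False using chains_take[of x ws n "Suc (Suc (length us))"] assms len by (auto simp: Vset_def t)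
  qed
qed

lemma chains_dead: "t \<in> chains n \<Longrightarrow> \<not> dotted t s"
  using chains_unmatched by (simp add: dotted_def)

lemma chains_bar_terms: "t \<in> chains n \<Longrightarrow> t \<in> bar_terms"
  by (auto simp: chains_def)

lemma chains_critical: "t \<in> chains n \<Longrightarrow> critical t"
  using chains_unmatched chains_bar_terms by (simp add: critical_def)

end

context toupie_algebra begin

lemma map_chains: "t \<in> chains n \<Longrightarrow> map_h t = 0" "t \<in> chains n \<Longrightarrow> map_p t = Poly_Mapping.single t 1"
  using map_h_dead map_p_dead chains_dead chains_critical chains_bar_terms by simp_all

end

context tip_free_path begin

lemma bt_prefix: "1 \<le> j \<Longrightarrow> (vert (hd xs), take j (pieces xs)) = bt (take (Suc j) xs)"
  by (cases xs) (auto simp: bt_def take_pieces)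

lemma bt_suffix: "Suc j < length xs \<Longrightarrow> (fst (pieces xs ! j), drop j (pieces xs)) = bt (drop j xs)"
  by (simp add: bt_def drop_pieces hd_drop_conv_nth piece_def)

lemma map_bt_chain: "chain xs \<Longrightarrow> map_h (bt xs) = 0" "chain xs \<Longrightarrow> map_p (bt xs) = Poly_Mapping.single (bt xs) 1"
  using map_chains chain_bt[of xs] by (auto simp: chain_def)

lemma map_bt_typeB: "valid xs \<Longrightarrow> typeB xs k \<Longrightarrow> map_h (bt xs) = 0" "valid xs \<Longrightarrow> typeB xs k \<Longrightarrow> map_p (bt xs) = 0"
  using map_h_dead[OF valid_bar_terms typeB_dead] map_p_dead[OF valid_bar_terms typeB_dead] typeB_not_critical
  by simp_all

lemma take_typeB: "typeB xs k \<Longrightarrow> k < j \<Longrightarrow> Suc j \<le> length xs \<Longrightarrow> typeB (take (Suc j) xs) k"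
  by (auto simp: typeB_def pre_def nxt_def)

text \<open>Left factors with at most \<open>k\<close> pieces are chains, longer ones are of type B.
  So h vanishes on all of them and p on the longer ones, which cuts the sum off at
  \<open>k\<close>.\<close>

lemma FF_bt:
  assumes xs: "valid xs" "pre xs k" and k: "Suc k = length xs \<or> typeB xs k" and n: "1 \<le> n"
  shows "FF (Suc n) (bt xs) = (\<Sum>j \<in> {j. 1 \<le> j \<and> j \<le> k \<and> Suc j < length xs}. smul ((-1) ^ (Suc n * Suc j))
     (tens (Poly_Mapping.single [bt (take (Suc j) xs)] 1) (Phi n (bt (drop j xs)))))"
proof -
  have pB: "typeB (take (Suc j) xs) k" if "k < j" "Suc j < length xs" for j
    using k take_typeB that by auto
  have "map_h (vert (hd xs), take j (pieces xs)) = 0" if j: "1 \<le> j" "j < length (pieces xs)" for j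
  proof (cases "j \<le> k")
    case True
    then show ?thesis using map_bt_chain(1)[OF take_chain[OF xs j(1)]] bt_prefix[OF j(1), of xs] by simp
  next
    case False
    then show ?thesis using map_bt_typeB(1)[OF take_valid[OF xs(1) j(1)] pB] bt_prefix[OF j(1), of xs] j by simp
  qed
  then have "FF (Suc n) (bt xs) = (\<Sum>j = 1..<length (pieces xs). smul ((-1) ^ (Suc n * Suc j))
     (tens (lin (\<lambda>t. Poly_Mapping.single [t] 1) (map_p (vert (hd xs), take j (pieces xs))))
       (Phi n (fst (pieces xs ! j), drop j (pieces xs)))))"
    unfolding bt_def by (rule FF_recursion[OF n])
  also have "\<dots> = (\<Sum>j = 1..<length (pieces xs). if j \<le> k then smul ((-1) ^ (Suc n * Suc j))
     (tens (Poly_Mapping.single [bt (take (Suc j) xs)] 1) (Phi n (bt (drop j xs)))) else 0)"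
  proof (rule sum.cong[OF refl])
    fix j assume "j \<in> {1..<length (pieces xs)}"
    then have j: "1 \<le> j" "Suc j < length xs" by auto
    show "smul ((-1) ^ (Suc n * Suc j)) (tens (lin (\<lambda>t. Poly_Mapping.single [t] 1) (map_p (vert (hd xs), take j (pieces xs))))
       (Phi n (fst (pieces xs ! j), drop j (pieces xs)))) =
      (if j \<le> k then smul ((-1) ^ (Suc n * Suc j))
       (tens (Poly_Mapping.single [bt (take (Suc j) xs)] 1) (Phi n (bt (drop j xs)))) else 0)"
    proof (cases "j \<le> k")
      case True
      then show ?thesis
        using map_bt_chain(2)[OF take_chain[OF xs j(1)]] bt_prefix[OF j(1), of xs] bt_suffix[OF j(2)] by simp
    next
      case False
      then show ?thesis
        using map_bt_typeB(2)[OF take_valid[OF xs(1) j(1)] pB] bt_prefix[OF j(1), of xs] j by simp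
    qed
  qed
  also have "\<dots> = (\<Sum>j \<in> {j \<in> {1..<length (pieces xs)}. j \<le> k}. smul ((-1) ^ (Suc n * Suc j))
     (tens (Poly_Mapping.single [bt (take (Suc j) xs)] 1) (Phi n (bt (drop j xs)))))"
    by (rule sum.inter_filter[symmetric]) simp
  also have "{j \<in> {1..<length (pieces xs)}. j \<le> k} = {j. 1 \<le> j \<and> j \<le> k \<and> Suc j < length xs}"
    by auto
  finally show ?thesis .
qed

sublocale transfer_recursion "length as" bad bt "\<lambda>n xs. Phi n (bt xs)" "\<lambda>n xs. FF n (bt xs)"
proof
  fix n :: nat and xs :: "nat list" and k
  assume n: "1 \<le> n"
  show "Phi n (bt xs) = (if n = 1 then Poly_Mapping.single [bt xs] 1 else 0)" if "chain xs"
    using map_bt_chain[OF that] by (simp add: Phi_def)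
  show "Phi n (bt xs) = 0" if "valid xs" "typeB xs k"
    using map_bt_typeB[OF that] by (simp add: Phi_def)
  show "Phi n (bt xs) = (if n = 1 then 0 else smul ((-1) ^ k) (FF n (bt (ins xs k))))
        + (if continues xs k then Phi n (bt (xs[Suc k := nxt xs k])) else 0)" if "valid xs" "typeA xs k"
    using map_typeA[OF that] by (simp add: Phi_def lin_add)
  assume xs: "valid xs" "typeB xs k"
  then have "{j. 1 \<le> j \<and> j \<le> k \<and> Suc j < length xs} = {1..k}" by (auto simp: typeB_def)
  then show "FF (Suc n) (bt xs) = (\<Sum>j = 1..k. smul ((-1) ^ (Suc n * Suc j))
         (tens (Poly_Mapping.single [bt (take (Suc j) xs)] 1) (Phi n (bt (drop j xs)))))"
    using FF_bt[OF xs(1), of k n] xs(2) n by (simp add: typeB_def)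
qed

end

context toupie_algebra begin

lemma bar_path_qpaths: "(x, ws) \<in> bar_terms \<Longrightarrow> bar_path (x, ws) \<in> qpaths"
proof (induction ws arbitrary: x)
  case Nil
  then show ?case by (auto simp: bar_path_def pconcat_def bar_terms_def qpaths_def awalk_Nil_iff)
next
  case (Cons w ws)
  have w: "w \<in> NonTip" "fst w = x" using Cons.prems by (auto simp: bar_terms_def)
  then have wq: "w \<in> qpaths" by (simp add: NonTip_def)
  then have "tgt w \<in> verts Q" using qpaths_tgt by fastforce
  then have "(tgt w, ws) \<in> bar_terms" using Cons.prems by (auto simp: bar_terms_def)
  then have "pcat w (bar_path (tgt w, ws)) \<in> qpaths"
    using qpaths_pcat[OF wq Cons.IH] by (simp add: bar_path_def pconcat_def)
  then show ?case using w by (simp add: bar_path_def pconcat_def pcat_def)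
qed

end

section \<open>Decompositions of a chain as words\<close>

context tip_free_path begin

lemma bt_exists:
  assumes "(vert p, ws) \<in> bar_terms" "ws \<noteq> []" "concat (map snd ws) = take l (drop p as)" "p + l \<le> length as"
  shows "\<exists>xs. valid xs \<and> hd xs = p \<and> last xs = p + l \<and> bt xs = (vert p, ws)"
  using assms
proof (induction ws arbitrary: p l)
  case Nil
  then show ?case by simp
next
  case (Cons w ws)
  define c where "c = length (snd w)"
  have w: "w \<in> NonTip" "fst w = vert p" "snd w \<noteq> []" and rest: "composable (tgt w) ws" "\<forall>v\<in>set ws. v \<in> NonTip \<and> snd v \<noteq> []"
    using Cons.prems(1) by (auto simp: bar_terms_def)
  have app: "snd w @ concat (map snd ws) = take l (drop p as)" using Cons.prems(3) by simp
  have len: "c + length (concat (map snd ws)) = l" using arg_cong[OF app, of length] Cons.prems(4) by (simp add: c_def)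
  have "snd w = take c (take l (drop p as))" unfolding app[symmetric] by (simp add: c_def)
  then have "snd w = take c (drop p as)" using len by (simp add: min_def)
  then have wp: "w = piece p (p + c)" unfolding piece_def by (intro prod_eqI) (use w in \<open>simp_all only: fst_conv snd_conv diff_add_inverse\<close>)
  have c0: "0 < c" "p + c \<le> length as" using w len Cons.prems(4) by (auto simp: c_def)
  have nb: "\<not> bad p (p + c)" using w(1) piece_NonTip[of p "p + c"] c0 wp by simp
  show ?case
  proof (cases "ws = []")
    case True
    then have "l = c" using len by simp
    then have "valid [p, p + c]" using c0 nb by (auto simp: valid_def less_Suc_eq)
    moreover have "bt [p, p + c] = (vert p, w # ws)" using True wp by (simp add: bt_def pieces_Cons)
    ultimately show ?thesis using \<open>l = c\<close> by (intro exI[of _ "[p, p + c]"]) simp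
  next
    case False
    have "tgt w = vert (p + c)" unfolding wp by (simp add: tgt_piece)
    then have "(vert (p + c), ws) \<in> bar_terms" using rest vert_verts[of "p + c"] c0 by (simp add: bar_terms_def)
    moreover have "concat (map snd ws) = take (l - c) (drop (p + c) as)"
    proof -
      have "concat (map snd ws) = drop c (take l (drop p as))" unfolding app[symmetric] by (simp add: c_def)
      then show ?thesis by (simp add: drop_take add.commute)
    qed
    ultimately obtain xs where xs: "valid xs" "hd xs = p + c" "last xs = p + c + (l - c)" "bt xs = (vert (p + c), ws)"
      using Cons.IH[of "p + c" "l - c"] False Cons.prems(4) len by auto
    obtain a ys where a: "xs = a # ys" using xs(1) valid_hd_last(2) by (cases xs) auto
    have "valid (p # xs)"
      unfolding valid_def
    proof (intro conjI allI impI)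
      have "p < y" if "y \<in> set xs" for y
        using xs(1,2) that c0 by (auto simp: a valid_def)
      then show "sorted_wrt (<) (p # xs)" using xs(1) by (simp add: valid_def)
      fix i assume "Suc i < length (p # xs)"
      then show "\<not> bad ((p # xs) ! i) ((p # xs) ! Suc i)"
        using xs(1,2) nb by (cases i) (auto simp: valid_def a)
    qed (use xs c0 in \<open>auto simp: valid_def\<close>)
    moreover have "bt (p # xs) = (vert p, w # ws)"
      using xs(2,4) wp by (simp add: bt_def a pieces_Cons)
    ultimately show ?thesis using xs len by (intro exI[of _ "p # xs"]) (simp add: a)
  qed
qed

lemma bt_chains_exists:
  assumes "\<delta> \<in> chains (Suc r)" "fst \<delta> = vert p" "snd (bar_path \<delta>) = take l (drop p as)" "p + l \<le> length as"
  shows "\<exists>xs. chain xs \<and> hd xs = p \<and> last xs = p + l \<and> bt xs = \<delta>"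
proof -
  obtain ws where d: "\<delta> = (vert p, ws)" using assms(2) by (cases \<delta>) auto
  have "ws \<noteq> []" "(vert p, ws) \<in> bar_terms" using assms(1) by (auto simp: d chains_def)
  then obtain xs where xs: "valid xs" "hd xs = p" "last xs = p + l" "bt xs = \<delta>"
    using bt_exists[of p ws l] assms by (auto simp: d bar_path_def pconcat_def)
  have "length (snd (bt xs)) = Suc r" using xs(4) assms(1) by (auto simp: chains_def)
  then have "length xs - 1 = Suc r" by (simp add: bt_def)
  then have "chain xs" using chain_bt[OF xs(1)] xs(4) assms(1) by simp
  then show ?thesis using xs by blast
qed

lemma chain_index_bt: "chain_index (bt xs) = length xs - 2"
  by (simp add: chain_index_def)

lemma chain_length: "chain xs \<Longrightarrow> 2 \<le> length xs"
  by (simp add: chain_def valid_def)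

lemma decomposition_words:
  assumes "\<forall>\<delta>\<in>set \<delta>s. \<exists>r. \<delta> \<in> chains (Suc r)" "composable (vert p) (map bar_path \<delta>s)"
    "concat (map snd (map bar_path \<delta>s)) = drop p as" "p \<le> length as"
  shows "\<exists>cs. word p cs \<and> map bt cs = \<delta>s"
  using assms
proof (induction \<delta>s arbitrary: p)
  case Nil
  then have "p = length as" by simp
  then have "word p []" by (simp only: word.simps)
  then show ?case by (intro exI[of _ "[]"]) simp
next
  case (Cons \<delta> \<delta>s)
  define l where "l = length (snd (bar_path \<delta>))"
  have app: "snd (bar_path \<delta>) @ concat (map snd (map bar_path \<delta>s)) = drop p as" using Cons.prems(3) by simp
  have pl: "p + l \<le> length as" using arg_cong[OF app, of length] Cons.prems(4) by (simp add: l_def)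
  have sl: "snd (bar_path \<delta>) = take l (drop p as)" unfolding app[symmetric] by (simp add: l_def)
  have dl: "concat (map snd (map bar_path \<delta>s)) = drop (p + l) as"
  proof -
    have "drop l (drop p as) = concat (map snd (map bar_path \<delta>s))" unfolding app[symmetric] by (simp add: l_def)
    then show ?thesis by (simp add: add.commute)
  qed
  have fd: "fst (bar_path \<delta>) = vert p" using Cons.prems(2) by simp
  then have "fst \<delta> = vert p" by (simp add: bar_path_def pconcat_def)
  then obtain xs where xs: "chain xs" "hd xs = p" "last xs = p + l" "bt xs = \<delta>"
    using bt_chains_exists[of \<delta> _ p l] Cons.prems(1) sl pl by auto
  have vx: "valid xs" using xs(1) by (simp add: chain_def)
  have "tgt (bar_path \<delta>) = vert (p + l)"
    using bar_path_bt[OF vx] xs by (simp add: tgt_piece)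
  then have "composable (vert (p + l)) (map bar_path \<delta>s)" using Cons.prems(2) by simp
  then obtain cs where "word (p + l) cs" "map bt cs = \<delta>s"
    using Cons.IH[of "p + l"] Cons.prems(1) dl pl by auto
  then show ?case using xs by (intro exI[of _ "xs # cs"]) simp
qed

lemma word_decomposition:
  assumes "word p cs"
  shows "(\<forall>\<delta>\<in>set (map bt cs). \<exists>r. \<delta> \<in> chains (Suc r)) \<and> composable (vert p) (map bar_path (map bt cs)) \<and>
    concat (map snd (map bar_path (map bt cs))) = drop p as \<and>
    (\<Sum>\<delta>\<leftarrow>map bt cs. chain_index \<delta>) + length cs = degsum cs"
  using assms
proof (induction cs arbitrary: p)
  case Nil
  then show ?case by simp
next
  case (Cons c cs)
  have c: "chain c" "hd c = p" "word (last c) cs" using Cons.prems by auto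
  have vc: "valid c" using c by (simp add: chain_def)
  have len: "2 \<le> length c" using chain_length c by simp
  have "bt c \<in> chains (Suc (length c - 2))" using chain_bt[OF vc] c len by (simp add: Suc_diff_Suc numeral_2_eq_2)
  moreover have bp: "bar_path (bt c) = piece p (last c)" using bar_path_bt[OF vc] c by simp
  moreover have pl: "p < last c" "last c \<le> length as" using valid_hd_last(1)[OF vc] c word_le by auto
  moreover have "take (last c - p) (drop p as) @ drop (last c) as = drop p as"
    using pl append_take_drop_id[of "last c - p" "drop p as"] by simp
  ultimately show ?case using Cons.IH[OF c(3)] len
    by (auto simp: chain_index_bt tgt_piece) (auto simp: piece_def)
qed

lemma map_bt_inj:
  "word p cs \<Longrightarrow> word p cs' \<Longrightarrow> map bt cs = map bt cs' \<Longrightarrow> cs = cs'"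
proof (induction cs arbitrary: p cs')
  case (Cons c cs)
  then obtain c' ds where c': "cs' = c' # ds" "bt c = bt c'" "map bt cs = map bt ds" by auto
  have "c = c'" using bt_inj[of c c'] c' Cons.prems by (auto simp: chain_def)
  then show ?case using Cons.IH[of "last c" ds] Cons.prems c' by auto
qed simp

text \<open>An r-chain has r + 1 pieces. With \<open>r = length b - 2\<close> and r equal to the sum
  of the r_i plus 1, the total degree is \<open>length b + n - 3\<close>.\<close>

lemma decompositions_words:
  assumes b: "chain b" "hd b = 0" "last b = length as"
  shows "decompositions n (bt b) = map bt ` words n (length b + n - 3) 0" "inj_on (map bt) (words n d 0)"
proof -
  have vb: "valid b" using b by (simp add: chain_def)
  have path_b: "bar_path (bt b) = (vert 0, as)" using bar_path_bt[OF vb] b by (simp add: piece_def)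
  have fst_b: "fst (bt b) = vert 0" by (simp add: bt_def b)
  have len: "2 \<le> length b" using chain_length b by simp
  show "decompositions n (bt b) = map bt ` words n (length b + n - 3) 0"
  proof
    show "decompositions n (bt b) \<subseteq> map bt ` words n (length b + n - 3) 0"
    proof
      fix \<delta>s assume d: "\<delta>s \<in> decompositions n (bt b)"
      then obtain cs where cs: "word 0 cs" "map bt cs = \<delta>s"
        using decomposition_words[of \<delta>s 0] by (auto simp: decompositions_def fst_b path_b pconcat_def)
      have "degsum cs = length b + n - 3"
        using word_decomposition[OF cs(1)] d cs(2) len by (auto simp: decompositions_def chain_index_bt)
      then show "\<delta>s \<in> map bt ` words n (length b + n - 3) 0" using cs d by (auto simp: words_def decompositions_def)
    qed
    show "map bt ` words n (length b + n - 3) 0 \<subseteq> decompositions n (bt b)"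
    proof
      fix \<delta>s assume "\<delta>s \<in> map bt ` words n (length b + n - 3) 0"
      then obtain cs where cs: "word 0 cs" "length cs = n" "degsum cs = length b + n - 3" "\<delta>s = map bt cs"
        by (auto simp: words_def)
      have "n \<noteq> 0"
      proof
        assume "n = 0"
        then have "length as = 0" using cs by simp
        then show False using valid_hd_last(1)[OF vb] b by simp
      qed
      then show "\<delta>s \<in> decompositions n (bt b)"
        unfolding decompositions_def mem_Collect_eq
      proof (intro conjI)
        note w = word_decomposition[OF cs(1), folded cs(4)]
        show "length \<delta>s = n" using cs by simp
        show "\<forall>\<delta>\<in>set \<delta>s. \<exists>r. \<delta> \<in> chains (Suc r)" "composable (fst (bt b)) (map bar_path \<delta>s)"
          "pconcat (fst (bt b)) (map bar_path \<delta>s) = bar_path (bt b)"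
          using w unfolding fst_b path_b pconcat_def drop_0 by blast+
        have "(\<Sum>\<delta>\<leftarrow>\<delta>s. chain_index \<delta>) + n = length b + n - 3" using w cs by simp
        then show "chain_index (bt b) = (\<Sum>\<delta>\<leftarrow>\<delta>s. chain_index \<delta>) + 1"
          using \<open>n \<noteq> 0\<close> len unfolding chain_index_bt by linarith
      qed
    qed
  qed
  show "inj_on (map bt) (words n d 0)"
    using map_bt_inj by (auto simp: inj_on_def words_def)
qed

text \<open>Merging neighbouring pieces of a chain gives a bad piece, so no arrow leaves it and the
  trivial zigzag is the only one.\<close>

lemma map_i_bt:
  assumes "chain b" shows "map_i (bt b) = Poly_Mapping.single (bt b) 1"
proof -
  have vb: "valid b" using assms by (simp add: chain_def)
  have bt: "bt b \<in> bar_terms" by (rule valid_bar_terms[OF vb])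
  have nu: "\<not> undotted (bt b) t" for t
  proof
    assume "undotted (bt b) t"
    then obtain j where j: "1 \<le> j" "Suc j < length b" "\<not> bad (b ! (j - 1)) (b ! Suc j)"
      using G_arrow_bt[OF vb] by (auto simp: undotted_def)
    then have "b ! Suc j = E (b ! (j - 1))" using assms by (auto simp: chain_def pre_def nxt_def)
    then show False using j(3) E_le_iff[of "b ! Suc j" "b ! (j - 1)"] valid_le[OF vb j(2)] by simp
  qed
  have "zigzags (bt b) t = (if bt b = t then {[bt b]} else {})" for t
  proof -
    have "zs = [bt b]" if zs: "zigzag zs" "hd zs = bt b" for zs
    proof (cases zs)
      case (Cons a rest)
      then show ?thesis using zs nu chain_dead[OF assms] by (cases rest) (auto simp: zigzag_Cons)
    qed (use zs in \<open>simp add: zigzag_def\<close>)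
    then have "zigzags (bt b) t \<subseteq> {[bt b]}" by (auto simp: zigzags_def)
    moreover have "[bt b] \<in> zigzags (bt b) t \<longleftrightarrow> bt b = t" using bt by (auto simp: zigzags_def)
    ultimately show ?thesis by auto
  qed
  then have tw: "total_weight (bt b) t = (if bt b = t then 1 else 0)" for t
    by (simp add: total_weight_zigzags)
  show ?thesis
  proof (rule poly_mapping_eqI)
    fix t
    show "Poly_Mapping.lookup (map_i (bt b)) t = Poly_Mapping.lookup (Poly_Mapping.single (bt b) 1) t"
      unfolding lookup_map_i tw lookup_single using bt by (auto simp: when_def)
  qed
qed

section \<open>Comultiplications of chains without tips, and of single branches\<close>

text \<open>All proper prefixes of \<open>b\<close> are chains, so every splitting contributes,
  including the even ones; the sign of the splitting survives only here, at the first
  factor.\<close>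

lemma Delta_bt:
  assumes b: "chain b" "hd b = 0" "last b = length as" and n: "2 \<le> n"
  shows "Delta (Suc n) (bt b) = (\<Sum>\<delta>s\<in>decompositions (Suc n) (bt b). Poly_Mapping.single \<delta>s ((-1) ^ sign_exponent (Suc n) \<delta>s))"
proof -
  have vb: "valid b" and pb: "pre b (length b - 1)" using b by (auto simp: chain_def)
  have len: "2 \<le> length b" using chain_length b by simp
  define D where "D = length b - 1"
  have D: "length b = Suc D" "1 \<le> D" using len by (auto simp: D_def)
  have bE: "b ! Suc (Suc i) = E (b ! i)" if "Suc (Suc i) \<le> D" for i
    using pb that D by (auto simp: pre_def nxt_def)
  have bD: "b ! D = length as" using valid_ne(2)[OF vb] b(3) by (simp add: D_def)
  define c where "c = (\<lambda>i. if i \<le> D then b ! i else Suc (length as))"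
  have base: "base c D"
    unfolding base_def
  proof (intro conjI allI impI)
    fix i assume i: "i < D"
    show "c i \<le> c (Suc i)" using i valid_less[OF vb, of i "Suc i"] D by (simp add: c_def)
    show "c (Suc (Suc i)) = E (c i)"
    proof (cases "Suc (Suc i) \<le> D")
      case True
      then show ?thesis using bE by (simp add: c_def)
    next
      case False
      then have e: "Suc i = D" using i by simp
      then have "\<not> bad (b ! i) (length as)" using vb D bD by (auto simp: valid_def)
      then have "length as < E (b ! i)" using less_E_iff by simp
      then show ?thesis using e E_le_Suc[of "b ! i"] by (simp add: c_def)
    qed
  qed (use D bD in \<open>auto simp: c_def\<close>)
  have tail: "Phi n (bt (drop j b)) = (\<Sum>cs\<in>words n (D + n - 1 - j) (b ! j). Poly_Mapping.single (map bt cs) 1)"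
    and tail_facts: "valid (drop j b)" "slow (drop j b)" "last (drop j b) = length as" "hd (drop j b) = b ! j"
    if j: "1 \<le> j" "j < D" for j
  proof -
    show v: "valid (drop j b)" using sub_valid[OF vb] j D by simp
    have ge: "drop j b ! Suc (Suc i) = E (drop j b ! i)" if "Suc (Suc i) < length (drop j b)" for i
      using bE[of "j + i"] that D by (simp add: add.commute)
    then show s: "slow (drop j b)" by (simp add: slow_def)
    have ng: "\<not> even_gap (drop j b)" using ge by (auto simp: even_gap_def)
    show l: "last (drop j b) = length as" using b(3) j D by simp
    show h: "hd (drop j b) = b ! j" using j D by (simp add: hd_drop_conv_nth)
    have "dominates c D (drop j b)" using j D by (auto simp: dominates_def c_def)
    then have "Phi n (bt (drop j b)) = target n (drop j b)"
      using Phi_eq_target[OF base _ v s l] n by simp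
    also have "\<dots> = (\<Sum>cs\<in>words n (D + n - 1 - j) (b ! j). Poly_Mapping.single (map bt cs) 1)"
    proof -
      have "length (drop j b) + n - 2 = D + n - 1 - j" using D j n by simp
      then show ?thesis using ng h by (simp add: target_def)
    qed
    finally show "Phi n (bt (drop j b)) = (\<Sum>cs\<in>words n (D + n - 1 - j) (b ! j). Poly_Mapping.single (map bt cs) 1)" .
  qed
  have J: "{j. 1 \<le> j \<and> j \<le> D \<and> Suc j < length b} = {1..<D}" using D by auto
  have "Delta (Suc n) (bt b) = FF (Suc n) (bt b)"
    by (simp add: Delta_def map_i_bt[OF b(1)] FF_def)
  also have "\<dots> = (\<Sum>j = 1..<D. smul ((-1) ^ (Suc n * Suc j))
     (tens (Poly_Mapping.single [bt (take (Suc j) b)] 1) (Phi n (bt (drop j b)))))"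
    unfolding J[symmetric] by (rule FF_bt[OF vb pb[folded D_def]]) (use D n in auto)
  also have "\<dots> = (\<Sum>j = 1..<D. \<Sum>cs\<in>(#) (take (Suc j) b) ` words n (D + n - 1 - j) (b ! j).
      Poly_Mapping.single (map bt cs) ((-1) ^ sign_exponent (Suc n) (map bt cs)))"
  proof (rule sum.cong[OF refl])
    fix j assume "j \<in> {1..<D}"
    then have j: "1 \<le> j" "j < D" by auto
    \<comment> \<open>The first chain contributes \<open>(n + 1) * (j - 1)\<close>, of the parity of
      \<open>(n + 1) * (j + 1)\<close>. The middle chains have odd degree, so their chain indices
      are even, and the last chain does not enter the exponent.\<close>
    have sign: "(-1 :: 'k) ^ sign_exponent (Suc n) (map bt (take (Suc j) b # cs)) = (-1) ^ (Suc n * Suc j)"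
      if cs: "cs \<in> words n (D + n - 1 - j) (b ! j)" for cs
    proof (rule minus_one_power_cong)
      let ?ds = "map bt (take (Suc j) b # cs)"
      have lc: "length cs = n" "word (hd (drop j b)) cs" "degsum cs = D + n - 1 - j"
        using cs tail_facts(4)[OF j] by (auto simp: words_def)
      have "degsum cs + 2 = length (drop j b) + length cs" using lc D j n by simp
      have odd: "odd (length (cs ! i) - 1)" if "Suc i < n" for i
        by (rule top_word_odd[OF tail_facts(1-3)[OF j] lc(2)]) (use \<open>degsum cs + 2 = length (drop j b) + length cs\<close> lc(1) n that in auto)
      have c0: "chain_index (?ds ! 0) = j - 1" using j D by (simp add: chain_index_bt)
      have ev: "even ((Suc n - i) * chain_index (?ds ! (i - 1)))" if i: "i \<in> {2..n}" for i
      proof -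
        obtain l where l: "i = Suc (Suc l)" using i by (metis add_2_eq_Suc atLeastAtMost_iff le_Suc_ex)
        have "length (cs ! l) - 2 = length (cs ! l) - 1 - 1" by simp
        moreover have "odd (length (cs ! l) - 1)" using odd[of l] i l by simp
        moreover have "?ds ! (i - 1) = bt (cs ! l)" using l i lc(1) by simp
        ultimately show ?thesis by (simp add: chain_index_bt)
      qed
      have "(\<Sum>i = 1..n. (Suc n - i) * chain_index (?ds ! (i - 1))) =
          n * (j - 1) + (\<Sum>i = 2..n. (Suc n - i) * chain_index (?ds ! (i - 1)))"
      proof -
        have "{1..n} = insert 1 {2..n}" using n by auto
        then show ?thesis using c0 by simp
      qed
      moreover have "even (\<Sum>i = 2..n. (Suc n - i) * chain_index (?ds ! (i - 1)))"
        using ev by (intro dvd_sum) auto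
      ultimately show "even (sign_exponent (Suc n) ?ds) = even (Suc n * Suc j)"
        unfolding sign_exponent_def c0 diff_Suc_1 using j by auto
    qed
    have "smul ((-1) ^ (Suc n * Suc j)) (tens (Poly_Mapping.single [bt (take (Suc j) b)] 1) (Phi n (bt (drop j b)))) =
        (\<Sum>cs\<in>words n (D + n - 1 - j) (b ! j). Poly_Mapping.single (map bt (take (Suc j) b # cs)) ((-1) ^ (Suc n * Suc j)))"
      by (simp add: tail[OF j] tens_sum_right smul_sum)
    also have "\<dots> = (\<Sum>cs\<in>words n (D + n - 1 - j) (b ! j). Poly_Mapping.single (map bt (take (Suc j) b # cs))
        ((-1) ^ sign_exponent (Suc n) (map bt (take (Suc j) b # cs))))"
      by (intro sum.cong refl) (simp only: sign)
    finally show "smul ((-1) ^ (Suc n * Suc j)) (tens (Poly_Mapping.single [bt (take (Suc j) b)] 1) (Phi n (bt (drop j b)))) =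
        (\<Sum>cs\<in>(#) (take (Suc j) b) ` words n (D + n - 1 - j) (b ! j).
          Poly_Mapping.single (map bt cs) ((-1) ^ sign_exponent (Suc n) (map bt cs)))"
      by (simp add: sum.reindex)
  qed
  also have "\<dots> = (\<Sum>cs\<in>words (Suc n) (D + n - 1) 0.
      Poly_Mapping.single (map bt cs) ((-1) ^ sign_exponent (Suc n) (map bt cs)))"
  proof -
    have first: "words (Suc n) (D + n - 1) (hd b) =
        (\<Union>j\<in>{j. j < D \<and> 1 \<le> j \<and> j \<le> D \<and> j \<le> D + n - 1}. (#) (take (Suc j) b) ` words n (D + n - 1 - j) (b ! j))"
    proof (rule words_split)
      fix f cs assume w: "word (hd b) (f # cs)" "length (f # cs) = Suc n"
      have f: "chain f" "hd f = hd b" "word (last f) cs" using w by auto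
      then have vf: "valid f" by (simp add: chain_def)
      have "cs \<noteq> []" using w(2) n by auto
      then have "last f < length as" by (rule word_less[OF f(3)])
      \<comment> \<open>A chain as long as \<open>b\<close> would already reach the end of the path,
        leaving nothing for the other factors.\<close>
      have "length f \<le> D"
      proof (rule ccontr)
        assume "\<not> ?thesis"
        then have "f ! D = b ! D" using chain_unique[OF f(1) pb f(2), of D] by (simp add: D_def)
        moreover have "f ! D \<le> last f" using valid_ne(2)[OF vf] valid_mono[OF vf, of D "length f - 1"] \<open>\<not> length f \<le> D\<close> by simp
        ultimately show False using bD \<open>last f < length as\<close> by simp
      qed
      then show "length f - 1 < D \<and> length f \<le> Suc D" using D by auto
    qed (use pb vb b(3) in \<open>auto simp: D_def\<close>)
    have J': "{j. j < D \<and> 1 \<le> j \<and> j \<le> D \<and> j \<le> D + n - 1} = {1..<D}" using n by auto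
    have ne: "take (Suc i) b \<noteq> take (Suc j) b" if "i \<in> {1..<D}" "j \<in> {1..<D}" "i \<noteq> j" for i j
    proof -
      have "length (take (Suc i) b) \<noteq> length (take (Suc j) b)" using that D by auto
      then show ?thesis by metis
    qed
    show ?thesis
      unfolding first[unfolded b(2) J']
      by (rule sum.UNION_disjoint[symmetric]) (use ne in \<open>auto simp: finite_words\<close>)
  qed
  also have "\<dots> = (\<Sum>\<delta>s\<in>decompositions (Suc n) (bt b). Poly_Mapping.single \<delta>s ((-1) ^ sign_exponent (Suc n) \<delta>s))"
  proof -
    have "length b + Suc n - 3 = D + n - 1" using D by simp
    then show ?thesis
      using decompositions_words[OF b, of "Suc n"] by (simp add: sum.reindex)
  qed
  finally show ?thesis .
qed

text \<open>On a path without relations the largest degree equals the number of factors, so the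
  factors are single arrows and their number is the length of the path.\<close>

lemma Phi_free:
  assumes "\<not> bad 0 (length as)" "as \<noteq> []" "1 \<le> n"
  shows "Phi n (x0, [(x0, as)]) = (if length as = n then Poly_Mapping.single (map arrow_chain as) 1 else 0)"
proof -
  have v: "valid [0, length as]" using assms by (auto simp: valid_def less_Suc_eq)
  have bt: "bt [0, length as] = (x0, [(x0, as)])" by (simp add: bt_def pieces_Cons piece_def vert_def)
  \<comment> \<open>The path as one piece serves as its own lower bound: no bad segment starts at 0,
    so E of 0 is the sentinel.\<close>
  define c :: "nat \<Rightarrow> nat" where "c = (\<lambda>i. if i = 0 then 0 else if i = 1 then length as else Suc (length as))"
  have "length as < E 0" using assms(1) less_E_iff by simp
  then have "base c 1" using E_le_Suc[of 0] by (auto simp: base_def c_def)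
  moreover have "dominates c 1 [0, length as]" by (auto simp: dominates_def c_def less_Suc_eq)
  ultimately have "Phi n (bt [0, length as]) = target n [0, length as]"
    using Phi_eq_target[of c 1 n "[0, length as]"] assms(3) v by (simp add: slow_def)
  also have "\<dots> = (\<Sum>cs\<in>words n n 0. Poly_Mapping.single (map bt cs) 1)"
    by (simp add: target_def even_gap_def)
  also have "\<dots> = (if length as = n then Poly_Mapping.single (map arrow_chain as) 1 else 0)"
  proof -
    have "map bt (map (\<lambda>i. [0 + i, 0 + Suc i]) [0..<length as]) = map arrow_chain as"
    proof (rule nth_equalityI)
      fix i assume "i < length (map bt (map (\<lambda>i. [0 + i, 0 + Suc i]) [0..<length as]))"
      then have i: "i < length as" by simp
      have pi: "piece i (Suc i) = (vert i, [as ! i])" using i by (simp add: piece_def take_Suc hd_drop_conv_nth)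
      then have "(vert i, [as ! i]) \<in> qpaths" using piece_qpaths[of i "Suc i"] i by simp
      then have "vert i = tail Q (as ! i)" by (auto simp: qpaths_def awalk_Cons_iff)
      then show "map bt (map (\<lambda>i. [0 + i, 0 + Suc i]) [0..<length as]) ! i = map arrow_chain as ! i"
        using i pi by (simp add: bt_def pieces_Cons arrow_chain_def)
    qed simp
    then show ?thesis by (auto simp: words_arrows)
  qed
  finally show ?thesis by (simp add: bt)
qed

text \<open>A single piece is of type A at index 0: it is matched with its splitting after the first
  arrow, whose only face is the piece itself.\<close>

lemma zigzags_arrow:
  assumes "\<not> bad 0 (length as)" "2 \<le> length as"
  shows "dotted (x0, [(x0, as)]) t \<longleftrightarrow> t = (x0, [piece 0 1, piece 1 (length as)])"
    and "\<not> undotted (x0, [piece 0 1, piece 1 (length as)]) u"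
    and "step_weight (x0, [(x0, as)]) (x0, [piece 0 1, piece 1 (length as)]) = 1"
    and "(x0, [(x0, as)]) \<in> bar_terms"
proof -
  have v: "valid [0, length as]" using assms by (auto simp: valid_def less_Suc_eq)
  have bt: "bt [0, length as] = (x0, [(x0, as)])" "bt [0, 1, length as] = (x0, [piece 0 1, piece 1 (length as)])"
    by (simp_all add: bt_def pieces_Cons piece_def vert_def)
  have A: "typeA [0, length as] 0" using assms by (simp add: typeA_def pre_def nxt_def)
  have ins: "ins [0, length as] 0 = [0, 1, length as]" by (simp add: ins_def nxt_def)
  show d: "dotted (x0, [(x0, as)]) t \<longleftrightarrow> t = (x0, [piece 0 1, piece 1 (length as)])" for t
    using dotted_bt[OF v, of t] A typeA_unique[OF A] bt ins by metis
  show "step_weight (x0, [(x0, as)]) (x0, [piece 0 1, piece 1 (length as)]) = 1"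
    using step_weight_dotted[OF v A] bt ins by simp
  show "(x0, [(x0, as)]) \<in> bar_terms" using valid_bar_terms[OF v] bt by simp
  show "\<not> undotted (x0, [piece 0 1, piece 1 (length as)]) u"
  proof
    assume u: "undotted (x0, [piece 0 1, piece 1 (length as)]) u"
    have vx: "valid [0, 1, length as]" using valid_ins(1)[OF v A] ins by simp
    obtain j where "1 \<le> j" "Suc j < 3" "u = bt (rem [0, 1, length as] j)"
      using u G_arrow_bt[OF vx] bt by (auto simp: undotted_def)
    then have "u = bt [0, length as]" by (cases "j = 1") (auto simp: rem_def)
    then show False using u matching_ins[OF v A] bt ins by (simp add: undotted_def)
  qed
qed

end

context toupie_algebra begin

lemma Delta_tip_free:
  assumes "\<gamma> \<in> chains (Suc r)" "\<not> (\<exists>i<m. subpath (tip i) (bar_path \<gamma>))" "3 \<le> n"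
  shows "Delta n \<gamma> = (\<Sum>\<delta>s\<in>decompositions n \<gamma>. Poly_Mapping.single \<delta>s ((-1) ^ sign_exponent n \<delta>s))"
proof -
  obtain x ws where g: "\<gamma> = (x, ws)" by (cases \<gamma>)
  obtain as where path: "bar_path \<gamma> = (x, as)" by (simp add: g bar_path_def pconcat_def)
  have "(x, ws) \<in> bar_terms" using assms(1) by (auto simp: g chains_def)
  then have q: "(x, as) \<in> qpaths" using bar_path_qpaths[of x ws] path by (simp add: g)
  interpret P: tip_free_path Q z \<omega> I Gmon B4 m \<kappa> C \<rho> tip W x as
    by unfold_locales (use q assms(2) path in auto)
  have "P.vert 0 = x" by (simp add: P.vert_def)
  then obtain b where b: "P.chain b" "hd b = 0" "last b = length as" "P.bt b = \<gamma>"
    using P.bt_chains_exists[OF assms(1), of 0 "length as"] path g by auto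
  obtain n' where "n = Suc n'" "2 \<le> n'" using assms(3) by (cases n) auto
  then show ?thesis using P.Delta_bt[OF b(1-3), of n'] b(4) by simp
qed

section \<open>Chains whose path is the tip of a non monomial relation\<close>

definition hdtl :: "('a, 'b) qpath \<Rightarrow> ('a, 'b) bar" where
  "hdtl \<beta> = (fst \<beta>, [(fst \<beta>, take 1 (snd \<beta>)), (tgt (fst \<beta>, take 1 (snd \<beta>)), drop 1 (snd \<beta>))])"

lemma hdtl_inj: "hdtl \<beta> = hdtl \<beta>' \<Longrightarrow> \<beta> = \<beta>'"
proof -
  have "\<beta> = (fst (hdtl \<beta>), snd (snd (hdtl \<beta>) ! 0) @ snd (snd (hdtl \<beta>) ! 1))" for \<beta>
    by (simp add: hdtl_def)
  then show "hdtl \<beta> = hdtl \<beta>' \<Longrightarrow> \<beta> = \<beta>'" by metis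
qed

lemma arrow_chain_chains: "a \<in> arcs Q \<Longrightarrow> arrow_chain a \<in> chains 1"
proof -
  assume a: "a \<in> arcs Q"
  then have w: "awalk (tail Q a) [a] (head Q a)" by (simp add: awalk_Cons_iff awalk_Nil_iff)
  then have "(tail Q a, [a]) \<in> qpaths" by (rule qpathsI)
  moreover have "\<not> subpath s (tail Q a, [a])" if "s \<in> W" for s
  proof
    assume "subpath s (tail Q a, [a])"
    then obtain xs ys where "[a] = xs @ snd s @ ys" by (auto simp: subpath_def)
    then have "length [a] = length (xs @ snd s @ ys)" by simp
    then have "length (snd s) \<le> 1" by simp
    then show False using W_length[OF that] by simp
  qed
  ultimately have "(tail Q a, [a]) \<in> NonTip" by (auto simp: NonTip_def)
  moreover have "uf_arc (tail Q a, []) (tail Q a, [a])"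
    using a unfolding uf_arc_def uf_verts_def by auto
  ultimately show ?thesis using a by (simp add: arrow_chain_def chains_def bar_terms_def)
qed

context
  fixes i \<beta>
  assumes i: "i < m" and \<beta>: "\<beta> \<in> Poly_Mapping.keys (\<rho> i)"
begin

private lemma branch: "\<beta> \<in> set B4" "\<beta> \<in> branches" "fst \<beta> = z" "\<beta> \<in> qpaths" "2 \<le> length (snd \<beta>)"
proof -
  show B: "\<beta> \<in> set B4" using rho_keys[OF i] \<beta> by blast
  then show "\<beta> \<in> branches" "\<beta> \<in> qpaths" "2 \<le> length (snd \<beta>)"
    using B4_branches B4_length B4_qpaths by blast+
  then show "fst \<beta> = z" by (simp add: branches_def)
qed

text \<open>The first arrow is a chain, so h vanishes on it and p fixes it. The rest of the branch
  contains no element of \<open>W\<close>, even for the tip itself, and \<open>Phi_free\<close>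
  applies.\<close>

lemma FF_hdtl:
  assumes "1 \<le> n"
  shows "FF (Suc n) (hdtl \<beta>) =
    (if length (snd \<beta>) = Suc n then Poly_Mapping.single (map arrow_chain (snd \<beta>)) 1 else 0)"
proof -
  obtain a as where s: "snd \<beta> = a # as" "as \<noteq> []" using branch(5) by (cases "snd \<beta>") (auto simp: Suc_le_eq)
  have bt: "\<beta> = (z, [a] @ as)" using branch(3) s by (cases \<beta>) auto
  define v where "v = tgt (z, [a])"
  have q: "(z, [a]) \<in> qpaths" "(v, as) \<in> qpaths" using branch(4) unfolding bt v_def qpaths_append by auto
  then have a: "a \<in> arcs Q" "tail Q a = z" by (auto simp: qpaths_def awalk_Cons_iff)
  have sub: "subpath s \<beta>" if "subpath s (v, as)" for s
    using that subpath_append_left[of s z "[a]" as] by (simp add: bt v_def)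
  have nW: "\<not> subpath s (v, as)" if "s \<in> W" for s
  proof
    assume sp: "subpath s (v, as)"
    show False
    proof (cases "s \<in> Gmon")
      case True
      then show ?thesis using B4_not_B3[OF branch(1) True] sub[OF sp] by simp
    next
      case False
      \<comment> \<open>A tip is a whole branch, too long to fit into a branch deprived of its first
        arrow.\<close>
      then obtain j where "j < m" "s = tip j" using \<open>s \<in> W\<close> W_cases by blast
      then have "s = \<beta>" using branch_subpath[OF tip_branch branch(2)] sub[OF sp] by simp
      then have "length (snd \<beta>) \<le> length as" using sp by (auto simp: subpath_def)
      then show False by (simp add: s)
    qed
  qed
  interpret P: tip_free_path Q z \<omega> I Gmon B4 m \<kappa> C \<rho> tip W v as
    by unfold_locales (use q(2) nW W_cases in blast)+
  have "P.piece 0 (length as) = (v, as)" by (simp add: P.piece_def P.vert_def)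
  then have "\<not> P.bad 0 (length as)" using P.bad_iff[of 0 "length as"] nW by simp
  then have ph: "Phi n (v, [(v, as)]) = (if length as = n then Poly_Mapping.single (map arrow_chain as) 1 else 0)"
    using P.Phi_free s(2) assms by simp
  have h: "hdtl \<beta> = (z, [(z, [a]), (v, as)])" by (simp add: hdtl_def bt v_def)
  have ac: "(z, [(z, [a])]) = arrow_chain a" using a by (simp add: arrow_chain_def)
  note mc = map_chains[OF arrow_chain_chains[OF a(1)]]
  have "FF (Suc n) (hdtl \<beta>) = tens (Poly_Mapping.single [arrow_chain a] 1) (Phi n (v, [(v, as)]))"
    unfolding h by (subst FF_recursion[OF assms]) (auto simp: ac mc less_Suc_eq)
  then show ?thesis using ph by (simp add: s)
qed

lemma zigzags_hdtl:
  assumes "\<beta> \<noteq> tip i"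
  shows "dotted (z, [\<beta>]) t \<longleftrightarrow> t = hdtl \<beta>" "\<not> undotted (hdtl \<beta>) u"
    "step_weight (z, [\<beta>]) (hdtl \<beta>) = 1" "(z, [\<beta>]) \<in> bar_terms"
proof -
  obtain as where bt: "\<beta> = (z, as)" using branch(3) by (cases \<beta>) auto
  have nt: "\<beta> \<in> NonTip" using rho_key_NonTip[OF i \<beta> assms] .
  interpret P: tip_free_path Q z \<omega> I Gmon B4 m \<kappa> C \<rho> tip W z as
    by unfold_locales (use nt W_cases in \<open>simp add: NonTip_def bt, unfold NonTip_def bt, blast\<close>)
  have whole: "P.piece 0 (length as) = \<beta>" by (simp add: P.piece_def P.vert_def bt)
  then have "\<not> P.bad 0 (length as)" using P.piece_NonTip[of 0 "length as"] nt by simp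
  moreover have "2 \<le> length as" using branch(5) by (simp add: bt)
  moreover have "(z, [P.piece 0 1, P.piece 1 (length as)]) = hdtl \<beta>"
    by (simp add: P.piece_def P.vert_def bt hdtl_def)
  ultimately show "dotted (z, [\<beta>]) t \<longleftrightarrow> t = hdtl \<beta>" "\<not> undotted (hdtl \<beta>) u"
    "step_weight (z, [\<beta>]) (hdtl \<beta>) = 1" "(z, [\<beta>]) \<in> bar_terms"
    using P.zigzags_arrow by (simp_all add: bt)
qed

end

text \<open>The differential rewrites the product of the two pieces by the other branches of the
  relation, each of which is matched with its own splitting. The trivial zigzag accounts for the
  tip, whose coefficient is 1.\<close>

lemma map_i_tip:
  assumes i: "i < m" and g: "hdtl (tip i) \<in> chains 2"
  shows "map_i (hdtl (tip i)) =
    (\<Sum>\<beta>\<in>Poly_Mapping.keys (\<rho> i). Poly_Mapping.single (hdtl \<beta>) (Poly_Mapping.lookup (\<rho> i) \<beta>))"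
proof -
  let ?\<gamma> = "hdtl (tip i)" and ?K = "Poly_Mapping.keys (\<rho> i)"
  define S where "S = ?K - {tip i}"
  have tipK: "tip i \<in> ?K" using rho_tip[OF i i] by (simp add: in_keys_iff)
  have fz: "fst (tip i) = z" using tip_branch[OF i] by (simp add: branches_def)
  have gb: "?\<gamma> \<in> bar_terms" using chains_bar_terms[OF g] .
  have pc: "pcat (snd ?\<gamma> ! 0) (snd ?\<gamma> ! 1) = tip i" by (simp add: hdtl_def pcat_def)
  have "bar_d ?\<gamma> = smul (-1) (lin (\<lambda>p. Poly_Mapping.single (z, [p]) 1) (nf (of_path (tip i))))"
    using pc fz by (simp add: bar_d_def hdtl_def)
  also have "\<dots> = smul (-1) (lin (\<lambda>p. Poly_Mapping.single (z, [p]) 1) (of_path (tip i) - \<rho> i))"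
    by (simp add: nf_tip[OF i])
  finally have d: "bar_d ?\<gamma> = smul (-1) (lin (\<lambda>p. Poly_Mapping.single (z, [p]) 1) (of_path (tip i) - \<rho> i))" .
  have lin_look: "Poly_Mapping.lookup (lin (\<lambda>p. Poly_Mapping.single (z, [p]) (1 :: 'k)) y) t =
      (\<Sum>p\<in>Poly_Mapping.keys y. if t = (z, [p]) then Poly_Mapping.lookup y p else 0)" for y t
    by (auto simp: lin_def lookup_sum lookup_single when_def intro!: sum.cong)
  \<comment> \<open>Two signs cancel: the differential has the sign -1, and the normal form of the
    tip is minus the rest of the relation.\<close>
  have look: "Poly_Mapping.lookup (bar_d ?\<gamma>) (z, [\<beta>]) = (if \<beta> \<in> S then Poly_Mapping.lookup (\<rho> i) \<beta> else 0)" for \<beta>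
  proof -
    have "Poly_Mapping.lookup (bar_d ?\<gamma>) (z, [\<beta>]) = - Poly_Mapping.lookup (of_path (tip i) - \<rho> i) \<beta>"
      unfolding d lookup_smul lin_look by (simp add: in_keys_iff)
    also have "\<dots> = (if \<beta> \<in> S then Poly_Mapping.lookup (\<rho> i) \<beta> else 0)"
      using rho_tip[OF i i] by (auto simp: S_def lookup_minus of_path_def lookup_single when_def in_keys_iff)
    finally show ?thesis .
  qed
  have un: "undotted ?\<gamma> y \<longleftrightarrow> (\<exists>\<beta>\<in>S. y = (z, [\<beta>]))" for y
  proof
    assume "undotted ?\<gamma> y"
    then have ne: "Poly_Mapping.lookup (bar_d ?\<gamma>) y \<noteq> 0" by (simp add: undotted_def G_arrow_def)
    then have "\<exists>\<beta>. y = (z, [\<beta>])"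
      unfolding d lookup_smul lin_look by (rule contrapos_np) (auto intro!: sum.neutral)
    then show "\<exists>\<beta>\<in>S. y = (z, [\<beta>])" using ne look by (auto split: if_splits)
  next
    assume "\<exists>\<beta>\<in>S. y = (z, [\<beta>])"
    then obtain \<beta> where b: "\<beta> \<in> S" "y = (z, [\<beta>])" by blast
    then have "y \<in> bar_terms" using zigzags_hdtl(4)[OF i, of \<beta>] by (auto simp: S_def)
    moreover have "Poly_Mapping.lookup (bar_d ?\<gamma>) y \<noteq> 0" using b look[of \<beta>] by (auto simp: S_def in_keys_iff)
    ultimately show "undotted ?\<gamma> y" using gb chains_unmatched(2)[OF g] by (simp add: undotted_def G_arrow_def)
  qed
  \<comment> \<open>A zigzag from the critical chain must start undotted, towards another branch.
    The dotted arrow from there is forced, and no undotted arrow leaves its end.\<close>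
  have zz: "zigzags ?\<gamma> t = (if t = ?\<gamma> then {[?\<gamma>]} else {}) \<union> {[?\<gamma>, (z, [\<beta>]), hdtl \<beta>] | \<beta>. \<beta> \<in> S \<and> t = hdtl \<beta>}"
    if t: "bar_degree t = 2" for t
  proof
    show "zigzags ?\<gamma> t \<subseteq> (if t = ?\<gamma> then {[?\<gamma>]} else {}) \<union> {[?\<gamma>, (z, [\<beta>]), hdtl \<beta>] | \<beta>. \<beta> \<in> S \<and> t = hdtl \<beta>}"
    proof
      fix zs assume "zs \<in> zigzags ?\<gamma> t"
      then obtain r where r: "zs = ?\<gamma> # r" "zigzag (?\<gamma> # r)" "last (?\<gamma> # r) = t"
        by (cases zs) (auto simp: zigzags_def zigzag_def)
      show "zs \<in> (if t = ?\<gamma> then {[?\<gamma>]} else {}) \<union> {[?\<gamma>, (z, [\<beta>]), hdtl \<beta>] | \<beta>. \<beta> \<in> S \<and> t = hdtl \<beta>}"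
      proof (cases r)
        case Nil
        then show ?thesis using r by simp
      next
        case (Cons y r')
        have "undotted ?\<gamma> y" using r(2) chains_dead[OF g] by (simp add: Cons zigzag_Cons)
        then obtain \<beta> where b: "\<beta> \<in> S" "y = (z, [\<beta>])" using un by blast
        have bK: "\<beta> \<in> ?K" "\<beta> \<noteq> tip i" using b(1) by (auto simp: S_def)
        note zh = zigzags_hdtl[OF i bK]
        show ?thesis
        proof (cases r')
          case Nil
          then have "t = (z, [\<beta>])" using r(3) Cons b(2) by simp
          then show ?thesis using t by (simp add: bar_degree_def)
        next
          case c2: (Cons u r'')
          have z2: "zigzag (y # u # r'')" "dotted y u"
            using r(2) chains_dead[OF g] by (auto simp: Cons c2 zigzag_Cons)
          then have u: "u = hdtl \<beta>" using zh(1) b(2) by simp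
          have "r'' = []"
          proof (cases r'')
            case c3: (Cons v r3)
            then have "undotted u v" using z2 by (auto simp: zigzag_Cons)
            then show ?thesis using zh(2) u by simp
          qed
          then have "zs = [?\<gamma>, (z, [\<beta>]), hdtl \<beta>]" "t = hdtl \<beta>" using r b(2) u Cons c2 by simp_all
          then show ?thesis using b(1) by blast
        qed
      qed
    qed
    show "(if t = ?\<gamma> then {[?\<gamma>]} else {}) \<union> {[?\<gamma>, (z, [\<beta>]), hdtl \<beta>] | \<beta>. \<beta> \<in> S \<and> t = hdtl \<beta>} \<subseteq> zigzags ?\<gamma> t"
    proof
      fix zs assume "zs \<in> (if t = ?\<gamma> then {[?\<gamma>]} else {}) \<union> {[?\<gamma>, (z, [\<beta>]), hdtl \<beta>] | \<beta>. \<beta> \<in> S \<and> t = hdtl \<beta>}"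
      then consider "t = ?\<gamma>" "zs = [?\<gamma>]" | \<beta> where "\<beta> \<in> S" "t = hdtl \<beta>" "zs = [?\<gamma>, (z, [\<beta>]), hdtl \<beta>]"
        by (auto split: if_splits)
      then show "zs \<in> zigzags ?\<gamma> t"
      proof cases
        case 1
        then show ?thesis using gb by (simp add: zigzags_def)
      next
        case 2
        have bK: "\<beta> \<in> ?K" "\<beta> \<noteq> tip i" using 2(1) by (auto simp: S_def)
        note zh = zigzags_hdtl[OF i bK]
        have dd: "dotted (z, [\<beta>]) (hdtl \<beta>)" using zh(1) by simp
        have uu: "undotted ?\<gamma> (z, [\<beta>])" using un 2(1) by blast
        show ?thesis
          using 2 dd uu undotted_not_dotted[OF uu] dotted_bar_terms[OF dd]
          by (simp add: zigzags_def zigzag_Cons)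
      qed
    qed
  qed
  have tw_in: "total_weight ?\<gamma> (hdtl \<beta>) = Poly_Mapping.lookup (\<rho> i) \<beta>" if b: "\<beta> \<in> ?K" for \<beta>
  proof (cases "\<beta> = tip i")
    case True
    have "zigzags ?\<gamma> (hdtl \<beta>) = {[?\<gamma>]}"
      using zz[of "hdtl \<beta>"] True hdtl_inj[of "tip i"] by (auto simp: S_def bar_degree_def hdtl_def[of "tip i"])
    then show ?thesis using True rho_tip[OF i i] by (simp add: total_weight_zigzags)
  next
    case False
    then have bS: "\<beta> \<in> S" using b by (simp add: S_def)
    have "hdtl \<beta> \<noteq> ?\<gamma>" using hdtl_inj False by blast
    have "bar_degree (hdtl \<beta>) = 2" by (simp add: bar_degree_def hdtl_def)
    then have "zigzags ?\<gamma> (hdtl \<beta>) = {[?\<gamma>, (z, [\<beta>]), hdtl \<beta>]}"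
      using zz[of "hdtl \<beta>"] bS hdtl_inj[of \<beta>] \<open>hdtl \<beta> \<noteq> ?\<gamma>\<close>
      by (auto simp del: split_paired_Ex split_paired_All)
    then have "total_weight ?\<gamma> (hdtl \<beta>) = zigzag_weight [?\<gamma>, (z, [\<beta>]), hdtl \<beta>]"
      by (simp add: total_weight_zigzags)
    also have "\<dots> = step_weight ?\<gamma> (z, [\<beta>])"
      using zigzags_hdtl(3)[OF i b False] by (simp add: zigzag_weight_Cons)
    also have "\<dots> = Poly_Mapping.lookup (\<rho> i) \<beta>"
      using look[of \<beta>] bS chains_dead[OF g] by (simp add: step_weight_def)
    finally show ?thesis .
  qed
  have tw_out: "total_weight ?\<gamma> t = 0" if "bar_degree t = 2" "t \<notin> hdtl ` ?K" for t
  proof -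
    have "zigzags ?\<gamma> t = {}" using zz[OF that(1)] that(2) tipK by (auto simp: S_def)
    then show ?thesis by (simp add: total_weight_zigzags)
  qed
  have hb: "hdtl \<beta> \<in> bar_terms" if "\<beta> \<in> ?K" for \<beta>
  proof (cases "\<beta> = tip i")
    case False
    then have "dotted (z, [\<beta>]) (hdtl \<beta>)" using zigzags_hdtl(1)[OF i that] by simp
    then show ?thesis using dotted_bar_terms by blast
  qed (use gb in simp)
  have dg: "bar_degree (hdtl \<beta>) = 2" for \<beta> by (simp add: bar_degree_def hdtl_def)
  show ?thesis
  proof (rule poly_mapping_eqI)
    fix t
    have "(\<Sum>\<beta>\<in>?K. Poly_Mapping.lookup (Poly_Mapping.single (hdtl \<beta>) (Poly_Mapping.lookup (\<rho> i) \<beta>)) t) =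
        Poly_Mapping.lookup (map_i ?\<gamma>) t"
    proof (cases "t \<in> hdtl ` ?K")
      case True
      then obtain \<beta>\<^sub>0 where b: "\<beta>\<^sub>0 \<in> ?K" "t = hdtl \<beta>\<^sub>0" by blast
      have "(\<Sum>\<beta>\<in>?K. Poly_Mapping.lookup (Poly_Mapping.single (hdtl \<beta>) (Poly_Mapping.lookup (\<rho> i) \<beta>)) t) =
          (\<Sum>\<beta>\<in>?K. if \<beta> = \<beta>\<^sub>0 then Poly_Mapping.lookup (\<rho> i) \<beta>\<^sub>0 else 0)"
        using hdtl_inj b(2) by (intro sum.cong refl) (auto simp: lookup_single when_def)
      then show ?thesis using b hb[OF b(1)] tw_in[OF b(1)] by (simp add: lookup_map_i dg)
    next
      case False
      then have "(\<Sum>\<beta>\<in>?K. Poly_Mapping.lookup (Poly_Mapping.single (hdtl \<beta>) (Poly_Mapping.lookup (\<rho> i) \<beta>)) t) = 0"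
        by (intro sum.neutral) (auto simp: lookup_single when_def)
      then show ?thesis using tw_out False by (simp add: lookup_map_i dg)
    qed
    then show "Poly_Mapping.lookup (map_i ?\<gamma>) t = Poly_Mapping.lookup
        (\<Sum>\<beta>\<in>?K. Poly_Mapping.single (hdtl \<beta>) (Poly_Mapping.lookup (\<rho> i) \<beta>)) t"
      by (simp add: lookup_sum)
  qed
qed

text \<open>The first piece is free of tips, so the arrow of the Uf-graph leading to it can only be
  one that starts at a vertex and ends at an arrow of the quiver.\<close>

lemma tip_chain_hdtl:
  assumes "(x, [w\<^sub>0, w\<^sub>1]) \<in> chains k" "pcat w\<^sub>0 w\<^sub>1 = tip i"
  shows "(x, [w\<^sub>0, w\<^sub>1]) = hdtl (tip i)" "k = 2"
proof -
  have w: "w\<^sub>0 \<in> NonTip" "fst w\<^sub>0 = x" "fst w\<^sub>1 = tgt w\<^sub>0" "uf_arc (x, []) w\<^sub>0"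
    using assms(1) by (auto simp: chains_def bar_terms_def)
  show "k = 2" using assms(1) by (auto simp: chains_def)
  have "of_path (pcat (x, []) w\<^sub>0) \<notin> tip_ideal"
    using w(1,2) tip_ideal_iff[of w\<^sub>0] by (cases w\<^sub>0) (auto simp: pcat_def NonTip_def)
  then obtain a where "w\<^sub>0 = (tail Q a, [a])" using w(4) by (auto simp: uf_arc_def)
  then have a: "w\<^sub>0 = (x, [a])" using w(2) by simp
  have "tip i = (x, a # snd w\<^sub>1)" using assms(2) a by (simp add: pcat_def)
  moreover have "w\<^sub>1 = (tgt (x, [a]), snd w\<^sub>1)" using w(3) a by (cases w\<^sub>1) simp
  ultimately show "(x, [w\<^sub>0, w\<^sub>1]) = hdtl (tip i)" using a by (simp add: hdtl_def)
qed

lemma Delta_tip: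
  assumes "i < m" "(x, [w\<^sub>0, w\<^sub>1]) \<in> chains k" "pcat w\<^sub>0 w\<^sub>1 = tip i" "3 \<le> n"
  shows "Delta n (x, [w\<^sub>0, w\<^sub>1]) = (\<Sum>\<beta>\<in>{\<beta> \<in> Poly_Mapping.keys (\<rho> i). length (snd \<beta>) = n}.
    Poly_Mapping.single (map arrow_chain (snd \<beta>)) (Poly_Mapping.lookup (\<rho> i) \<beta>))"
proof -
  obtain n' where n: "n = Suc n'" "1 \<le> n'" using assms(4) by (cases n) auto
  note h = tip_chain_hdtl[OF assms(2,3)]
  have g: "hdtl (tip i) \<in> chains 2" using assms(2) h by simp
  have "Delta n (hdtl (tip i)) = (\<Sum>\<beta>\<in>Poly_Mapping.keys (\<rho> i). smul (Poly_Mapping.lookup (\<rho> i) \<beta>) (FF n (hdtl \<beta>)))"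
    by (simp add: Delta_def map_i_tip[OF assms(1) g] lin_sum lin_smul FF_def)
  also have "\<dots> = (\<Sum>\<beta>\<in>Poly_Mapping.keys (\<rho> i). if length (snd \<beta>) = n
      then Poly_Mapping.single (map arrow_chain (snd \<beta>)) (Poly_Mapping.lookup (\<rho> i) \<beta>) else 0)"
    using FF_hdtl[OF assms(1) _ n(2)] n(1) by (intro sum.cong refl) simp
  also have "\<dots> = (\<Sum>\<beta>\<in>{\<beta> \<in> Poly_Mapping.keys (\<rho> i). length (snd \<beta>) = n}.
    Poly_Mapping.single (map arrow_chain (snd \<beta>)) (Poly_Mapping.lookup (\<rho> i) \<beta>))"
    by (rule sum.inter_filter[symmetric]) simp
  finally show ?thesis by (simp add: h)
qed

end

theorem theorem4p7:
  fixes Q :: "('a, 'b) pre_digraph"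
    and I :: "(('a, 'b) qpath \<Rightarrow>\<^sub>0 'k::field_char_0) set"
    and n r :: nat
    and \<gamma> :: "('a, 'b) bar"
  assumes "toupie_algebra Q z \<omega> I Gmon B4 m \<kappa> C \<rho> tip W"
    and "3 \<le> n"
    and "\<gamma> \<in> tip_presentation.chains TYPE('k) Q W (Suc r)"
  shows
    "(\<not> (\<exists>i<m. pre_digraph.subpath Q (tip i) (bar_path \<gamma>)) \<longrightarrow>
        tip_presentation.Delta Q I W n \<gamma> =
          (\<Sum>\<delta>s\<in>tip_presentation.decompositions TYPE('k) Q W n \<gamma>.
             Poly_Mapping.single \<delta>s ((-1) ^ sign_exponent n \<delta>s)))
     \<and>
     (\<forall>i x w\<^sub>0 w\<^sub>1. i < m \<and> \<gamma> = (x, [w\<^sub>0, w\<^sub>1]) \<and> pcat w\<^sub>0 w\<^sub>1 = tip i \<longrightarrow>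
        tip_presentation.Delta Q I W n \<gamma> =
          (\<Sum>\<beta>\<in>{\<beta> \<in> Poly_Mapping.keys (\<rho> i). length (snd \<beta>) = n}.
             Poly_Mapping.single (map (pre_digraph.arrow_chain Q) (snd \<beta>))
               (Poly_Mapping.lookup (\<rho> i) \<beta>)))"
proof -
  interpret toupie_algebra Q z \<omega> I Gmon B4 m \<kappa> C \<rho> tip W by fact
  show ?thesis
    using Delta_tip_free[OF assms(3) _ assms(2)] Delta_tip[OF _ _ _ assms(2)] assms(3) by blast
qed

end
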